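(* Fix positive sequences $\delta_n \searrow 0$ and $\Delta_n \searrow 0$, sequences $K_n$, $s = s_n\ge 1$, $p=p_n$, and constants $C>0$, $c>0$, $0<c'<1/2$, none of which depend on $\Pr$. Let $\mathbf{P}_n$ be the set of data-generating processes $\Pr$ for which the model and Condition HTE($\Pr$) described in the context hold. Then: (1) For any sequence $\Pr=\Pr_n \in \mathbf{P}_n$, $$\sigma_n^{-1}\sqrt{n}(\check\alpha - \alpha_0) \rightsquigarrow N(0,1), \qquad \sigma_n^2 = \mathrm{E}\big[\varphi^2(\alpha_0, y_i, d_i, g(0,z_i), g(1,z_i), m(z_i))\big].$$ (2) The conclusion of (1) continues to hold with $\sigma_n^2$ replaced by $\hat\sigma_n^2 := \mathbb{E}_n\big[\varphi^2(\alpha_0, y_i, d_i, \hat g(0,z_i), \hat g(1,z_i), \hat m(z_i))\big]$. (3) For every $\xi\in(0,1)$, $$\lim_{n\to\infty}\sup_{\Pr\in\mathbf{P}_n}\Big|\Pr\big(\alpha_0 \in [\check\alpha \pm \Phi^{-1}(1-\xi/2)\hat\sigma_n/\sqrt{n}]\big) - (1-\xi)\Big| = 0,$$ where $\Phi$ is the standard normal cdf.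
   Context: Data: an i.i.d. sample $(y_i,d_i,z_i)_{i=1}^n$ on a probability space $(\Omega,\mathfrak F,\Pr)$ ($\Pr$ is called the data-generating process), with binary treatment $d_i\in\{0,1\}$, satisfying $$y_i = g(d_i,z_i)+\zeta_i,\ \mathrm{E}[\zeta_i\mid z_i,d_i]=0, \qquad d_i = m(z_i)+v_i,\ \mathrm{E}[v_i\mid z_i]=0.$$ Let $x_i = P(z_i)\in\mathbb{R}^p$ be a vector of technical controls, $\tilde x_i := (d_i x_i', (1-d_i)x_i')'$, and suppose $$y_i = \tilde x_i'\beta_{g0} + r_{gi} + \zeta_i,\qquad d_i = \Lambda(x_i'\beta_{m0}) + r_{mi} + v_i,$$ i.e. $g(d_i,z_i)=\tilde x_i'\beta_{g0}+r_{gi}$ and $m(z_i)=\Lambda(x_i'\beta_{m0})+r_{mi}$, where $\beta_{g0}=(\beta_{g0,1}',\beta_{g0,0}')'$, $r_{gi},r_{mi}$ are approximation errors, and the link $\Lambda$ is either $\Lambda(u)=u$ or $\Lambda(u)=e^u/(1+e^u)$. The target is the average treatment effect $\alpha_0=\mathrm{E}[g(1,z_i)-g(0,z_i)]$. Given estimators $\hat\beta_g=(\hat\beta_{g,1}',\hat\beta_{g,0}')'$ and $\hat\beta_m$ (e.g. post-Lasso estimators), set $\hat g(d,z)= d\,P(z)'\hat\beta_{g,1}+(1-d)P(z)'\hat\beta_{g,0}$ and $\hat m(z)=\Lambda(P(z)'\hat\beta_m)$. Define $$\varphi(\alpha,y,d,g_0,g_1,m) = \alpha - \frac{d(y-g_1)}{m}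 + \frac{(1-d)(y-g_0)}{1-m} - (g_1-g_0),$$ and let $\check\alpha$ solve $\mathbb{E}_n[\varphi(\check\alpha,y_i,d_i,\hat g(0,z_i),\hat g(1,z_i),\hat m(z_i))]=0$, where $\mathbb{E}_n$ is the sample average. Notation: $\|w_i\|_{\Pr,q}$ is the $L^q(\Pr)$ norm; $\|w_i\|_{\mathbb{P}_n,q}=(n^{-1}\sum_{i=1}^n |w_i|^q)^{1/q}$ is the empirical $L^q$ norm; $\|\cdot\|_0$ counts nonzero entries, $\|\cdot\|_1$ is the $\ell_1$ norm. Condition HTE($\Pr$): (i) $\|r_{gi}\|_{\Pr,2}\le\delta_n n^{-1/4}$, $\|r_{gi}\|_{\Pr,\infty}\le\delta_n$, $\|r_{mi}\|_{\Pr,2}\le\delta_n n^{-1/4}$, $\|r_{mi}\|_{\Pr,\infty}\le\delta_n$. (ii) With $\Pr$-probability at least $1-\Delta_n$: $\|\tilde x_i'(\hat\beta_g-\beta_{g0})\|_{\mathbb{P}_n,2}\le\delta_n n^{-1/4}$, $\|x_i'(\hat\beta_m-\beta_{m0})\|_{\mathbb{P}_n,2}\le\delta_n n^{-1/4}$, $K_n\|\hat\beta_g-\beta_{g0}\|_1\le\delta_n$, $K_n\|\hat\beta_m-\beta_{m0}\|_1\le\delta_n$, $\|\hat\beta_g\|_0\le Cs$, $\|\hat\beta_m\|_0\le Cs$; moreover $\|\beta_{g0}\|_0\le Cs$, $\|\beta_{m0}\|_0\le Cs$, and $\sup_{\|\delta\|_0\le 2Cs}\big|\|\tilde x_i'\delta\|_{\mathbb{P}_n,2}/\|\tilde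 x_i'\delta\|_{\Pr,2}-1\big|\le\delta_n$. (iii) $\|x_{ij}\|_{\Pr,\infty}\le K_n$ for each $j$, $\|g\|_{\Pr,\infty}\le C$, $\|y_i\|_{\Pr,\infty}\le C$, $\Pr(c'\le m(z_i)\le 1-c')=1$, and $\|\zeta_i^2\|_{\Pr,2}\ge c$. (iv) $(s\log(p\vee n))^2/n\le\delta_n$. *)

theory Defs
  imports "HOL-Probability.Probability"
begin

text \<open>Observations are triples (y, d, z) :: real \<times> real \<times> 'z.  The covariate space 'z
carries a fixed sigma-algebra Mz; one observation lives in obsM Mz.
A sample of size n is a function nat \<Rightarrow> obs (coordinates i < n), distributed
according to the n-fold product of the one-observation law Q.\<close>

type_synonym 'z obs = "real \<times> real \<times> 'z"

definition obsM :: "'z measure \<Rightarrow> 'z obs measure" where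
  "obsM Mz = borel \<Otimes>\<^sub>M borel \<Otimes>\<^sub>M Mz"

definition yo :: "'z obs \<Rightarrow> real" where "yo ob = fst ob"
definition dO :: "'z obs \<Rightarrow> real" where "dO ob = fst (snd ob)"
definition zo :: "'z obs \<Rightarrow> 'z" where "zo ob = snd (snd ob)"

definition sigma_dz :: "'z measure \<Rightarrow> 'z obs measure" where
  "sigma_dz Mz = vimage_algebra (space (obsM Mz)) (\<lambda>ob. (dO ob, zo ob)) (borel \<Otimes>\<^sub>M Mz)"
definition sigma_z :: "'z measure \<Rightarrow> 'z obs measure" where
  "sigma_z Mz = vimage_algebra (space (obsM Mz)) zo Mz"

definition sampleM :: "nat \<Rightarrow> 'z obs measure \<Rightarrow> (nat \<Rightarrow> 'z obs) measure" where
  "sampleM n Q = PiM {..<n} (\<lambda>_. Q)"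

definition logistic :: "real \<Rightarrow> real" where
  "logistic u = exp u / (1 + exp u)"

text \<open>Vectors in R^q are represented as nat \<Rightarrow> real, only coordinates j < q matter.\<close>
definition dotp :: "nat \<Rightarrow> (nat \<Rightarrow> real) \<Rightarrow> (nat \<Rightarrow> real) \<Rightarrow> real" where
  "dotp q x b = (\<Sum>j<q. x j * b j)"

definition l1norm :: "nat \<Rightarrow> (nat \<Rightarrow> real) \<Rightarrow> real" where
  "l1norm q b = (\<Sum>j<q. \<bar>b j\<bar>)"

definition l0norm :: "nat \<Rightarrow> (nat \<Rightarrow> real) \<Rightarrow> nat" where
  "l0norm q b = card {j. j < q \<and> b j \<noteq> 0}"

text \<open>x-tilde' b with x-tilde = (d x', (1-d) x')' in R^(2p): the first p coordinates of b
 are the treated block, coordinates p..2p-1 the untreated block.\<close>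
definition xtdot :: "nat \<Rightarrow> (nat \<Rightarrow> real) \<Rightarrow> real \<Rightarrow> (nat \<Rightarrow> real) \<Rightarrow> real" where
  "xtdot p x d b = d * dotp p x b + (1 - d) * dotp p x (\<lambda>j. b (p + j))"

definition L2norm :: "'a measure \<Rightarrow> ('a \<Rightarrow> real) \<Rightarrow> real" where
  "L2norm M f = sqrt (\<integral>x. (f x)\<^sup>2 \<partial>M)"

definition En :: "nat \<Rightarrow> (nat \<Rightarrow> real) \<Rightarrow> real" where
  "En n w = (\<Sum>i<n. w i) / real n"

definition Pn2 :: "nat \<Rightarrow> (nat \<Rightarrow> real) \<Rightarrow> real" where
  "Pn2 n w = sqrt (En n (\<lambda>i. (w i)\<^sup>2))"

definition phi :: "real \<Rightarrow> real \<Rightarrow> real \<Rightarrow> real \<Rightarrow> real \<Rightarrow> real \<Rightarrow> real" where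
  "phi a y d g0 g1 m = a - d * (y - g1) / m + (1 - d) * (y - g0) / (1 - m) - (g1 - g0)"

text \<open>Data-generating process: law Q of one observation, regression functions g and m,
and approximation coefficients beta_g0 (in R^(2p)) and beta_m0 (in R^p).\<close>
record 'z dgp =
  lawQ :: "'z obs measure"
  gfun :: "real \<Rightarrow> 'z \<Rightarrow> real"
  mfun :: "'z \<Rightarrow> real"
  bg0 :: "nat \<Rightarrow> real"
  bm0 :: "nat \<Rightarrow> real"

text \<open>Estimated regression functions: ghat(d,z) and mhat(z) from a sample w, given the
dictionary Pd n z (= x = P(z) in R^(p n)), link Lam and estimator maps bghat, bmhat.\<close>
definition ghat :: "(nat \<Rightarrow> nat) \<Rightarrow> (nat \<Rightarrow> 'z \<Rightarrow> nat \<Rightarrow> real)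
    \<Rightarrow> (nat \<Rightarrow> (nat \<Rightarrow> 'z obs) \<Rightarrow> nat \<Rightarrow> real) \<Rightarrow> nat \<Rightarrow> (nat \<Rightarrow> 'z obs) \<Rightarrow> real \<Rightarrow> 'z \<Rightarrow> real" where
  "ghat p Pd bghat n w d z = xtdot (p n) (Pd n z) d (bghat n w)"

definition mhat :: "(nat \<Rightarrow> nat) \<Rightarrow> (nat \<Rightarrow> 'z \<Rightarrow> nat \<Rightarrow> real) \<Rightarrow> (real \<Rightarrow> real)
    \<Rightarrow> (nat \<Rightarrow> (nat \<Rightarrow> 'z obs) \<Rightarrow> nat \<Rightarrow> real) \<Rightarrow> nat \<Rightarrow> (nat \<Rightarrow> 'z obs) \<Rightarrow> 'z \<Rightarrow> real" where
  "mhat p Pd Lam bmhat n w z = Lam (dotp (p n) (Pd n z) (bmhat n w))"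

definition alpha_check where
  "alpha_check p Pd Lam bghat bmhat n w =
     (THE a. En n (\<lambda>i. phi a (yo (w i)) (dO (w i))
                (ghat p Pd bghat n w 0 (zo (w i))) (ghat p Pd bghat n w 1 (zo (w i)))
                (mhat p Pd Lam bmhat n w (zo (w i)))) = 0)"

definition alpha0 :: "('z, 'b) dgp_scheme \<Rightarrow> real" where
  "alpha0 D = (\<integral>ob. gfun D 1 (zo ob) - gfun D 0 (zo ob) \<partial>lawQ D)"

definition sigma2 :: "('z, 'b) dgp_scheme \<Rightarrow> real" where
  "sigma2 D = (\<integral>ob. (phi (alpha0 D) (yo ob) (dO ob) (gfun D 0 (zo ob)) (gfun D 1 (zo ob)) (mfun D (zo ob)))\<^sup>2 \<partial>lawQ D)"

definition sigmahat2 where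
  "sigmahat2 p Pd Lam bghat bmhat D n w =
     En n (\<lambda>i. (phi (alpha0 D) (yo (w i)) (dO (w i))
                (ghat p Pd bghat n w 0 (zo (w i))) (ghat p Pd bghat n w 1 (zo (w i)))
                (mhat p Pd Lam bmhat n w (zo (w i))))\<^sup>2)"

definition Phi :: "real \<Rightarrow> real" where
  "Phi x = measure std_normal_distribution {..x}"

definition Phi_inv :: "real \<Rightarrow> real" where
  "Phi_inv q = (THE x. Phi x = q)"

definition HTE_class ::
  "'z measure \<Rightarrow> (nat \<Rightarrow> real) \<Rightarrow> (nat \<Rightarrow> real) \<Rightarrow> (nat \<Rightarrow> real) \<Rightarrow> (nat \<Rightarrow> real) \<Rightarrow> (nat \<Rightarrow> nat)
   \<Rightarrow> real \<Rightarrow> real \<Rightarrow> real \<Rightarrow> (nat \<Rightarrow> 'z \<Rightarrow> nat \<Rightarrow> real) \<Rightarrow> (real \<Rightarrow> real)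
   \<Rightarrow> (nat \<Rightarrow> (nat \<Rightarrow> 'z obs) \<Rightarrow> nat \<Rightarrow> real) \<Rightarrow> (nat \<Rightarrow> (nat \<Rightarrow> 'z obs) \<Rightarrow> nat \<Rightarrow> real)
   \<Rightarrow> nat \<Rightarrow> 'z dgp set" where
  "HTE_class Mz \<delta> \<Delta> K s p C c c' Pd Lam bghat bmhat n =
   {D. let Q = lawQ D; g = gfun D; m = mfun D;
           \<zeta> = (\<lambda>ob. yo ob - g (dO ob) (zo ob));
           v = (\<lambda>ob. dO ob - m (zo ob));
           rg = (\<lambda>ob. g (dO ob) (zo ob) - xtdot (p n) (Pd n (zo ob)) (dO ob) (bg0 D));
           rm = (\<lambda>ob. m (zo ob) - Lam (dotp (p n) (Pd n (zo ob)) (bm0 D)));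
           S = sampleM n Q in
     \<comment> \<open>the model\<close>
     prob_space Q \<and> sets Q = sets (obsM Mz) \<and>
     (\<lambda>(d, z). g d z) \<in> borel_measurable (borel \<Otimes>\<^sub>M Mz) \<and> m \<in> borel_measurable Mz \<and>
     (AE ob in Q. dO ob = 0 \<or> dO ob = 1) \<and>
     integrable Q \<zeta> \<and> (AE ob in Q. real_cond_exp Q (sigma_dz Mz) \<zeta> ob = 0) \<and>
     integrable Q v \<and> (AE ob in Q. real_cond_exp Q (sigma_z Mz) v ob = 0) \<and>
     \<comment> \<open>HTE (i)\<close>
     L2norm Q rg \<le> \<delta> n * real n powr (-1/4) \<and> (AE ob in Q. \<bar>rg ob\<bar> \<le> \<delta> n) \<and>
     L2norm Q rm \<le> \<delta> n * real n powr (-1/4) \<and> (AE ob in Q. \<bar>rm ob\<bar> \<le> \<delta> n) \<and>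
     \<comment> \<open>HTE (ii)\<close>
     real (l0norm (2 * p n) (bg0 D)) \<le> C * s n \<and> real (l0norm (p n) (bm0 D)) \<le> C * s n \<and>
     (\<exists>A\<in>sets S. measure S A \<ge> 1 - \<Delta> n \<and> (\<forall>w\<in>A.
        Pn2 n (\<lambda>i. xtdot (p n) (Pd n (zo (w i))) (dO (w i)) (\<lambda>j. bghat n w j - bg0 D j))
          \<le> \<delta> n * real n powr (-1/4) \<and>
        Pn2 n (\<lambda>i. dotp (p n) (Pd n (zo (w i))) (\<lambda>j. bmhat n w j - bm0 D j))
          \<le> \<delta> n * real n powr (-1/4) \<and>
        K n * l1norm (2 * p n) (\<lambda>j. bghat n w j - bg0 D j) \<le> \<delta> n \<and>
        K n * l1norm (p n) (\<lambda>j. bmhat n w j - bm0 D j) \<le> \<delta> n \<and>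
        real (l0norm (2 * p n) (bghat n w)) \<le> C * s n \<and>
        real (l0norm (p n) (bmhat n w)) \<le> C * s n \<and>
        (\<forall>b. real (l0norm (2 * p n) b) \<le> 2 * C * s n \<and>
              L2norm Q (\<lambda>ob. xtdot (p n) (Pd n (zo ob)) (dO ob) b) > 0 \<longrightarrow>
           \<bar>Pn2 n (\<lambda>i. xtdot (p n) (Pd n (zo (w i))) (dO (w i)) b)
              / L2norm Q (\<lambda>ob. xtdot (p n) (Pd n (zo ob)) (dO ob) b) - 1\<bar> \<le> \<delta> n))) \<and>
     \<comment> \<open>HTE (iii)\<close>
     (\<forall>j<p n. AE ob in Q. \<bar>Pd n (zo ob) j\<bar> \<le> K n) \<and>
     (AE ob in Q. \<bar>g (dO ob) (zo ob)\<bar> \<le> C) \<and> (AE ob in Q. \<bar>yo ob\<bar> \<le> C) \<and>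
     (AE ob in Q. c' \<le> m (zo ob) \<and> m (zo ob) \<le> 1 - c') \<and>
     L2norm Q (\<lambda>ob. (\<zeta> ob)\<^sup>2) \<ge> c \<and>
     \<comment> \<open>HTE (iv)\<close>
     (s n * ln (real (max (p n) n)))\<^sup>2 / real n \<le> \<delta> n}"

end

theory Submission
  imports Defs
begin

text \<open>
  Write \<open>\<phi> = \<alpha> - T\<^sub>1 + T\<^sub>0\<close>, where \<open>T\<^sub>1 = d (y - g\<^sub>1) / m + g\<^sub>1\<close> and \<open>T\<^sub>0\<close> is the same expression for the arm
  \<open>(1 - d, g\<^sub>0, 1 - m)\<close>.  For each arm, with indicator \<open>e\<close> and propensity \<open>\<mu>\<close>, the estimation error of
  the score splits as
  \<open>e (y - \<gamma>) (1/\<mu>' - 1/\<mu>) + (1 - e/\<mu>) (\<gamma>' - \<gamma>) - e (\<gamma>' - \<gamma>) (1/\<mu>' - 1/\<mu>)\<close>.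
  The last term is negligible as both nuisance errors are of order \<open>\<delta>\<^sub>n n\<^bsup>-1/4\<^esup>\<close> in empirical
  \<open>L\<^sup>2\<close>-norm.  The first two are, for a fixed coefficient vector, centred sums, but the vector depends on
  the sample.  They are bounded uniformly over sparse vectors \<open>b\<close> with \<open>K \<parallel>b\<parallel>\<^sub>1 \<le> \<delta>\<^sub>n\<close> and population
  second moment of order \<open>\<delta>\<^sub>n\<^sup>2 n\<^bsup>-1/2\<^esup>\<close>: on this class an exponential moment at tilt \<open>1/(L \<delta>\<^sub>n)\<close> gives the
  tail \<open>exp (- \<surd>n (\<epsilon>/(L \<delta>\<^sub>n) - O(1)))\<close> for deviations \<open>\<epsilon> \<surd>n\<close>, which beats the logarithm
  \<open>O(s ln (p \<or> n)) = O(\<surd>(\<delta>\<^sub>n n))\<close> of the size of a single grid, so no chaining is needed.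
  Overlap transfers every condition on the observed arm to both arms.  Asymptotic normality follows
  from a central limit theorem for triangular arrays with bounded rows, and uniformity over the class from
  running the argument along arbitrary subsequences.
\<close>

text \<open>The condition moreover controls the regression error only in empirical norm and only
  through the stacked regressor. The route to a population second moment is therefore: the sparse
  norm comparison turns the empirical norm into a population norm of d x'b, and E[e h(z)] =
  E[mu(z) h(z)] >= c' E[h(z)] removes the indicator. Since the comparison speaks only of the stacked
  regressor, the propensity error is first padded with zeros into the treated block.

  The O(1) in the exponent is the variance cost: n times a second moment of order \<delta>^2
  n^(-1/2), divided by \<delta>^2, is of order sqrt n. The same rate makes the summed product term
  of order \<delta>^2 sqrt n, which vanishes after division by sqrt n.

  A supremum over sparse vectors need not be measurable. Every uniform statement is therefore made
  outside a measurable exceptional event that comes from finitely many grid points and a null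
  set.\<close>

section \<open>Product samples and exponential tails of centred sums\<close>

lemma exp_le_quadratic:
  fixes x :: real
  assumes "\<bar>x\<bar> \<le> 1"
  shows "exp x \<le> 1 + x + x\<^sup>2"
proof (cases "x \<ge> 0")
  case True then show ?thesis using exp_bound[of x] assms by simp
next
  case False
  define y where "y = -x"
  have y: "0 \<le> y" "y \<le> 1" using False assms by (auto simp: y_def)
  \<comment> \<open>For negative arguments the reciprocal of this Taylor lower bound is used; its
    product with \<open>1 - y + y\<^sup>2\<close> exceeds 1 by (y^2 + y^3 + y^4)/2.\<close>
  have "1 + y + y\<^sup>2/2 \<le> exp y" using exp_lower_Taylor_quadratic[of y] y by simp
  then have "inverse (exp y) \<le> inverse (1 + y + y\<^sup>2/2)"
    using y by (intro le_imp_inverse_le) (auto intro!: add_pos_nonneg)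
  then have "exp x \<le> inverse (1 + y + y\<^sup>2/2)"
    by (simp add: y_def exp_minus)
  also have "\<dots> \<le> 1 - y + y\<^sup>2"
  proof -
    have "(1 - y + y\<^sup>2) * (1 + y + y\<^sup>2/2) = 1 + (y\<^sup>2 + y^3 + y^4) / 2"
      by (simp add: field_simps power2_eq_square power3_eq_cube power4_eq_xxxx)
    then have "1 \<le> (1 - y + y\<^sup>2) * (1 + y + y\<^sup>2/2)"
      using y by simp
    then show ?thesis using y
      by (simp add: inverse_eq_divide divide_le_eq add_pos_nonneg)
  qed
  finally show ?thesis by (simp add: y_def)
qed

lemma prob_space_sampleM: "prob_space Q \<Longrightarrow> prob_space (sampleM n Q)"
  unfolding sampleM_def by (rule prob_space_PiM)

lemma AE_sampleM:
  assumes "prob_space Q" "AE x in Q. P x"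
  shows "AE w in sampleM n Q. \<forall>i<n. P (w i)"
proof -
  have "AE w in sampleM n Q. \<forall>i\<in>{..<n}. P (w i)"
    unfolding sampleM_def using assms
    by (intro eventually_ball_finite ballI AE_PiM_component) auto
  then show ?thesis by eventually_elim auto
qed

lemma measurable_sampleM_component:
  "i < n \<Longrightarrow> f \<in> measurable Q N \<Longrightarrow> (\<lambda>w. f (w i)) \<in> measurable (sampleM n Q) N"
  unfolding sampleM_def by (rule measurable_PiM_component_rev) auto

lemma measurable_sample_sum:
  fixes f :: "'z obs \<Rightarrow> real"
  assumes "f \<in> borel_measurable Q"
  shows "(\<lambda>w. \<Sum>i<n. f (w i)) \<in> borel_measurable (sampleM n Q)"
  by (rule borel_measurable_sum) (use assms in \<open>auto intro: measurable_sampleM_component\<close>)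

lemma AE_bounded_integrable:
  fixes f :: "'a \<Rightarrow> real"
  assumes "prob_space Q" "f \<in> borel_measurable Q" "AE x in Q. \<bar>f x\<bar> \<le> B"
  shows "integrable Q f"
proof -
  interpret prob_space Q by fact
  show ?thesis using assms by (intro integrable_const_bound[where B=B]) auto
qed

lemma AE_square_le:
  fixes f :: "'a \<Rightarrow> real"
  assumes "AE x in Q. \<bar>f x\<bar> \<le> B"
  shows "AE x in Q. \<bar>(f x)\<^sup>2\<bar> \<le> B\<^sup>2"
  using assms by eventually_elim (simp add: abs_le_square_iff[symmetric])

lemma AE_bounded_square_integrable:
  fixes f :: "'a \<Rightarrow> real"
  assumes "prob_space Q" "f \<in> borel_measurable Q" "AE x in Q. \<bar>f x\<bar> \<le> B"
  shows "integrable Q (\<lambda>x. (f x)\<^sup>2)"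
  using assms by (intro AE_bounded_integrable[OF _ _ AE_square_le]) auto

text \<open>The codomain is a general field because two transforms of a sum factorise this way: the
  real exponential moment in the tail bounds and the complex characteristic function in the central
  limit theorem.\<close>

lemma integral_sampleM_prod:
  fixes f :: "'z obs \<Rightarrow> 'b::{real_normed_field,banach,second_countable_topology}"
  assumes "prob_space Q" "integrable Q f"
  shows "integrable (sampleM n Q) (\<lambda>w. \<Prod>i<n. f (w i))"
    and "(\<integral>w. (\<Prod>i<n. f (w i)) \<partial>sampleM n Q) = (\<integral>x. f x \<partial>Q) ^ n"
proof -
  interpret prob_space Q by fact
  interpret product_sigma_finite "\<lambda>_::nat. Q" by standard
  show "integrable (sampleM n Q) (\<lambda>w. \<Prod>i<n. f (w i))"
    unfolding sampleM_def by (rule product_integrable_prod) (use assms in auto)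
  show "(\<integral>w. (\<Prod>i<n. f (w i)) \<partial>sampleM n Q) = (\<integral>x. f x \<partial>Q) ^ n"
    unfolding sampleM_def by (subst product_integral_prod) (use assms in auto)
qed

text \<open>Chernoff bound at the single tilt 1/M, with the exponential replaced by its quadratic
  majorant. As \<open>M\<close> need only be an upper bound for |f|, enlarging it is the way to
  choose a smaller tilt.\<close>

lemma sample_sum_tail_upper:
  assumes Q: "prob_space Q" and [measurable]: "f \<in> borel_measurable Q"
    and bd: "AE x in Q. \<bar>f x\<bar> \<le> M" and M: "M > 0"
    and mean: "(\<integral>x. f x \<partial>Q) = 0" and var: "(\<integral>x. (f x)\<^sup>2 \<partial>Q) \<le> v"
  shows "measure (sampleM n Q) {w \<in> space (sampleM n Q). (\<Sum>i<n. f (w i)) \<ge> t}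
    \<le> exp (- t / M + real n * v / M\<^sup>2)"
proof -
  interpret prob_space Q by fact
  interpret S: prob_space "sampleM n Q" by (rule prob_space_sampleM[OF Q])
  have b1: "AE x in Q. \<bar>f x / M\<bar> \<le> 1" using bd by eventually_elim (use M in simp)
  have i0: "integrable Q f" by (rule AE_bounded_integrable[OF Q _ bd]) simp
  have i2: "integrable Q (\<lambda>x. (f x)\<^sup>2)" by (rule AE_bounded_square_integrable[OF Q _ bd]) simp
  have ie: "integrable Q (\<lambda>x. exp (f x / M))"
  proof (rule AE_bounded_integrable[OF Q])
    show "AE x in Q. \<bar>exp (f x / M)\<bar> \<le> exp 1" using b1 by eventually_elim (use M in \<open>simp add: field_simps\<close>)
  qed simp
  have "(\<integral>x. exp (f x / M) \<partial>Q) \<le> (\<integral>x. 1 + f x / M + (f x)\<^sup>2 / M\<^sup>2 \<partial>Q)"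
  proof (rule integral_mono_AE)
    show "AE x in Q. exp (f x / M) \<le> 1 + f x / M + (f x)\<^sup>2 / M\<^sup>2"
      using b1
    proof eventually_elim
      case (elim x)
      then show ?case using exp_le_quadratic[OF elim] by (simp add: power_divide)
    qed
  qed (use i0 i2 ie in auto)
  also have "\<dots> = 1 + (\<integral>x. (f x)\<^sup>2 \<partial>Q) / M\<^sup>2"
    using i0 i2 by (simp add: mean prob_space)
  also have "\<dots> \<le> exp (v / M\<^sup>2)"
    using var M exp_ge_add_one_self[of "v / M\<^sup>2"] by (smt (verit) divide_right_mono zero_le_power2)
  finally have m1: "(\<integral>x. exp (f x / M) \<partial>Q) \<le> exp (v / M\<^sup>2)" .
  have eq: "exp (1 / M * (\<Sum>i<n. f (w i))) = (\<Prod>i<n. exp (f (w i) / M))" for w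
    by (simp add: exp_sum[symmetric] sum_divide_distrib)
  have sumi: "integrable (sampleM n Q) (\<lambda>w. exp (1 / M * (\<Sum>i<n. f (w i))))"
    unfolding eq using integral_sampleM_prod(1)[OF Q ie] .
  have "measure (sampleM n Q) {w \<in> space (sampleM n Q). (\<Sum>i<n. f (w i)) \<ge> t}
     \<le> exp (- (1/M) * t) * (\<integral>w\<in>space (sampleM n Q). exp (1 / M * (\<Sum>i<n. f (w i))) \<partial>sampleM n Q)"
    by (rule S.Chernoff_ineq_ge) (use M sumi in \<open>auto simp: set_integrable_def cong: Bochner_Integration.integrable_cong\<close>)
  also have "(\<integral>w\<in>space (sampleM n Q). exp (1 / M * (\<Sum>i<n. f (w i))) \<partial>sampleM n Q)
     = (\<integral>x. exp (f x / M) \<partial>Q) ^ n"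
    unfolding eq by (simp add: set_integral_space integral_sampleM_prod[OF Q ie])
  also have "\<dots> \<le> exp (v / M\<^sup>2) ^ n"
    by (rule power_mono[OF m1]) simp
  finally have "measure (sampleM n Q) {w \<in> space (sampleM n Q). (\<Sum>i<n. f (w i)) \<ge> t}
     \<le> exp (- (1/M) * t) * exp (v / M\<^sup>2) ^ n" by simp
  also have "\<dots> = exp (- t / M + real n * v / M\<^sup>2)"
    by (simp add: exp_add[symmetric] exp_of_nat_mult[symmetric])
  finally show ?thesis .
qed

lemma sample_sum_tail:
  assumes Q: "prob_space Q" and [measurable]: "f \<in> borel_measurable Q"
    and bd: "AE x in Q. \<bar>f x\<bar> \<le> M" and M: "M > 0"
    and mean: "(\<integral>x. f x \<partial>Q) = 0" and var: "(\<integral>x. (f x)\<^sup>2 \<partial>Q) \<le> v"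
  shows "measure (sampleM n Q) {w \<in> space (sampleM n Q). \<bar>\<Sum>i<n. f (w i)\<bar> \<ge> t}
    \<le> 2 * exp (- t / M + real n * v / M\<^sup>2)"
proof -
  interpret S: prob_space "sampleM n Q" by (rule prob_space_sampleM[OF Q])
  have [measurable]: "(\<lambda>w. \<Sum>i<n. f (w i)) \<in> borel_measurable (sampleM n Q)"
    "(\<lambda>w. \<Sum>i<n. - f (w i)) \<in> borel_measurable (sampleM n Q)"
    by (rule measurable_sample_sum; simp)+
  let ?A = "{w \<in> space (sampleM n Q). (\<Sum>i<n. f (w i)) \<ge> t}"
  let ?B = "{w \<in> space (sampleM n Q). (\<Sum>i<n. - f (w i)) \<ge> t}"
  have "measure (sampleM n Q) {w \<in> space (sampleM n Q). \<bar>\<Sum>i<n. f (w i)\<bar> \<ge> t}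
     \<le> measure (sampleM n Q) (?A \<union> ?B)"
    proof (rule S.finite_measure_mono)
    show "{w \<in> space (sampleM n Q). \<bar>\<Sum>i<n. f (w i)\<bar> \<ge> t} \<subseteq> ?A \<union> ?B"
      unfolding sum_negf by (rule subsetI, simp, arith)
  qed measurable
  also have "\<dots> \<le> measure (sampleM n Q) ?A + measure (sampleM n Q) ?B"
    by (rule measure_Un_le) measurable
  also have "measure (sampleM n Q) ?A \<le> exp (- t / M + real n * v / M\<^sup>2)"
    by (rule sample_sum_tail_upper) (use assms in auto)
  also have "measure (sampleM n Q) ?B \<le> exp (- t / M + real n * v / M\<^sup>2)"
    by (rule sample_sum_tail_upper) (use assms in auto)
  finally show ?thesis by simp
qed

section \<open>Sparse coefficient vectors and uniform deviation over them\<close>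

lemma dotp_diff: "dotp p x (\<lambda>j. a j - b j) = dotp p x a - dotp p x b"
  by (simp add: dotp_def algebra_simps sum_subtractf)

lemma dotp_zero: "dotp p x (\<lambda>_. 0) = 0"
  by (simp add: dotp_def)

lemma abs_dotp_le_l1norm:
  assumes "\<forall>j<p. \<bar>x j\<bar> \<le> K"
  shows "\<bar>dotp p x b\<bar> \<le> K * l1norm p b"
proof -
  have "\<bar>dotp p x b\<bar> \<le> (\<Sum>j<p. \<bar>x j * b j\<bar>)" unfolding dotp_def by (rule sum_abs)
  also have "\<dots> \<le> (\<Sum>j<p. K * \<bar>b j\<bar>)"
    by (rule sum_mono) (use assms in \<open>auto simp: abs_mult intro!: mult_right_mono\<close>)
  finally show ?thesis by (simp add: l1norm_def sum_distrib_left)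
qed

lemma measurable_dotp:
  assumes "\<And>j. j < p \<Longrightarrow> (\<lambda>x. X x j) \<in> borel_measurable M"
  shows "(\<lambda>x. dotp p (X x) b) \<in> borel_measurable M"
  unfolding dotp_def by (rule borel_measurable_sum) (use assms in auto)

text \<open>A sparse grid vector is coded by \<open>k\<close> slots, each holding a coordinate and
  an integer multiple of the mesh. The codes form a finite function space whose cardinality is a
  plain power; different codes may give the same vector, which is harmless for a union
  bound.\<close>

definition grid_vec :: "nat \<Rightarrow> real \<Rightarrow> (nat \<Rightarrow> nat \<times> int) \<Rightarrow> nat \<Rightarrow> real" where
  "grid_vec k \<eta> u j = (\<Sum>l<k. if fst (u l) = j then \<eta> * of_int (snd (u l)) else 0)"

text \<open>Rounding each coordinate towards zero enlarges neither the support nor any absolute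
  value. The rounded vector thus still satisfies the l1 constraint under which the Lipschitz and
  mean-zero properties are available, and the rounding error lives on the support of
  \<open>b\<close>.\<close>

lemma sparse_grid_approx:
  fixes b :: "nat \<Rightarrow> real"
  assumes \<eta>: "\<eta> > 0" and k: "l0norm p b \<le> k" and p: "p > 0"
    and bnd: "l1norm p b \<le> \<eta> * real N"
  obtains u where "u \<in> PiE {..<k} (\<lambda>_. {..<p} \<times> {- int N..int N})"
    and "\<And>j. j < p \<Longrightarrow> \<bar>grid_vec k \<eta> u j\<bar> \<le> \<bar>b j\<bar>"
    and "\<And>j. j < p \<Longrightarrow> \<bar>b j - grid_vec k \<eta> u j\<bar> \<le> (if b j = 0 then 0 else \<eta>)"
proof -
  define S where "S = {j. j < p \<and> b j \<noteq> 0}"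
  have finS: "finite S" by (simp add: S_def)
  have cS: "card S \<le> k" using k by (simp add: l0norm_def S_def)
  obtain h where h: "bij_betw h {..<card S} S"
    using ex_bij_betw_nat_finite[OF finS] by (auto simp: atLeast0LessThan)
  define r where "r j = (if b j \<ge> 0 then \<lfloor>b j / \<eta>\<rfloor> else - \<lfloor>- b j / \<eta>\<rfloor>)" for j
  have r1: "\<bar>\<eta> * of_int (r j)\<bar> \<le> \<bar>b j\<bar> \<and> \<bar>b j - \<eta> * of_int (r j)\<bar> \<le> \<eta>" for j
  proof (cases "b j \<ge> 0")
    case True
    have "of_int \<lfloor>b j / \<eta>\<rfloor> * \<eta> \<le> b j" "b j < (of_int \<lfloor>b j / \<eta>\<rfloor> + 1) * \<eta>"
      using floor_divide_lower[OF \<eta>, of "b j"] floor_divide_upper[OF \<eta>, of "b j"] by auto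
    moreover have "0 \<le> \<lfloor>b j / \<eta>\<rfloor>" using True \<eta> by simp
    ultimately show ?thesis using True \<eta> by (simp add: r_def abs_mult algebra_simps)
  next
    case False
    have "of_int \<lfloor>- b j / \<eta>\<rfloor> * \<eta> \<le> - b j" "- b j < (of_int \<lfloor>- b j / \<eta>\<rfloor> + 1) * \<eta>"
      using floor_divide_lower[OF \<eta>, of "- b j"] floor_divide_upper[OF \<eta>, of "- b j"] by auto
    moreover have "0 \<le> \<lfloor>- b j / \<eta>\<rfloor>" using False \<eta> by (simp add: divide_nonpos_pos)
    ultimately show ?thesis using False \<eta> by (simp add: r_def abs_mult algebra_simps)
  qed
  have r0: "b j = 0 \<Longrightarrow> r j = 0" for j by (simp add: r_def)
  have rN: "r j \<in> {- int N..int N}" if "j < p" for j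
  proof -
    have "\<bar>b j\<bar> \<le> l1norm p b" unfolding l1norm_def
      by (rule member_le_sum) (use that in auto)
    then have "\<bar>\<eta> * of_int (r j)\<bar> \<le> \<eta> * real N"
      using r1[of j] bnd by linarith
    then have "\<eta> * \<bar>of_int (r j)\<bar> \<le> \<eta> * real N"
      using \<eta> by (simp only: abs_mult abs_of_pos)
    then have "\<bar>real_of_int (r j)\<bar> \<le> real N" using \<eta> by simp
    then show ?thesis by auto
  qed
  \<comment> \<open>Slots beyond the support carry the pair (0, 0): a legal code since
    \<open>p > 0\<close>, with multiple 0 and hence no contribution.\<close>
  define u where "u = (\<lambda>l\<in>{..<k}. if l < card S then (h l, r (h l)) else (0, 0))"
  have hS: "l < card S \<Longrightarrow> h l \<in> S" for l using h by (auto simp: bij_betw_def)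
  have uU: "u \<in> PiE {..<k} (\<lambda>_. {..<p} \<times> {- int N..int N})"
    using hS rN p by (auto simp: u_def S_def)
  have gv: "grid_vec k \<eta> u j = \<eta> * of_int (r j)" if "j < p" for j
  proof -
    have "grid_vec k \<eta> u j = (\<Sum>l<k. if l < card S then (if h l = j then \<eta> * of_int (r (h l)) else 0) else 0)"
      unfolding grid_vec_def by (rule sum.cong) (auto simp: u_def)
    also have "\<dots> = (\<Sum>l<card S. if h l = j then \<eta> * of_int (r (h l)) else 0)"
      by (rule sum.mono_neutral_cong_right) (use cS in auto)
    also have "\<dots> = (\<Sum>i\<in>S. if i = j then \<eta> * of_int (r i) else 0)"
      by (rule sum.reindex_bij_betw[OF h])
    also have "\<dots> = \<eta> * of_int (r j)"
      using finS r0[of j] that by (auto simp: S_def)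
    finally show ?thesis .
  qed
  show thesis
  proof (rule that[OF uU])
    fix j assume "j < p"
    then show "\<bar>grid_vec k \<eta> u j\<bar> \<le> \<bar>b j\<bar>" using gv r1 by simp
    show "\<bar>b j - grid_vec k \<eta> u j\<bar> \<le> (if b j = 0 then 0 else \<eta>)"
      using gv[OF \<open>j < p\<close>] r1[of j] r0[of j] by simp
  qed
qed

text \<open>The failure set of an almost sure property may be nonmeasurable; a measurable null hull
  is added to the exceptional event at no cost in probability.\<close>

lemma measure_le_AE_event:
  assumes M: "prob_space M" and A: "A \<in> sets M" and P: "AE w in M. P w"
    and le: "measure M A \<le> \<epsilon>"
  obtains B where "B \<in> sets M" "measure M B \<le> \<epsilon>" "\<And>w. w \<in> space M - B \<Longrightarrow> P w \<and> w \<notin> A"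
proof -
  interpret prob_space M by fact
  obtain N where N: "{w \<in> space M. \<not> P w} \<subseteq> N" "N \<in> sets M" "emeasure M N = 0"
    using P by (rule AE_E)
  have "measure M (A \<union> N) \<le> measure M A + measure M N" using A N by (intro measure_Un_le)
  also have "measure M N = 0" using N by (simp add: measure_def)
  finally show thesis using that[of "A \<union> N"] A N le by auto
qed

text \<open>On the class, |F b| is at most L \<delta> and its second moment at most L^2 times that
  of the linear index, so each grid vector obeys the tail bound at tilt 1/(L \<delta>). A union
  bound covers the grid, and the Lipschitz property carries it to every vector of the class with a
  total loss of L \<delta>. Writing \<open>p + 1\<close> keeps the counting factor at least 1 even
  for \<open>p = 0\<close>.\<close>

lemma sparse_uniform_deviation:
  fixes F :: "(nat \<Rightarrow> real) \<Rightarrow> 'z obs \<Rightarrow> real"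
  assumes Q: "prob_space Q"
    and X: "\<And>j. j < p \<Longrightarrow> (\<lambda>x. X x j) \<in> borel_measurable Q"
    and XK: "AE x in Q. \<forall>j<p. \<bar>X x j\<bar> \<le> K"
    and F: "\<And>b. F b \<in> borel_measurable Q"
    and lip: "AE x in Q. \<forall>b b'. K * l1norm p b \<le> \<delta> \<longrightarrow> K * l1norm p b' \<le> \<delta> \<longrightarrow>
        \<bar>F b x - F b' x\<bar> \<le> L * \<bar>dotp p (X x) b - dotp p (X x) b'\<bar>"
    and zero: "AE x in Q. F (\<lambda>_. 0) x = 0"
    and mean: "\<And>b. K * l1norm p b \<le> \<delta> \<Longrightarrow> (\<integral>x. F b x \<partial>Q) = 0"
    and \<delta>: "\<delta> > 0" and L: "L > 0" and n: "n > 0" and k: "k \<le> n" and t: "t \<ge> 0"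
  shows "\<exists>B\<in>sets (sampleM n Q).
     measure (sampleM n Q) B \<le> (real (p + 1) * (2 * (real n)\<^sup>2 + 1)) ^ k *
        (2 * exp (- t / (L * \<delta>) + real n * (2 * \<rho> + 2 * (\<delta> / real n)\<^sup>2) / \<delta>\<^sup>2)) \<and>
     (\<forall>w\<in>space (sampleM n Q) - B. \<forall>b. l0norm p b \<le> k \<longrightarrow> K * l1norm p b \<le> \<delta> \<longrightarrow>
        (\<integral>x. (dotp p (X x) b)\<^sup>2 \<partial>Q) \<le> \<rho> \<longrightarrow> \<bar>\<Sum>i<n. F b (w i)\<bar> \<le> t + L * \<delta>)"
proof -
  interpret prob_space Q by fact
  interpret S: prob_space "sampleM n Q" by (rule prob_space_sampleM[OF Q])
  let ?S = "sampleM n Q"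
  let ?x = "\<lambda>x. dotp p (X x)" and ?c = "(real (p + 1) * (2 * (real n)\<^sup>2 + 1)) ^ k"
  \<comment> \<open>Rounding may double the second moment and adds twice the squared rounding error
    \<delta>/n of the index.\<close>
  let ?v = "2 * \<rho> + 2 * (\<delta> / real n)\<^sup>2"
  let ?E = "2 * exp (- t / (L * \<delta>) + real n * ?v / \<delta>\<^sup>2)"
  have l10: "K * l1norm p (\<lambda>_. 0) \<le> \<delta>" using \<delta> by (simp add: l1norm_def)
  define good where "good x \<longleftrightarrow> (\<forall>j<p. \<bar>X x j\<bar> \<le> K) \<and> F (\<lambda>_. 0) x = 0 \<and> (\<forall>b b'. K * l1norm p b \<le> \<delta> \<longrightarrow> K * l1norm p b' \<le> \<delta> \<longrightarrow>
        \<bar>F b x - F b' x\<bar> \<le> L * \<bar>?x x b - ?x x b'\<bar>)" for x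
  have good: "AE x in Q. good x" using XK lip zero unfolding good_def by eventually_elim auto
  have goodS: "AE w in ?S. \<forall>i<n. good (w i)" by (rule AE_sampleM[OF Q good])
  have goodF: "\<bar>F b x\<bar> \<le> L * \<bar>?x x b\<bar>" if "good x" "K * l1norm p b \<le> \<delta>" for b x
  proof -
    have "\<bar>F b x - F (\<lambda>_. 0) x\<bar> \<le> L * \<bar>?x x b - ?x x (\<lambda>_. 0)\<bar>"
      using that l10 unfolding good_def by blast
    then show ?thesis using that by (simp add: good_def dotp_zero)
  qed
  have dotp_bd: "AE x in Q. \<bar>?x x b\<bar> \<le> \<delta>" if "K * l1norm p b \<le> \<delta>" for b
    using good
  proof eventually_elim
    case (elim x)
    show ?case using abs_dotp_le_l1norm[of p "X x" K b] that elim by (simp add: good_def)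
  qed
  have di: "integrable Q (\<lambda>x. (?x x b)\<^sup>2)" if "K * l1norm p b \<le> \<delta>" for b
    by (rule AE_bounded_square_integrable[OF Q measurable_dotp[OF X] dotp_bd[OF that]])
  show ?thesis
  \<comment> \<open>The mesh divides by \<open>K\<close> and the codes need a coordinate. Otherwise
    the index vanishes almost surely on the class, and with it \<open>F b\<close>.\<close>
  proof (cases "K > 0 \<and> p > 0")
    case False
    have dp0: "?x x b = 0" if "good x" for x b
    proof (cases "p = 0")
      case True then show ?thesis by (simp add: dotp_def)
    next
      case p: False
      then have "K \<le> 0" using False by simp
      then have "K * l1norm p b \<le> 0" by (simp add: l1norm_def mult_nonpos_nonneg sum_nonneg)
      moreover have "\<bar>?x x b\<bar> \<le> K * l1norm p b"
        by (rule abs_dotp_le_l1norm) (use that in \<open>simp add: good_def\<close>)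
      ultimately show ?thesis by simp
    qed
    obtain B where B: "B \<in> sets ?S" "measure ?S B \<le> 0" "\<And>w. w \<in> space ?S - B \<Longrightarrow> (\<forall>i<n. good (w i)) \<and> w \<notin> {}"
      using measure_le_AE_event[OF S.prob_space_axioms sets.empty_sets goodS, of 0] by auto
    have "\<bar>\<Sum>i<n. F b (w i)\<bar> \<le> t + L * \<delta>" if "w \<in> space ?S - B" "K * l1norm p b \<le> \<delta>" for w b
    proof -
      have "F b (w i) = 0" if "i < n" for i
        using goodF[of "w i" b] dp0[of "w i" b] B(3)[of w] that \<open>w \<in> space ?S - B\<close> \<open>K * l1norm p b \<le> \<delta>\<close> by auto
      then have "(\<Sum>i<n. F b (w i)) = 0" by simp
      then show ?thesis using t L \<delta> by (auto intro!: add_nonneg_nonneg)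
    qed
    then show ?thesis using B(1,2) by (intro bexI[of _ B]) (auto intro: order_trans)
  next
    case True
    then have K: "K > 0" and p: "p > 0" by auto
    \<comment> \<open>With mesh \<delta>/(K n^2), rounding at most k <= n coordinates moves the
      index by at most K n \<eta> = \<delta>/n, and the l1 constraint bounds each coefficient by N
      mesh widths.\<close>
    define N where "N = n\<^sup>2"
    define \<eta> where "\<eta> = \<delta> / (K * real N)"
    have N: "N > 0" using n by (simp add: N_def)
    have \<eta>: "\<eta> > 0" using \<delta> K N by (simp add: \<eta>_def)
    define U where "U = PiE {..<k} (\<lambda>_. {..<p} \<times> {- int N..int N})"
    have finU: "finite U" unfolding U_def by (rule finite_PiE) auto
    have cardU: "real (card U) \<le> ?c"
    proof -
      have "real (card U) = (real p * (2 * (real n)\<^sup>2 + 1)) ^ k"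
        unfolding U_def by (simp add: card_PiE card_cartesian_product N_def nat_add_distrib algebra_simps)
      also have "\<dots> \<le> ?c"
        by (intro power_mono mult_right_mono) auto
      finally show ?thesis .
    qed
    \<comment> \<open>Only grid vectors that themselves lie in the class, with the enlarged second
      moment, have centred sums with the required tail.\<close>
    define V where "V = {u \<in> U. K * l1norm p (grid_vec k \<eta> u) \<le> \<delta> \<and>
        (\<integral>x. (?x x (grid_vec k \<eta> u))\<^sup>2 \<partial>Q) \<le> ?v}"
    define A where "A = (\<Union>u\<in>V. {w \<in> space ?S. \<bar>\<Sum>i<n. F (grid_vec k \<eta> u) (w i)\<bar> \<ge> t})"
    have Au: "{w \<in> space ?S. \<bar>\<Sum>i<n. F b (w i)\<bar> \<ge> t} \<in> sets ?S" for b
    proof -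
      have [measurable]: "(\<lambda>w. \<Sum>i<n. F b (w i)) \<in> borel_measurable ?S"
        by (rule measurable_sample_sum[OF F])
      show ?thesis by measurable
    qed
    have VU: "V \<subseteq> U" by (auto simp: V_def)
    have finV: "finite V" using finU VU by (rule rev_finite_subset)
    have Am: "A \<in> sets ?S" unfolding A_def using finV Au by auto
    have tail: "measure ?S {w \<in> space ?S. \<bar>\<Sum>i<n. F (grid_vec k \<eta> u) (w i)\<bar> \<ge> t} \<le> ?E"
      if u: "u \<in> V" for u
    proof -
      let ?b = "grid_vec k \<eta> u"
      have l1: "K * l1norm p ?b \<le> \<delta>" using u by (simp add: V_def)
      have bnd: "AE x in Q. \<bar>F ?b x\<bar> \<le> L * \<delta>"
        using good dotp_bd[OF l1]
      proof eventually_elim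
        case (elim x)
        then show ?case using goodF[OF elim(1) l1] L by (smt (verit) mult_left_mono)
      qed
      have di: "integrable Q (\<lambda>x. (?x x ?b)\<^sup>2)" by (rule di[OF l1])
      have "(\<integral>x. (F ?b x)\<^sup>2 \<partial>Q) \<le> (\<integral>x. L\<^sup>2 * (?x x ?b)\<^sup>2 \<partial>Q)"
      proof (rule integral_mono_AE)
        show "integrable Q (\<lambda>x. (F ?b x)\<^sup>2)"
          by (rule AE_bounded_square_integrable[OF Q F bnd])
        show "integrable Q (\<lambda>x. L\<^sup>2 * (?x x ?b)\<^sup>2)" using di by simp
        show "AE x in Q. (F ?b x)\<^sup>2 \<le> L\<^sup>2 * (?x x ?b)\<^sup>2" using good
        proof eventually_elim
          case (elim x)
          have "\<bar>F ?b x\<bar>\<^sup>2 \<le> (L * \<bar>?x x ?b\<bar>)\<^sup>2"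
            by (rule power_mono[OF goodF[OF elim l1]]) simp
          then show ?case by (simp add: power_mult_distrib)
        qed
      qed
      also have "\<dots> \<le> L\<^sup>2 * ?v"
        using u by (simp add: V_def mult_left_mono)
      finally have var: "(\<integral>x. (F ?b x)\<^sup>2 \<partial>Q) \<le> L\<^sup>2 * ?v" .
      have "measure ?S {w \<in> space ?S. \<bar>\<Sum>i<n. F ?b (w i)\<bar> \<ge> t}
        \<le> 2 * exp (- t / (L * \<delta>) + real n * (L\<^sup>2 * ?v) / (L * \<delta>)\<^sup>2)"
        by (rule sample_sum_tail[OF Q F bnd _ mean[OF l1] var]) (use L \<delta> in simp)
      also have "real n * (L\<^sup>2 * ?v) / (L * \<delta>)\<^sup>2
          = real n * ?v / \<delta>\<^sup>2"
        using L by (simp add: power_mult_distrib)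
      finally show ?thesis .
    qed
    have "measure ?S A \<le> (\<Sum>u\<in>V. measure ?S {w \<in> space ?S. \<bar>\<Sum>i<n. F (grid_vec k \<eta> u) (w i)\<bar> \<ge> t})"
      unfolding A_def by (rule measure_UNION_le[OF finV Au])
    also have "\<dots> \<le> (\<Sum>u\<in>V. ?E)" by (rule sum_mono[OF tail])
    also have "\<dots> = real (card V) * ?E" by simp
    also have "\<dots> \<le> ?c * ?E"
      using card_mono[OF finU VU] cardU by (intro mult_right_mono) auto
    finally have mA: "measure ?S A \<le> ?c * ?E" .
    obtain B where B: "B \<in> sets ?S" "measure ?S B \<le> ?c * ?E"
        "\<And>w. w \<in> space ?S - B \<Longrightarrow> (\<forall>i<n. good (w i)) \<and> w \<notin> A"
      using measure_le_AE_event[OF S.prob_space_axioms Am goodS mA] by blast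
    have "\<bar>\<Sum>i<n. F b (w i)\<bar> \<le> t + L * \<delta>"
      if w: "w \<in> space ?S - B" and l0: "l0norm p b \<le> k" and l1: "K * l1norm p b \<le> \<delta>"
        and rho: "(\<integral>x. (?x x b)\<^sup>2 \<partial>Q) \<le> \<rho>" for w b
    proof -
      have "l1norm p b \<le> \<eta> * real N" using l1 K N by (simp add: \<eta>_def field_simps)
      then obtain u where u: "u \<in> U"
        and u1: "\<And>j. j < p \<Longrightarrow> \<bar>grid_vec k \<eta> u j\<bar> \<le> \<bar>b j\<bar>"
        and u2: "\<And>j. j < p \<Longrightarrow> \<bar>b j - grid_vec k \<eta> u j\<bar> \<le> (if b j = 0 then 0 else \<eta>)"
        using sparse_grid_approx[OF \<eta> l0 p] unfolding U_def by metis
      let ?b = "grid_vec k \<eta> u"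
      have l1b: "K * l1norm p ?b \<le> \<delta>"
      proof -
        have "l1norm p ?b \<le> l1norm p b" unfolding l1norm_def by (rule sum_mono) (use u1 in auto)
        then show ?thesis using l1 K by (smt (verit) mult_left_mono)
      qed
      have diff: "\<bar>?x x b - ?x x ?b\<bar> \<le> \<delta> / real n" if "good x" for x
      proof -
        have "l1norm p (\<lambda>j. b j - ?b j) \<le> (\<Sum>j<p. if b j = 0 then 0 else \<eta>)"
          unfolding l1norm_def by (rule sum_mono) (use u2 in auto)
        also have "\<dots> = (\<Sum>j\<in>{j. j < p \<and> b j \<noteq> 0}. \<eta>)"
          by (rule sum.mono_neutral_cong_right) auto
        also have "\<dots> \<le> real k * \<eta>"
          using l0 \<eta> by (simp add: l0norm_def)
        also have "\<dots> \<le> real n * \<eta>" using k \<eta> by simp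
        finally have "K * l1norm p (\<lambda>j. b j - ?b j) \<le> K * (real n * \<eta>)" using K by simp
        also have "\<dots> = \<delta> / real n"
          using K n by (simp add: \<eta>_def N_def power2_eq_square)
        finally have "K * l1norm p (\<lambda>j. b j - ?b j) \<le> \<delta> / real n" .
        moreover have "\<bar>?x x (\<lambda>j. b j - ?b j)\<bar> \<le> K * l1norm p (\<lambda>j. b j - ?b j)"
          by (rule abs_dotp_le_l1norm) (use that in \<open>simp add: good_def\<close>)
        ultimately show ?thesis by (simp add: dotp_diff)
      qed
      have "(\<integral>x. (?x x ?b)\<^sup>2 \<partial>Q) \<le> (\<integral>x. 2 * (?x x b)\<^sup>2 + 2 * (\<delta> / real n)\<^sup>2 \<partial>Q)"
      proof (rule integral_mono_AE)
        show "AE x in Q. (?x x ?b)\<^sup>2 \<le> 2 * (?x x b)\<^sup>2 + 2 * (\<delta> / real n)\<^sup>2"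
          using good
        proof eventually_elim
          case (elim x)
          let ?d = "?x x b - ?x x ?b"
          have "?d\<^sup>2 \<le> (\<delta> / real n)\<^sup>2" using power_mono[OF diff[OF elim], of 2] by simp
          \<comment> \<open>With a and a' the index at \<open>b\<close> and at its rounding, the
            difference of the two sides is (2a - a')^2.\<close>
          moreover have "(?x x ?b)\<^sup>2 \<le> 2 * (?x x b)\<^sup>2 + 2 * ?d\<^sup>2"
            using zero_le_power2[of "2 * ?x x b - ?x x ?b"]
            by (simp add: power2_eq_square algebra_simps)
          ultimately show ?case by simp
        qed
      qed (use di[OF l1] di[OF l1b] in auto)
      also have "\<dots> \<le> ?v"
        using di[OF l1] rho by (simp add: prob_space)
      finally have "u \<in> V" using u l1b by (simp add: V_def)
      moreover have "w \<notin> A" and gw: "\<And>i. i < n \<Longrightarrow> good (w i)" using B(3)[OF w] by auto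
      ultimately have s1: "\<bar>\<Sum>i<n. F ?b (w i)\<bar> < t" using w by (force simp: A_def)
      have "\<bar>(\<Sum>i<n. F b (w i)) - (\<Sum>i<n. F ?b (w i))\<bar> \<le> (\<Sum>i<n. \<bar>F b (w i) - F ?b (w i)\<bar>)"
        unfolding sum_subtractf[symmetric] by (rule sum_abs)
      also have "\<dots> \<le> (\<Sum>i<n. L * (\<delta> / real n))"
      proof (rule sum_mono)
        fix i assume "i \<in> {..<n}"
        then have g: "good (w i)" using gw by simp
        have "\<bar>F b (w i) - F ?b (w i)\<bar> \<le> L * \<bar>?x (w i) b - ?x (w i) ?b\<bar>"
          using g l1 l1b unfolding good_def by blast
        also have "\<dots> \<le> L * (\<delta> / real n)" using diff[OF g] L by (intro mult_left_mono) auto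
        finally show "\<bar>F b (w i) - F ?b (w i)\<bar> \<le> L * (\<delta> / real n)" .
      qed
      also have "\<dots> = L * \<delta>" using n by simp
      finally show ?thesis using s1 by linarith
    qed
    then show ?thesis using B(1,2) by blast
  qed
qed

section \<open>The standard normal distribution function and its quantiles\<close>

interpretation std_normal: real_distribution std_normal_distribution
  by (rule real_dist_normal_dist)

lemma Phi_eq_cdf: "Phi = cdf std_normal_distribution"
  by (simp add: fun_eq_iff Phi_def cdf_def2)

text \<open>The density is positive everywhere, so both measures have the same null sets. Null
  singletons then give continuity of \<open>Phi\<close>, non-null intervals its strict
  monotonicity.\<close>

lemma std_normal_null_sets_iff:
  "A \<in> null_sets std_normal_distribution \<longleftrightarrow> A \<in> null_sets lborel"
  by (auto simp: null_sets_density_iff normal_density_pos AE_iff_null_sets AE_not_in less_imp_neq[OF normal_density_pos, symmetric])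

lemma std_normal_singleton: "measure std_normal_distribution {x} = 0"
  using std_normal_null_sets_iff[of "{x}"] by (simp add: measure_eq_0_null_sets finite_imp_null_set_lborel)

lemma isCont_Phi: "isCont Phi x"
  unfolding Phi_eq_cdf by (simp add: std_normal.isCont_cdf std_normal_singleton)

lemma Phi_strict_mono: "x < y \<Longrightarrow> Phi x < Phi y"
proof -
  assume xy: "x < y"
  have "{x<..y} \<notin> null_sets std_normal_distribution"
    using xy unfolding std_normal_null_sets_iff by (simp add: null_sets_def)
  then have "measure std_normal_distribution {x<..y} \<noteq> 0"
    by (simp add: null_sets_def std_normal.emeasure_eq_measure)
  then have "measure std_normal_distribution {x<..y} > 0"
    by (simp add: zero_less_measure_iff)
  then show ?thesis
    using std_normal.cdf_diff_eq[OF xy] by (simp add: Phi_eq_cdf)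
qed

text \<open>\<open>Phi_inv\<close> is a definite description, so both existence (intermediate
  values) and uniqueness (strict monotonicity) of the quantile are required.\<close>

lemma Phi_Phi_inv:
  assumes "0 < u" "u < 1"
  shows "Phi (Phi_inv u) = u"
proof -
  have "\<exists>x. Phi x = u"
  proof -
    have "eventually (\<lambda>x. Phi x < u) at_bot"
      using std_normal.cdf_lim_at_bot assms(1) unfolding Phi_eq_cdf by (rule order_tendstoD)
    then obtain a where a: "Phi a < u" by (auto simp: eventually_at_bot_linorder)
    have "eventually (\<lambda>x. u < Phi x) at_top"
      using std_normal.cdf_lim_at_top_prob assms(2) unfolding Phi_eq_cdf by (rule order_tendstoD)
    then obtain b where b: "u < Phi b" by (auto simp: eventually_at_top_linorder)
    have "a \<le> b"
      using a b std_normal.cdf_nondecreasing[of b a] unfolding Phi_eq_cdf by linarith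
    then show ?thesis
      using IVT[of Phi a u b] a b isCont_Phi by force
  qed
  moreover have "Phi x = u \<Longrightarrow> Phi y = u \<Longrightarrow> x = y" for x y
    using Phi_strict_mono[of x y] Phi_strict_mono[of y x] by (cases x y rule: linorder_cases) auto
  ultimately have "\<exists>!x. Phi x = u" by blast
  then show ?thesis unfolding Phi_inv_def by (rule theI')
qed

lemma Phi_uminus: "Phi (- x) = 1 - Phi x"
proof -
  have "emeasure std_normal_distribution {..-x} = emeasure std_normal_distribution {x..}"
  proof -
    have "emeasure std_normal_distribution {..-x} = (\<integral>\<^sup>+t. ennreal (std_normal_density t) * indicator {..-x} t \<partial>lborel)"
      by (simp add: emeasure_density)
    also have "\<dots> = (\<integral>\<^sup>+t. ennreal (std_normal_density (- t)) * indicator {..-x} (- t) \<partial>lborel)"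
      by (subst nn_integral_real_affine[where c="-1" and t=0]) auto
    also have "\<dots> = (\<integral>\<^sup>+t. ennreal (std_normal_density t) * indicator {x..} t \<partial>lborel)"
      by (rule nn_integral_cong) (auto simp: std_normal_density_def split: split_indicator)
    finally show ?thesis by (simp add: emeasure_density)
  qed
  then have "Phi (- x) = measure std_normal_distribution {x..}"
    by (simp add: Phi_def measure_def)
  also have "\<dots> = measure std_normal_distribution (insert x {x<..})"
    by (rule arg_cong[where f="measure _"]) auto
  also have "\<dots> = measure std_normal_distribution {x<..}"
    by (subst measure_eq_AE[where B="{x<..}"])
       (use std_normal_null_sets_iff[of "{x}"] in \<open>auto intro: AE_I'[of "{x}"] simp: finite_imp_null_set_lborel\<close>)
  also have "\<dots> = 1 - Phi x"
    using std_normal.prob_compl[of "{..x}"] by (simp add: Phi_def Compl_eq_Diff_UNIV[symmetric])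
  finally show ?thesis .
qed

lemma std_normal_symmetric_interval:
  assumes "0 < \<xi>" "\<xi> < 1"
  shows "Phi_inv (1 - \<xi>/2) > 0"
    and "measure std_normal_distribution {- Phi_inv (1 - \<xi>/2)..Phi_inv (1 - \<xi>/2)} = 1 - \<xi>"
proof -
  let ?q = "Phi_inv (1 - \<xi>/2)"
  have q: "Phi ?q = 1 - \<xi>/2" using assms by (intro Phi_Phi_inv) auto
  show pos: "?q > 0"
  proof (rule ccontr)
    assume "\<not> ?q > 0"
    then have "Phi ?q \<le> Phi (- ?q)" unfolding Phi_eq_cdf by (intro std_normal.cdf_nondecreasing) auto
    then show False using q assms by (simp add: Phi_uminus)
  qed
  have "measure std_normal_distribution {-?q..?q} = measure std_normal_distribution {-?q<..?q}"
    by (rule measure_eq_AE)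
       (use std_normal_null_sets_iff[of "{-?q}"] in \<open>auto intro: AE_I'[of "{-?q}"] simp: finite_imp_null_set_lborel\<close>)
  also have "\<dots> = Phi ?q - Phi (- ?q)"
    using std_normal.cdf_diff_eq[of "-?q" ?q] pos by (simp add: Phi_eq_cdf)
  finally show "measure std_normal_distribution {-?q..?q} = 1 - \<xi>"
    using q by (simp add: Phi_uminus)
qed

section \<open>Weak convergence to the normal law\<close>

text \<open>Phrased through a measurable exceptional event, because the property itself need not
  describe a measurable set.\<close>

definition whp :: "'a measure \<Rightarrow> real \<Rightarrow> ('a \<Rightarrow> bool) \<Rightarrow> bool" where
  "whp M \<epsilon> P \<longleftrightarrow> (\<exists>B\<in>sets M. measure M B \<le> \<epsilon> \<and> (\<forall>w\<in>space M - B. P w))"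

lemma whp_mono:
  assumes "whp M \<epsilon> P" "\<epsilon> \<le> \<epsilon>'" "\<And>w. w \<in> space M \<Longrightarrow> P w \<Longrightarrow> R w"
  shows "whp M \<epsilon>' R"
  using assms unfolding whp_def by (meson DiffD1 order_trans)

lemma whpE:
  assumes "whp M \<epsilon> P"
  obtains B where "B \<in> sets M" "measure M B \<le> \<epsilon>" "\<And>w. w \<in> space M - B \<Longrightarrow> P w"
  using assms unfolding whp_def by blast

text \<open>A sandwich F(x - \<epsilon>) - \<epsilon> <= G(x) <= F(x + \<epsilon>) + \<epsilon> of
  distribution functions and continuity of \<open>Phi\<close>. Closeness is expressed by levels
  rather than by |X - Y|, since for a studentized ratio the distance grows with the size of the
  numerator while a fixed level moves only a little.\<close>

lemma weak_conv_std_normal_perturb: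
  fixes M :: "nat \<Rightarrow> 'a measure" and X Y :: "nat \<Rightarrow> 'a \<Rightarrow> real"
  assumes M: "\<And>k. prob_space (M k)"
    and X: "\<And>k. X k \<in> borel_measurable (M k)"
    and Y: "eventually (\<lambda>k. Y k \<in> borel_measurable (M k)) sequentially"
    and conv: "weak_conv_m (\<lambda>k. distr (M k) borel (X k)) std_normal_distribution"
    and close: "\<And>x \<epsilon>. \<epsilon> > 0 \<Longrightarrow> eventually (\<lambda>k. whp (M k) \<epsilon>
        (\<lambda>w. (X k w \<le> x - \<epsilon> \<longrightarrow> Y k w \<le> x) \<and> (Y k w \<le> x \<longrightarrow> X k w \<le> x + \<epsilon>))) sequentially"
  shows "weak_conv_m (\<lambda>k. distr (M k) borel (Y k)) std_normal_distribution"
  unfolding weak_conv_m_def weak_conv_def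
proof (intro allI impI)
  fix x :: real
  let ?F = "\<lambda>k. cdf (distr (M k) borel (X k))" and ?G = "\<lambda>k. cdf (distr (M k) borel (Y k))"
  have cX: "(\<lambda>k. ?F k u) \<longlonglongrightarrow> Phi u" for u
    using conv isCont_Phi by (simp add: weak_conv_m_def weak_conv_def Phi_eq_cdf)
  show "(\<lambda>k. ?G k x) \<longlonglongrightarrow> cdf std_normal_distribution x"
    unfolding Phi_eq_cdf[symmetric]
  proof (rule LIMSEQ_I)
    fix r :: real assume r: "r > 0"
    have "(\<lambda>e. Phi (x + e)) \<midarrow>0\<rightarrow> Phi x"
      using isCont_Phi[of x] by (simp add: isCont_def LIM_offset_zero_iff)
    then obtain d where d: "d > 0" "\<And>e. e \<noteq> 0 \<Longrightarrow> \<bar>e\<bar> < d \<Longrightarrow> \<bar>Phi (x + e) - Phi x\<bar> < r / 3"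
      using LIM_D[of "\<lambda>e. Phi (x + e)" "Phi x" 0 "r/3"] r by auto
    \<comment> \<open>One third of \<open>r\<close> each for the exceptional event, the modulus of
      continuity of \<open>Phi\<close>, and the convergence of F at the shifted level.\<close>
    define \<epsilon> where "\<epsilon> = min (d / 2) (r / 3)"
    have \<epsilon>: "\<epsilon> > 0" "\<epsilon> \<le> r / 3" "\<epsilon> < d" using d r by (auto simp: \<epsilon>_def min_def)
    have pl: "\<bar>Phi (x + \<epsilon>) - Phi x\<bar> < r / 3" using d(2)[of \<epsilon>] \<epsilon> by simp
    have mi: "\<bar>Phi (x - \<epsilon>) - Phi x\<bar> < r / 3" using d(2)[of "- \<epsilon>"] \<epsilon> by simp
    have "eventually (\<lambda>k. \<bar>?F k (x + \<epsilon>) - Phi (x + \<epsilon>)\<bar> < r / 3) sequentially"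
      using tendstoD[OF cX, of "r/3" "x + \<epsilon>"] r by (simp add: dist_real_def)
    moreover have "eventually (\<lambda>k. \<bar>?F k (x - \<epsilon>) - Phi (x - \<epsilon>)\<bar> < r / 3) sequentially"
      using tendstoD[OF cX, of "r/3" "x - \<epsilon>"] r by (simp add: dist_real_def)
    ultimately have "eventually (\<lambda>k. norm (?G k x - Phi x) < r) sequentially"
      using close[OF \<epsilon>(1), of x] Y
    proof eventually_elim
      case (elim k)
      interpret prob_space "M k" by fact
      note X[of k, measurable] elim(4)[measurable]
      obtain B where B: "B \<in> sets (M k)" "measure (M k) B \<le> \<epsilon>"
        "\<And>w. w \<in> space (M k) - B \<Longrightarrow> (X k w \<le> x - \<epsilon> \<longrightarrow> Y k w \<le> x) \<and> (Y k w \<le> x \<longrightarrow> X k w \<le> x + \<epsilon>)"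
        using whpE[OF elim(3)] by blast
      have cd: "cdf (distr (M k) borel Z) u = measure (M k) {w \<in> space (M k). Z w \<le> u}"
        if "Z \<in> borel_measurable (M k)" for Z u
      proof -
        have "Z -` {..u} \<inter> space (M k) = {w \<in> space (M k). Z w \<le> u}" by auto
        then show ?thesis using that by (simp add: cdf_def2 measure_distr)
      qed
      have "measure (M k) {w \<in> space (M k). Y k w \<le> x} \<le> measure (M k) ({w \<in> space (M k). X k w \<le> x + \<epsilon>} \<union> B)"
        by (rule finite_measure_mono) (use B in auto)
      also have "\<dots> \<le> measure (M k) {w \<in> space (M k). X k w \<le> x + \<epsilon>} + measure (M k) B"
        by (rule measure_Un_le) (use B(1) in auto)
      finally have 1: "?G k x \<le> ?F k (x + \<epsilon>) + \<epsilon>"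
        using B(2) cd[OF elim(4)] cd[OF X] by simp
      have "measure (M k) {w \<in> space (M k). X k w \<le> x - \<epsilon>} \<le> measure (M k) ({w \<in> space (M k). Y k w \<le> x} \<union> B)"
        by (rule finite_measure_mono) (use B in auto)
      also have "\<dots> \<le> measure (M k) {w \<in> space (M k). Y k w \<le> x} + measure (M k) B"
        by (rule measure_Un_le) (use B(1) in auto)
      finally have 2: "?F k (x - \<epsilon>) - \<epsilon> \<le> ?G k x"
        using B(2) cd[OF elim(4)] cd[OF X] by simp
      show ?case using 1 2 elim(1,2) pl mi \<epsilon>(2) unfolding real_norm_def by linarith
    qed
    then show "\<exists>no. \<forall>k\<ge>no. norm (?G k x - Phi x) < r"
      by (simp add: eventually_sequentially)
  qed
qed

text \<open>The law may change from row to row. With unit variance and |f| <= B, one factor of the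
  characteristic function differs from 1 - t^2/(2n) by at most |t|^3 |B|^3/(6 n^(3/2)), so the n-th
  powers differ by O(n^(-1/2)), uniformly over the laws.\<close>

lemma triangular_bounded_clt:
  fixes Q :: "nat \<Rightarrow> 'z obs measure" and f :: "nat \<Rightarrow> 'z obs \<Rightarrow> real"
  assumes Q: "\<And>k. prob_space (Q k)" and f: "\<And>k. f k \<in> borel_measurable (Q k)"
    and bd: "\<And>k. AE x in Q k. \<bar>f k x\<bar> \<le> B"
    and mean: "\<And>k. (\<integral>x. f k x \<partial>Q k) = 0" and var: "\<And>k. (\<integral>x. (f k x)\<^sup>2 \<partial>Q k) = 1"
    and n: "filterlim n at_top sequentially"
  shows "weak_conv_m (\<lambda>k. distr (sampleM (n k) (Q k)) borel (\<lambda>w. (\<Sum>i<n k. f k (w i)) / sqrt (real (n k))))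
           std_normal_distribution"
proof (rule levy_continuity)
  let ?S = "\<lambda>k w. (\<Sum>i<n k. f k (w i)) / sqrt (real (n k))"
  have sm: "?S k \<in> borel_measurable (sampleM (n k) (Q k))" for k
    using measurable_sample_sum[OF f] by (rule borel_measurable_divide) simp
  show "real_distribution (distr (sampleM (n k) (Q k)) borel (?S k))" for k
    using sm prob_space.real_distribution_distr[OF prob_space_sampleM[OF Q]] by blast
  show "real_distribution std_normal_distribution" by (rule real_dist_normal_dist)
  fix t :: real
  let ?u = "\<lambda>k. 1 + (-(t\<^sup>2) / 2) / real (n k)"
  define s where "s k = t / sqrt (real (n k))" for k
  define \<psi> where "\<psi> k = char (distr (Q k) borel (f k)) (s k)" for k
  have char_eq: "char (distr (sampleM (n k) (Q k)) borel (?S k)) t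
      = \<psi> k ^ n k" for k
  proof -
    interpret prob_space "Q k" by (rule Q)
    note f[of k, measurable]
    have int: "integrable (Q k) (\<lambda>x. iexp (s k * f k x))"
      by (rule integrable_const_bound[where B=1]) auto
    have "char (distr (sampleM (n k) (Q k)) borel (?S k)) t
        = (\<integral>w. iexp (t * ?S k w) \<partial>sampleM (n k) (Q k))"
      unfolding char_def by (rule integral_distr) (use sm in auto)
    also have "\<dots> = (\<integral>w. (\<Prod>i<n k. iexp (s k * f k (w i))) \<partial>sampleM (n k) (Q k))"
      by (rule Bochner_Integration.integral_cong)
         (auto simp: exp_sum[symmetric] sum_distrib_left sum_divide_distrib s_def)
    also have "\<dots> = (\<integral>x. iexp (s k * f k x) \<partial>Q k) ^ n k"
      by (rule integral_sampleM_prod(2)[OF Q int])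
    also have "(\<integral>x. iexp (s k * f k x) \<partial>Q k) = \<psi> k"
      unfolding \<psi>_def char_def by (rule integral_distr[symmetric]) auto
    finally show ?thesis .
  qed
  have approx: "cmod (\<psi> k - complex_of_real (?u k)) \<le> \<bar>s k\<bar> ^ 3 / 6 * \<bar>B\<bar> ^ 3"
    if nk: "n k > 0" for k
  proof -
    interpret prob_space "Q k" by (rule Q)
    note f[of k, measurable]
    let ?m = "\<lambda>x. min (6 * (f k x)^2) (\<bar>s k\<bar> * \<bar>f k x\<bar>^3)"
    have i1: "integrable (Q k) (f k)" by (rule AE_bounded_integrable[OF Q f bd])
    have i2: "integrable (Q k) (\<lambda>x. (f k x)\<^sup>2)" by (rule AE_bounded_square_integrable[OF Q f bd])
    have "cmod (\<psi> k - (1 - (s k)\<^sup>2 * 1 / 2))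
       \<le> ((s k)\<^sup>2 / 6) * expectation ?m"
      unfolding \<psi>_def
      using char_approx3'[of "f k" 1 "distr (Q k) borel (f k)" "s k"] i1 i2 mean[of k] var[of k] by simp
    also have "expectation ?m \<le> expectation (\<lambda>x. \<bar>s k\<bar> * \<bar>B\<bar>^3)"
    proof (rule integral_mono_AE)
      have b6: "AE x in Q k. \<bar>f k x\<bar>^3 \<le> \<bar>B\<bar>^3" using bd[of k]
        by eventually_elim (auto intro!: power_mono)
      then show "AE x in Q k. ?m x \<le> \<bar>s k\<bar> * \<bar>B\<bar>^3"
        by eventually_elim (auto intro!: min.coboundedI2 mult_left_mono)
      show "integrable (Q k) ?m"
      proof (rule AE_bounded_integrable[OF Q])
        show "AE x in Q k. \<bar>?m x\<bar> \<le> \<bar>s k\<bar> * \<bar>B\<bar>^3"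
          using b6
        proof eventually_elim
          case (elim x)
          have "\<bar>?m x\<bar> = ?m x" by simp
          also have "\<dots> \<le> \<bar>s k\<bar> * \<bar>B\<bar>^3"
            using elim by (auto intro!: min.coboundedI2 mult_left_mono)
          finally show ?case .
        qed
      qed simp
    qed simp
    also have "(s k)\<^sup>2 / 6 * expectation (\<lambda>x. \<bar>s k\<bar> * \<bar>B\<bar>^3) = \<bar>s k\<bar> ^ 3 / 6 * \<bar>B\<bar> ^ 3"
    proof -
      have "a\<^sup>2 / 6 * (a * b ^ 3) = a ^ 3 / 6 * b ^ 3" for a b :: real
        by (simp add: power3_eq_cube power2_eq_square)
      from this[of "\<bar>s k\<bar>" "\<bar>B\<bar>"] show ?thesis by (simp add: prob_space)
    qed
    finally have "cmod (\<psi> k - (1 - (s k)\<^sup>2 * 1 / 2)) \<le> \<bar>s k\<bar> ^ 3 / 6 * \<bar>B\<bar> ^ 3"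
      by (simp add: mult_left_mono)
    moreover have "(s k)\<^sup>2 = t\<^sup>2 / real (n k)" using nk by (simp add: s_def power_divide)
    ultimately show ?thesis by (simp add: field_simps)
  qed
  have lim: "(\<lambda>k. complex_of_real (?u k ^ n k)) \<longlonglongrightarrow> complex_of_real (exp (-(t\<^sup>2) / 2))"
    by (rule tendsto_of_real, rule filterlim_compose[OF tendsto_exp_limit_sequentially n])
  \<comment> \<open>This size makes \<open>n k\<close> positive and |1 - t^2/(2n)| <= 1, so that
    powers of the two factors can be compared.\<close>
  have ev: "eventually (\<lambda>k. real (n k) \<ge> t\<^sup>2 + 1) sequentially"
    using filterlim_compose[OF filterlim_real_sequentially n] by (simp add: filterlim_at_top)
  have main: "eventually (\<lambda>k. cmod (\<psi> k ^ n k - complex_of_real (?u k ^ n k))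
      \<le> \<bar>t\<bar> ^ 3 / 6 * \<bar>B\<bar> ^ 3 * inverse (sqrt (real (n k)))) sequentially"
    using ev
  proof eventually_elim
    case (elim k)
    have nk: "n k > 0" using elim by (metis add_nonneg_pos gr0I less_le_not_le of_nat_0 zero_le_power2 zero_less_one)
    interpret D: real_distribution "distr (Q k) borel (f k)"
      using prob_space.real_distribution_distr[OF Q f] .
    have "t\<^sup>2 / 2 / real (n k) \<le> 1" using elim nk by (simp add: divide_le_eq)
    moreover have "t\<^sup>2 / 2 / real (n k) \<ge> 0" by simp
    ultimately have "\<bar>?u k\<bar> \<le> 1" by (simp add: abs_le_iff)
    then have "cmod (complex_of_real (?u k)) \<le> 1" unfolding norm_of_real .
    then have "cmod (\<psi> k ^ n k - complex_of_real (?u k) ^ n k)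
       \<le> real (n k) * cmod (\<psi> k - complex_of_real (?u k))"
      using D.cmod_char_le_1 unfolding \<psi>_def by (intro norm_power_diff) auto
    also have "\<dots> \<le> real (n k) * (\<bar>s k\<bar> ^ 3 / 6 * \<bar>B\<bar> ^ 3)"
      by (rule mult_left_mono[OF approx[OF nk]]) simp
    also have "\<bar>s k\<bar> ^ 3 = \<bar>t\<bar> ^ 3 / (real (n k) * sqrt (real (n k)))"
      by (simp add: s_def power_divide power3_eq_cube)
    also have "real (n k) * (\<bar>t\<bar> ^ 3 / (real (n k) * sqrt (real (n k))) / 6 * \<bar>B\<bar> ^ 3)
        = \<bar>t\<bar> ^ 3 / 6 * \<bar>B\<bar> ^ 3 * inverse (sqrt (real (n k)))"
      using nk by (simp add: field_simps)
    finally show ?case by simp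
  qed
  have "(\<lambda>k. \<bar>t\<bar> ^ 3 / 6 * \<bar>B\<bar> ^ 3 * inverse (sqrt (real (n k)))) \<longlonglongrightarrow> 0"
    by (intro tendsto_mult_right_zero tendsto_inverse_0_at_top filterlim_compose[OF sqrt_at_top]
        filterlim_compose[OF filterlim_real_sequentially] n)
  then have "(\<lambda>k. \<psi> k ^ n k) \<longlonglongrightarrow> complex_of_real (exp (-(t\<^sup>2) / 2))"
    using lim by (intro Lim_transform[OF lim]) (rule Lim_null_comparison[OF main])
  then show "(\<lambda>k. char (distr (sampleM (n k) (Q k)) borel (?S k)) t)
      \<longlonglongrightarrow> char std_normal_distribution t"
    unfolding char_eq by (simp add: char_std_normal_distribution)
qed

section \<open>The score of a single treatment arm\<close>

text \<open>The augmented inverse-propensity score for the mean response under one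
  treatment.\<close>

definition arm_score :: "real \<Rightarrow> real \<Rightarrow> real \<Rightarrow> real \<Rightarrow> real" where
  "arm_score e y g m = e * (y - g) / m + g"

lemma phi_eq_arm_score:
  "phi a y d g0 g1 m = a - arm_score d y g1 m + arm_score (1 - d) y g0 (1 - m)"
  by (simp add: phi_def arm_score_def)

text \<open>The expansion is exact because the score is affine in g for fixed 1/m and affine in 1/m
  for fixed g: nothing beyond the product of the two errors can appear.\<close>

lemma arm_score_diff:
  assumes "m \<noteq> 0" "m' \<noteq> 0"
  shows "arm_score e y g' m' - arm_score e y g m =
    e * (y - g) * (1 / m' - 1 / m) + (1 - e / m) * (g' - g) - e * (g' - g) * (1 / m' - 1 / m)"
  using assms by (simp add: arm_score_def field_simps)

text \<open>The threshold \<open>c / 2\<close> is what remains of overlap for approximated and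
  estimated propensities; 4/c^2 is its inverse square.\<close>

lemma abs_inverse_diff_le:
  fixes a b c :: real
  assumes "0 < c" "c / 2 \<le> a" "c / 2 \<le> b"
  shows "\<bar>1 / a - 1 / b\<bar> \<le> 4 / c\<^sup>2 * \<bar>a - b\<bar>"
proof -
  have ab: "a > 0" "b > 0" using assms by auto
  have "(c / 2) * (c / 2) \<le> a * b" using assms ab by (intro mult_mono) auto
  then have "1 / (a * b) \<le> 1 / ((c / 2) * (c / 2))" using assms by (intro divide_left_mono) (auto intro!: mult_pos_pos ab)
  then have "\<bar>a - b\<bar> * (1 / (a * b)) \<le> \<bar>a - b\<bar> * (4 / c\<^sup>2)"
    by (intro mult_left_mono) (auto simp: power2_eq_square)
  moreover have "\<bar>1 / a - 1 / b\<bar> = \<bar>a - b\<bar> * (1 / (a * b))"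
  proof -
    have "1 / a - 1 / b = (b - a) * (1 / (a * b))" using ab by (simp add: field_simps)
    then show ?thesis using ab by (simp add: abs_mult abs_minus_commute)
  qed
  ultimately show ?thesis by (simp add: mult.commute)
qed

text \<open>One Lipschitz constant for all terms: it dominates 2C * 4/c^2 for the residual times a
  difference of inverse propensities, 1/c for the weight 1 - e/\<mu>, and 4/c for the product
  term.\<close>

definition arm_const :: "real \<Rightarrow> real \<Rightarrow> real" where
  "arm_const c C = 8 * (C + 1) / c\<^sup>2"

text \<open>The treated arm has e = d and link \<open>Lam\<close>; the untreated arm has e = 1 - d
  and link 1 - \<open>Lam\<close>. The conditional mean restrictions enter as orthogonality to
  bounded functions of z, the only form in which centring is used.\<close>

locale arm =
  fixes Q :: "'z obs measure" and Mz :: "'z measure" and e :: "'z obs \<Rightarrow> real"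
    and \<gamma> \<mu> :: "'z \<Rightarrow> real" and G :: "real \<Rightarrow> real" and X :: "'z \<Rightarrow> nat \<Rightarrow> real"
    and p :: nat and K :: real and b\<gamma> b\<mu> :: "nat \<Rightarrow> real" and \<delta> c C :: real
  assumes Q: "prob_space Q"
    and zo_meas: "zo \<in> measurable Q Mz" and yo_meas: "yo \<in> borel_measurable Q"
    and e_meas: "e \<in> borel_measurable Q"
    and \<gamma>_meas: "\<gamma> \<in> borel_measurable Mz" and \<mu>_meas: "\<mu> \<in> borel_measurable Mz"
    and G_meas: "G \<in> borel_measurable borel"
    and X_meas: "\<And>j. (\<lambda>z. X z j) \<in> borel_measurable Mz"
    and e01: "AE ob in Q. e ob = 0 \<or> e ob = 1"
    and y_bd: "AE ob in Q. \<bar>yo ob\<bar> \<le> C"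
    and \<gamma>_bd: "AE ob in Q. \<bar>\<gamma> (zo ob)\<bar> \<le> C"
    and \<mu>_bd: "AE ob in Q. c \<le> \<mu> (zo ob) \<and> \<mu> (zo ob) \<le> 1"
    and X_bd: "AE ob in Q. \<forall>j<p. \<bar>X (zo ob) j\<bar> \<le> K"
    and r\<gamma>_bd: "AE ob in Q. \<bar>\<gamma> (zo ob) - dotp p (X (zo ob)) b\<gamma>\<bar> \<le> \<delta>"
    and r\<mu>_bd: "AE ob in Q. \<bar>\<mu> (zo ob) - G (dotp p (X (zo ob)) b\<mu>)\<bar> \<le> \<delta>"
    and orth_y: "\<And>h B. h \<in> borel_measurable Mz \<Longrightarrow> AE ob in Q. \<bar>h (zo ob)\<bar> \<le> B \<Longrightarrow>
        (\<integral>ob. e ob * (yo ob - \<gamma> (zo ob)) * h (zo ob) \<partial>Q) = 0"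
    and orth_e: "\<And>h B. h \<in> borel_measurable Mz \<Longrightarrow> AE ob in Q. \<bar>h (zo ob)\<bar> \<le> B \<Longrightarrow>
        (\<integral>ob. (e ob - \<mu> (zo ob)) * h (zo ob) \<partial>Q) = 0"
    and G_lip: "\<And>u v. \<bar>G u - G v\<bar> \<le> \<bar>u - v\<bar>"
    and \<delta>_pos: "\<delta> > 0" and \<delta>_small: "4 * \<delta> \<le> c" and c_pos: "c > 0" and c_le: "c \<le> 1" and C_pos: "C > 0"
begin

abbreviation "xd z \<equiv> dotp p (X z)"

text \<open>The almost sure conditions at a single observation. Bounds proved under it are
  deterministic and hold at all sample points simultaneously.\<close>

definition ok :: "'z obs \<Rightarrow> bool" where
  "ok ob \<longleftrightarrow> (e ob = 0 \<or> e ob = 1) \<and> \<bar>yo ob\<bar> \<le> C \<and> \<bar>\<gamma> (zo ob)\<bar> \<le> C \<and>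
     c \<le> \<mu> (zo ob) \<and> \<mu> (zo ob) \<le> 1 \<and> (\<forall>j<p. \<bar>X (zo ob) j\<bar> \<le> K) \<and>
     \<bar>\<gamma> (zo ob) - xd (zo ob) b\<gamma>\<bar> \<le> \<delta> \<and> \<bar>\<mu> (zo ob) - G (xd (zo ob) b\<mu>)\<bar> \<le> \<delta>"

abbreviation "L \<equiv> arm_const c C"

text \<open>Each centred term of the expansion is cut at the approximating index. \<open>F1\<close>
  and \<open>F2\<close> carry the deviation of the coefficients and vanish at zero;
  \<open>R1\<close> and \<open>R2\<close> carry the approximation error, do not involve the
  estimator, and so need no uniformity.\<close>

definition F1 :: "(nat \<Rightarrow> real) \<Rightarrow> 'z obs \<Rightarrow> real" where
  "F1 b ob = e ob * (yo ob - \<gamma> (zo ob)) *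
     (1 / G (xd (zo ob) b\<mu> + xd (zo ob) b) - 1 / G (xd (zo ob) b\<mu>))"

definition F2 :: "(nat \<Rightarrow> real) \<Rightarrow> 'z obs \<Rightarrow> real" where
  "F2 b ob = (1 - e ob / \<mu> (zo ob)) * xd (zo ob) b"

definition R1 :: "'z obs \<Rightarrow> real" where
  "R1 ob = e ob * (yo ob - \<gamma> (zo ob)) * (1 / G (xd (zo ob) b\<mu>) - 1 / \<mu> (zo ob))"

definition R2 :: "'z obs \<Rightarrow> real" where
  "R2 ob = (1 - e ob / \<mu> (zo ob)) * (\<gamma> (zo ob) - xd (zo ob) b\<gamma>)"

lemma AE_ok: "AE ob in Q. ok ob"
  using e01 y_bd \<gamma>_bd \<mu>_bd X_bd r\<gamma>_bd r\<mu>_bd unfolding ok_def by eventually_elim blast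

lemma L_pos: "L > 0" using C_pos c_pos by (simp add: arm_const_def)

lemma L_ge: "8 * C / c\<^sup>2 \<le> L" "1 / c \<le> L" "4 / c \<le> L"
proof -
  have c2: "c\<^sup>2 \<le> c" using c_pos c_le by (simp add: power2_eq_square mult_left_le)
  show "8 * C / c\<^sup>2 \<le> L" unfolding arm_const_def using c_pos by (intro divide_right_mono) auto
  have "4 / c \<le> 4 / c\<^sup>2" using c2 c_pos by (intro divide_left_mono) auto
  also have "\<dots> \<le> L" unfolding arm_const_def using C_pos c_pos by (intro divide_right_mono) auto
  finally show "4 / c \<le> L" .
  moreover have "1 / c \<le> 4 / c" using c_pos by (intro divide_right_mono) auto
  ultimately show "1 / c \<le> L" by linarith
qed

lemma meas_dotp: "(\<lambda>z. xd z b) \<in> borel_measurable Mz"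
  by (rule measurable_dotp) (rule X_meas)

lemma ok_dotp: "ok ob \<Longrightarrow> K * l1norm p b \<le> \<delta> \<Longrightarrow> \<bar>xd (zo ob) b\<bar> \<le> \<delta>"
  using abs_dotp_le_l1norm[of p "X (zo ob)" K b] by (force simp: ok_def)

text \<open>Overlap loses at most \<delta> to the approximation error and \<delta> to the deviation
  of the index; \<open>4 * \<delta> \<le> c\<close> leaves half of it.\<close>

lemma ok_G:
  assumes "ok ob" "\<bar>u\<bar> \<le> \<delta>"
  shows "c / 2 \<le> G (xd (zo ob) b\<mu> + u)"
proof -
  have "c \<le> \<mu> (zo ob)" "\<bar>\<mu> (zo ob) - G (xd (zo ob) b\<mu>)\<bar> \<le> \<delta>"
    using assms by (auto simp: ok_def)
  then show ?thesis
    using assms(2) G_lip[of "xd (zo ob) b\<mu> + u" "xd (zo ob) b\<mu>"] \<delta>_small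
    by linarith
qed

lemma ok_G0: "ok ob \<Longrightarrow> c / 2 \<le> G (xd (zo ob) b\<mu>)"
  using ok_G[of ob 0] \<delta>_pos by simp

lemma ok_weight:
  assumes "ok ob"
  shows "\<bar>1 - e ob / \<mu> (zo ob)\<bar> \<le> L"
proof -
  have m: "c \<le> \<mu> (zo ob)" "\<mu> (zo ob) \<le> 1" "e ob = 0 \<or> e ob = 1" using assms by (auto simp: ok_def)
  have "1 / \<mu> (zo ob) \<le> 1 / c" using m c_pos by (intro divide_left_mono) auto
  moreover have "1 / \<mu> (zo ob) \<ge> 1" using m c_pos by simp
  moreover have "1 \<le> 1 / c" using c_pos c_le by simp
  ultimately have "\<bar>1 - e ob / \<mu> (zo ob)\<bar> \<le> 1 / c" using m(3) by auto
  then show ?thesis using L_ge by linarith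
qed

lemma ok_residual:
  assumes "ok ob" "\<bar>u\<bar> \<le> 4 / c\<^sup>2 * v" "v \<ge> 0"
  shows "\<bar>e ob * (yo ob - \<gamma> (zo ob)) * u\<bar> \<le> L * v"
proof -
  have "\<bar>e ob * (yo ob - \<gamma> (zo ob))\<bar> \<le> 2 * C"
    using assms(1) C_pos by (auto simp: ok_def)
  then have "\<bar>e ob * (yo ob - \<gamma> (zo ob)) * u\<bar> \<le> (2 * C) * (4 / c\<^sup>2 * v)"
    unfolding abs_mult[of _ u] using assms(2) C_pos by (intro mult_mono) auto
  also have "\<dots> = 8 * C / c\<^sup>2 * v" by simp
  also have "\<dots> \<le> L * v" using L_ge assms(3) by (intro mult_right_mono) auto
  finally show ?thesis .
qed

lemma ok_R1: "ok ob \<Longrightarrow> \<bar>R1 ob\<bar> \<le> L * \<bar>\<mu> (zo ob) - G (xd (zo ob) b\<mu>)\<bar>"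
  unfolding R1_def
proof (rule ok_residual)
  assume ok: "ok ob"
  have "c / 2 \<le> \<mu> (zo ob)" using ok c_pos by (simp add: ok_def)
  then show "\<bar>1 / G (xd (zo ob) b\<mu>) - 1 / \<mu> (zo ob)\<bar> \<le> 4 / c\<^sup>2 * \<bar>\<mu> (zo ob) - G (xd (zo ob) b\<mu>)\<bar>"
    using abs_inverse_diff_le[OF c_pos ok_G0[OF ok]] by (simp add: abs_minus_commute)
qed auto

lemma ok_R2: "ok ob \<Longrightarrow> \<bar>R2 ob\<bar> \<le> L * \<bar>\<gamma> (zo ob) - xd (zo ob) b\<gamma>\<bar>"
  unfolding R2_def abs_mult by (rule mult_right_mono[OF ok_weight]) auto

lemma ok_F1_lip:
  assumes "ok ob" "K * l1norm p b \<le> \<delta>" "K * l1norm p b' \<le> \<delta>"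
  shows "\<bar>F1 b ob - F1 b' ob\<bar> \<le> L * \<bar>xd (zo ob) b - xd (zo ob) b'\<bar>"
proof -
  let ?x = "X (zo ob)" and ?s = "xd (zo ob) b\<mu>"
  have "F1 b ob - F1 b' ob = e ob * (yo ob - \<gamma> (zo ob)) *
     (1 / G (?s + dotp p ?x b) - 1 / G (?s + dotp p ?x b'))"
    by (simp add: F1_def algebra_simps)
  moreover have "\<bar>1 / G (?s + dotp p ?x b) - 1 / G (?s + dotp p ?x b')\<bar> \<le> 4 / c\<^sup>2 * \<bar>dotp p ?x b - dotp p ?x b'\<bar>"
  proof -
    have "\<bar>1 / G (?s + dotp p ?x b) - 1 / G (?s + dotp p ?x b')\<bar> \<le> 4 / c\<^sup>2 * \<bar>G (?s + dotp p ?x b) - G (?s + dotp p ?x b')\<bar>"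
      using assms by (intro abs_inverse_diff_le c_pos ok_G ok_dotp)
    also have "\<dots> \<le> 4 / c\<^sup>2 * \<bar>(?s + dotp p ?x b) - (?s + dotp p ?x b')\<bar>"
      by (intro mult_left_mono G_lip) auto
    finally show ?thesis by simp
  qed
  ultimately show ?thesis using ok_residual[OF assms(1)] by simp
qed

lemma ok_F2_lip:
  assumes "ok ob"
  shows "\<bar>F2 b ob - F2 b' ob\<bar> \<le> L * \<bar>xd (zo ob) b - xd (zo ob) b'\<bar>"
proof -
  have "F2 b ob - F2 b' ob = (1 - e ob / \<mu> (zo ob)) * (xd (zo ob) b - xd (zo ob) b')"
    by (simp add: F2_def algebra_simps)
  then show ?thesis using ok_weight[OF assms] by (simp add: abs_mult mult_right_mono)
qed

lemma F1_0: "F1 (\<lambda>_. 0) ob = 0" and F2_0: "F2 (\<lambda>_. 0) ob = 0"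
  by (simp_all add: F1_def F2_def dotp_zero)

lemma meas_all:
  "F1 b \<in> borel_measurable Q" "F2 b \<in> borel_measurable Q"
  "R1 \<in> borel_measurable Q" "R2 \<in> borel_measurable Q"
  "(\<lambda>ob. \<gamma> (zo ob) - xd (zo ob) b\<gamma>) \<in> borel_measurable Q"
  "(\<lambda>ob. \<mu> (zo ob) - G (xd (zo ob) b\<mu>)) \<in> borel_measurable Q"
proof -
  note [measurable] = zo_meas yo_meas e_meas \<gamma>_meas \<mu>_meas G_meas meas_dotp
  show "F1 b \<in> borel_measurable Q" "F2 b \<in> borel_measurable Q"
    "R1 \<in> borel_measurable Q" "R2 \<in> borel_measurable Q"
    "(\<lambda>ob. \<gamma> (zo ob) - xd (zo ob) b\<gamma>) \<in> borel_measurable Q"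
    "(\<lambda>ob. \<mu> (zo ob) - G (xd (zo ob) b\<mu>)) \<in> borel_measurable Q"
    unfolding F1_def[abs_def] F2_def[abs_def] R1_def[abs_def] R2_def[abs_def] by measurable
qed

lemma orth_weight:
  assumes h: "h \<in> borel_measurable Mz" and bd: "AE ob in Q. \<bar>h (zo ob)\<bar> \<le> B"
  shows "(\<integral>ob. (1 - e ob / \<mu> (zo ob)) * h (zo ob) \<partial>Q) = 0"
proof -
  note [measurable] = zo_meas e_meas \<mu>_meas h
  \<comment> \<open>The weight is (e - \<mu>)(-1/\<mu>), and overlap keeps the new test function
    -h/\<mu> bounded.\<close>
  have "(\<integral>ob. (1 - e ob / \<mu> (zo ob)) * h (zo ob) \<partial>Q) = (\<integral>ob. (e ob - \<mu> (zo ob)) * (- h (zo ob) / \<mu> (zo ob)) \<partial>Q)"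
  proof (rule integral_cong_AE)
    show "AE ob in Q. (1 - e ob / \<mu> (zo ob)) * h (zo ob) = (e ob - \<mu> (zo ob)) * (- h (zo ob) / \<mu> (zo ob))"
      using \<mu>_bd by eventually_elim (use c_pos in \<open>simp add: field_simps\<close>)
  qed measurable
  also have "\<dots> = 0"
  proof (rule orth_e[of "\<lambda>z. - h z / \<mu> z" "\<bar>B\<bar> / c"])
    show "AE ob in Q. \<bar>- h (zo ob) / \<mu> (zo ob)\<bar> \<le> \<bar>B\<bar> / c" using \<mu>_bd bd
    proof eventually_elim
      case (elim ob)
      have "\<bar>- h (zo ob) / \<mu> (zo ob)\<bar> = \<bar>h (zo ob)\<bar> / \<mu> (zo ob)" using elim c_pos by simp
      also have "\<dots> \<le> \<bar>B\<bar> / c" using elim c_pos by (intro frac_le) auto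
      finally show ?case .
    qed
  qed measurable
  finally show ?thesis .
qed

lemma mean_F1:
  assumes b: "K * l1norm p b \<le> \<delta>"
  shows "(\<integral>ob. F1 b ob \<partial>Q) = 0"
  unfolding F1_def
proof (rule orth_y[of "\<lambda>z. 1 / G (xd z b\<mu> + xd z b) - 1 / G (xd z b\<mu>)" "4 / c\<^sup>2 * \<delta>"])
  note [measurable] = meas_dotp G_meas
  show "(\<lambda>z. 1 / G (xd z b\<mu> + xd z b) - 1 / G (xd z b\<mu>)) \<in> borel_measurable Mz"
    by measurable
  show "AE ob in Q. \<bar>1 / G (xd (zo ob) b\<mu> + xd (zo ob) b) - 1 / G (xd (zo ob) b\<mu>)\<bar> \<le> 4 / c\<^sup>2 * \<delta>"
    using AE_ok
  proof eventually_elim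
    case (elim ob)
    let ?s = "xd (zo ob) b\<mu>" and ?u = "xd (zo ob) b"
    have u: "\<bar>?u\<bar> \<le> \<delta>" by (rule ok_dotp[OF elim b])
    have "\<bar>1 / G (?s + ?u) - 1 / G ?s\<bar> \<le> 4 / c\<^sup>2 * \<bar>G (?s + ?u) - G ?s\<bar>"
      by (rule abs_inverse_diff_le[OF c_pos ok_G[OF elim u] ok_G0[OF elim]])
    also have "\<dots> \<le> 4 / c\<^sup>2 * \<delta>" using G_lip[of "?s + ?u" ?s] u by (intro mult_left_mono) auto
    finally show ?case .
  qed
qed

lemma mean_R1: "(\<integral>ob. R1 ob \<partial>Q) = 0"
  unfolding R1_def
proof (rule orth_y[of "\<lambda>z. 1 / G (xd z b\<mu>) - 1 / \<mu> z" "4 / c\<^sup>2 * \<delta>"])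
  note [measurable] = meas_dotp G_meas \<mu>_meas
  show "(\<lambda>z. 1 / G (xd z b\<mu>) - 1 / \<mu> z) \<in> borel_measurable Mz" by measurable
  show "AE ob in Q. \<bar>1 / G (xd (zo ob) b\<mu>) - 1 / \<mu> (zo ob)\<bar> \<le> 4 / c\<^sup>2 * \<delta>"
    using AE_ok
  proof eventually_elim
    case (elim ob)
    have m: "c / 2 \<le> \<mu> (zo ob)" using elim c_pos by (simp add: ok_def)
    have "\<bar>1 / G (xd (zo ob) b\<mu>) - 1 / \<mu> (zo ob)\<bar> \<le> 4 / c\<^sup>2 * \<bar>G (xd (zo ob) b\<mu>) - \<mu> (zo ob)\<bar>"
      by (rule abs_inverse_diff_le[OF c_pos ok_G0[OF elim] m])
    also have "\<dots> \<le> 4 / c\<^sup>2 * \<delta>" using elim by (intro mult_left_mono) (auto simp: ok_def abs_minus_commute)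
    finally show ?case .
  qed
qed

lemma mean_F2:
  assumes b: "K * l1norm p b \<le> \<delta>"
  shows "(\<integral>ob. F2 b ob \<partial>Q) = 0"
  unfolding F2_def
proof (rule orth_weight[of "\<lambda>z. xd z b" \<delta>])
  show "AE ob in Q. \<bar>xd (zo ob) b\<bar> \<le> \<delta>"
    using AE_ok by eventually_elim (rule ok_dotp[OF _ b])
qed (rule meas_dotp)

lemma mean_R2: "(\<integral>ob. R2 ob \<partial>Q) = 0"
  unfolding R2_def
  using borel_measurable_diff[OF \<gamma>_meas meas_dotp] r\<gamma>_bd by (rule orth_weight)

text \<open>The first bound isolates the product term as a sum of squares. The factor
  \<open>e ob\<close> stays inside the regression square because the empirical norm controls that
  error on the observed arm only. The second, crude bound adds five pieces of size at most L
  \<delta> and serves the consistency of the variance estimator.\<close>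

lemma ok_score_diff:
  fixes ob b1 b2
  defines "x \<equiv> X (zo ob)"
  assumes ok: "ok ob" and b1: "K * l1norm p b1 \<le> \<delta>" and b2: "K * l1norm p b2 \<le> \<delta>"
  shows "\<bar>arm_score (e ob) (yo ob) (dotp p x b\<gamma> + dotp p x b1) (G (dotp p x b\<mu> + dotp p x b2))
      - arm_score (e ob) (yo ob) (\<gamma> (zo ob)) (\<mu> (zo ob)) - (F1 b2 ob + R1 ob + F2 b1 ob - R2 ob)\<bar>
    \<le> 4 / c\<^sup>2 * ((e ob * dotp p x b1)\<^sup>2 + (\<gamma> (zo ob) - dotp p x b\<gamma>)\<^sup>2 + (dotp p x b2)\<^sup>2 + (\<mu> (zo ob) - G (dotp p x b\<mu>))\<^sup>2)"
    (is "\<bar>?d - ?f\<bar> \<le> ?r") and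
  "\<bar>arm_score (e ob) (yo ob) (dotp p x b\<gamma> + dotp p x b1) (G (dotp p x b\<mu> + dotp p x b2))
      - arm_score (e ob) (yo ob) (\<gamma> (zo ob)) (\<mu> (zo ob))\<bar> \<le> 8 * L * \<delta>"
proof -
  define u1 where "u1 = dotp p x b1"
  define u2 where "u2 = dotp p x b2"
  define m' where "m' = G (dotp p x b\<mu> + u2)"
  define m where "m = \<mu> (zo ob)"
  define rg where "rg = \<gamma> (zo ob) - dotp p x b\<gamma>"
  define rm where "rm = m - G (dotp p x b\<mu>)"
  define E where "E = e ob"
  have u1: "\<bar>u1\<bar> \<le> \<delta>" and u2: "\<bar>u2\<bar> \<le> \<delta>"
    unfolding u1_def u2_def x_def using ok_dotp[OF ok] b1 b2 by auto
  have E: "E = 0 \<or> E = 1" and rg: "\<bar>rg\<bar> \<le> \<delta>" and rm: "\<bar>rm\<bar> \<le> \<delta>"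
    using ok by (auto simp: ok_def x_def rg_def rm_def m_def E_def)
  have m'2: "c / 2 \<le> m'" using ok_G[OF ok u2] by (simp add: m'_def x_def)
  have m2: "c / 2 \<le> m" using ok c_pos by (simp add: ok_def m_def)
  have "?d = E * (yo ob - \<gamma> (zo ob)) * (1 / m' - 1 / m) + (1 - E / m) * (u1 - rg) - E * (u1 - rg) * (1 / m' - 1 / m)"
  proof -
    have "dotp p x b\<gamma> + u1 - \<gamma> (zo ob) = u1 - rg" by (simp add: rg_def)
    moreover have "m \<noteq> 0" "m' \<noteq> 0" using m2 m'2 c_pos by auto
    ultimately show ?thesis
      using arm_score_diff[of m m' E "yo ob" "dotp p x b\<gamma> + u1" "\<gamma> (zo ob)"]
      unfolding m'_def m_def E_def u2_def u1_def by metis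
  qed
  moreover have "?f = E * (yo ob - \<gamma> (zo ob)) * (1 / m' - 1 / m) + (1 - E / m) * (u1 - rg)"
    unfolding F1_def R1_def F2_def R2_def m'_def m_def E_def u2_def u1_def rg_def x_def
    by (simp add: right_diff_distrib)
  ultimately have eq: "?d - ?f = - (E * (u1 - rg) * (1 / m' - 1 / m))" by simp
  have mm: "\<bar>m' - m\<bar> \<le> \<bar>u2\<bar> + \<bar>rm\<bar>"
    using G_lip[of "dotp p x b\<mu> + u2" "dotp p x b\<mu>"] by (simp add: m'_def rm_def)
  have inv: "\<bar>1 / m' - 1 / m\<bar> \<le> 4 / c\<^sup>2 * (\<bar>u2\<bar> + \<bar>rm\<bar>)"
    using abs_inverse_diff_le[OF c_pos m'2 m2] mm
    by (smt (verit) divide_nonneg_nonneg mult_left_mono zero_le_power2)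
  have Eu: "\<bar>E * (u1 - rg)\<bar> \<le> \<bar>E * u1\<bar> + \<bar>rg\<bar>" using E by auto
  have dle: "\<bar>?d - ?f\<bar> \<le> (\<bar>E * u1\<bar> + \<bar>rg\<bar>) * (4 / c\<^sup>2 * (\<bar>u2\<bar> + \<bar>rm\<bar>))"
    unfolding eq abs_minus_cancel abs_mult[of "E * (u1 - rg)"] by (intro mult_mono Eu inv) auto
  \<comment> \<open>Twice the difference of the two sides is (a + b - a' - b')^2 + (a - b)^2 + (a' -
    b')^2.\<close>
  have am: "(a + b) * (a' + b') \<le> a\<^sup>2 + b\<^sup>2 + a'\<^sup>2 + b'\<^sup>2" for a b a' b' :: real
    using zero_le_power2[of "a + b - a' - b'"] zero_le_power2[of "a - b"] zero_le_power2[of "a' - b'"]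
    by (simp add: power2_eq_square algebra_simps)
  have "(\<bar>E * u1\<bar> + \<bar>rg\<bar>) * (4 / c\<^sup>2 * (\<bar>u2\<bar> + \<bar>rm\<bar>)) = 4 / c\<^sup>2 * ((\<bar>E * u1\<bar> + \<bar>rg\<bar>) * (\<bar>u2\<bar> + \<bar>rm\<bar>))"
    by simp
  also have "\<dots> \<le> 4 / c\<^sup>2 * (\<bar>E * u1\<bar>\<^sup>2 + \<bar>rg\<bar>\<^sup>2 + \<bar>u2\<bar>\<^sup>2 + \<bar>rm\<bar>\<^sup>2)"
    by (intro mult_left_mono am) auto
  finally show "\<bar>?d - ?f\<bar> \<le> ?r"
    using dle by (simp add: E_def u1_def u2_def rg_def rm_def m_def)
  have "(\<bar>E * u1\<bar> + \<bar>rg\<bar>) * (4 / c\<^sup>2 * (\<bar>u2\<bar> + \<bar>rm\<bar>)) \<le> (2 * \<delta>) * (4 / c\<^sup>2 * (2 * \<delta>))"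
    using E u1 u2 rg rm \<delta>_pos by (intro mult_mono) auto
  also have "\<dots> = (4 * \<delta>) * (4 / c\<^sup>2 * \<delta>)" by simp
  also have "\<dots> \<le> c * (4 / c\<^sup>2 * \<delta>)" using \<delta>_small \<delta>_pos by (intro mult_right_mono) auto
  also have "\<dots> = 4 / c * \<delta>" using c_pos by (simp add: power2_eq_square)
  also have "\<dots> \<le> L * \<delta>" using L_ge \<delta>_pos by (intro mult_right_mono) auto
  finally have t5: "\<bar>?d - ?f\<bar> \<le> L * \<delta>" using dle by linarith
  have lm: "L * v \<le> L * \<delta>" if "v \<le> \<delta>" for v using that L_pos by (intro mult_left_mono) auto
  have l10: "K * l1norm p (\<lambda>_. 0) \<le> \<delta>" using \<delta>_pos by (simp add: l1norm_def)
  have "\<bar>F1 b2 ob\<bar> \<le> L * \<delta>"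
    using ok_F1_lip[OF ok b2 l10] lm[OF ok_dotp[OF ok b2]] by (simp add: F1_0 dotp_zero)
  moreover have "\<bar>F2 b1 ob\<bar> \<le> L * \<delta>"
    using ok_F2_lip[OF ok, of b1 "\<lambda>_. 0"] lm[OF ok_dotp[OF ok b1]] by (simp add: F2_0 dotp_zero)
  moreover have "\<bar>R1 ob\<bar> \<le> L * \<delta>" using ok_R1[OF ok] lm[OF rm] by (simp add: rm_def m_def x_def)
  moreover have "\<bar>R2 ob\<bar> \<le> L * \<delta>" using ok_R2[OF ok] lm[OF rg] by (simp add: rg_def x_def)
  moreover have "L * \<delta> \<ge> 0" using L_pos \<delta>_pos by simp
  ultimately show "\<bar>?d\<bar> \<le> 8 * L * \<delta>" using t5 by linarith
qed

text \<open>Approximation errors are known in population norm, while the product term needs their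
  empirical squares. As r^2 <= \<delta>^2, the variance of r^2 is at most \<delta>^2 \<rho>, and the
  tail bound applies at tilt 1/\<delta>^2.\<close>

lemma square_sum_tail:
  assumes r: "r \<in> borel_measurable Q" and bd: "AE ob in Q. \<bar>r ob\<bar> \<le> \<delta>"
    and \<rho>: "(\<integral>ob. (r ob)\<^sup>2 \<partial>Q) \<le> \<rho>"
  shows "measure (sampleM n Q) {w \<in> space (sampleM n Q). (\<Sum>i<n. (r (w i))\<^sup>2) \<ge> real n * \<rho> + t}
    \<le> exp (- t / \<delta>\<^sup>2 + real n * \<rho> / \<delta>\<^sup>2)"
proof -
  interpret prob_space Q by (rule Q)
  interpret S: prob_space "sampleM n Q" by (rule prob_space_sampleM[OF Q])
  note [measurable] = r
  define E where "E = (\<integral>ob. (r ob)\<^sup>2 \<partial>Q)"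
  have b2: "AE ob in Q. (r ob)\<^sup>2 \<le> \<delta>\<^sup>2" using AE_square_le[OF bd] by simp
  have i2: "integrable Q (\<lambda>ob. (r ob)\<^sup>2)" by (rule AE_bounded_square_integrable[OF Q r bd])
  have i4: "integrable Q (\<lambda>ob. ((r ob)\<^sup>2)\<^sup>2)"
    by (rule AE_bounded_square_integrable[OF Q _ AE_square_le[OF bd]]) measurable
  have E0: "0 \<le> E" unfolding E_def by simp
  have E1: "E \<le> \<delta>\<^sup>2"
    unfolding E_def using integral_mono_AE[OF i2 integrable_const b2] by (simp add: prob_space)
  let ?f = "\<lambda>ob. (r ob)\<^sup>2 - E"
  have "measure (sampleM n Q) {w \<in> space (sampleM n Q). (\<Sum>i<n. ?f (w i)) \<ge> t}
    \<le> exp (- t / \<delta>\<^sup>2 + real n * (\<delta>\<^sup>2 * \<rho>) / (\<delta>\<^sup>2)\<^sup>2)"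
  proof (rule sample_sum_tail_upper[OF Q])
    show "AE ob in Q. \<bar>?f ob\<bar> \<le> \<delta>\<^sup>2" using b2
    proof eventually_elim
      case (elim ob)
      then show ?case using zero_le_power2[of "r ob"] E0 E1 by linarith
    qed
    show "(\<integral>ob. ?f ob \<partial>Q) = 0" using i2 by (simp add: prob_space E_def)
    have "(\<integral>ob. (?f ob)\<^sup>2 \<partial>Q) = (\<integral>ob. ((r ob)\<^sup>2)\<^sup>2 \<partial>Q) - E\<^sup>2"
      using i2 i4 by (simp add: power2_diff prob_space E_def[symmetric] power2_eq_square[of E])
    also have "\<dots> \<le> (\<integral>ob. \<delta>\<^sup>2 * (r ob)\<^sup>2 \<partial>Q)"
    proof -
      have "(\<integral>ob. ((r ob)\<^sup>2)\<^sup>2 \<partial>Q) \<le> (\<integral>ob. \<delta>\<^sup>2 * (r ob)\<^sup>2 \<partial>Q)"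
      proof (rule integral_mono_AE)
        show "AE ob in Q. ((r ob)\<^sup>2)\<^sup>2 \<le> \<delta>\<^sup>2 * (r ob)\<^sup>2" using b2
        proof eventually_elim
          case (elim ob)
          then show ?case
            unfolding power2_eq_square[of "(r ob)\<^sup>2"] by (rule mult_right_mono) simp
        qed
      qed (use i2 i4 in auto)
      then show ?thesis using zero_le_power2[of E] by linarith
    qed
    also have "\<dots> \<le> \<delta>\<^sup>2 * \<rho>" using \<rho> by (simp add: mult_left_mono)
    finally show "(\<integral>ob. (?f ob)\<^sup>2 \<partial>Q) \<le> \<delta>\<^sup>2 * \<rho>" .
  qed (use \<delta>_pos in auto)
  also have "real n * (\<delta>\<^sup>2 * \<rho>) / (\<delta>\<^sup>2)\<^sup>2 = real n * \<rho> / \<delta>\<^sup>2"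
    using \<delta>_pos by (simp add: power2_eq_square)
  finally have le: "measure (sampleM n Q) {w \<in> space (sampleM n Q). (\<Sum>i<n. ?f (w i)) \<ge> t}
    \<le> exp (- t / \<delta>\<^sup>2 + real n * \<rho> / \<delta>\<^sup>2)" .
  have "measure (sampleM n Q) {w \<in> space (sampleM n Q). (\<Sum>i<n. (r (w i))\<^sup>2) \<ge> real n * \<rho> + t}
     \<le> measure (sampleM n Q) {w \<in> space (sampleM n Q). (\<Sum>i<n. ?f (w i)) \<ge> t}"
  proof (rule S.finite_measure_mono)
    have "real n * E \<le> real n * \<rho>" using \<rho> by (simp add: E_def mult_left_mono)
    then show "{w \<in> space (sampleM n Q). (\<Sum>i<n. (r (w i))\<^sup>2) \<ge> real n * \<rho> + t} \<subseteq> {w \<in> space (sampleM n Q). (\<Sum>i<n. ?f (w i)) \<ge> t}"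
      by (auto simp: sum_subtractf)
    have [measurable]: "(\<lambda>w. \<Sum>i<n. ?f (w i)) \<in> borel_measurable (sampleM n Q)"
      by (rule measurable_sample_sum) measurable
    show "{w \<in> space (sampleM n Q). (\<Sum>i<n. ?f (w i)) \<ge> t} \<in> sets (sampleM n Q)" by measurable
  qed
  then show ?thesis using le by linarith
qed

definition score_err :: "(nat \<Rightarrow> real) \<Rightarrow> (nat \<Rightarrow> real) \<Rightarrow> 'z obs \<Rightarrow> real" where
  "score_err b1 b2 ob = arm_score (e ob) (yo ob) (xd (zo ob) b\<gamma> + xd (zo ob) b1) (G (xd (zo ob) b\<mu> + xd (zo ob) b2))
     - arm_score (e ob) (yo ob) (\<gamma> (zo ob)) (\<mu> (zo ob))"

text \<open>The quantifiers over \<open>b1\<close>, \<open>b2\<close> and \<open>\<tau>\<close>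
  stand inside the property of the fixed sample \<open>w\<close>, so vectors computed from
  \<open>w\<close> may be substituted.\<close>

definition controlled :: "nat \<Rightarrow> nat \<Rightarrow> real \<Rightarrow> real \<Rightarrow> (nat \<Rightarrow> 'z obs) \<Rightarrow> bool" where
  "controlled n k \<rho> t w \<longleftrightarrow> (\<forall>i<n. ok (w i)) \<and>
     (\<forall>b1 b2 \<tau>. l0norm p b1 \<le> k \<longrightarrow> l0norm p b2 \<le> k \<longrightarrow> K * l1norm p b1 \<le> \<delta> \<longrightarrow> K * l1norm p b2 \<le> \<delta> \<longrightarrow>
       (\<integral>ob. (xd (zo ob) b1)\<^sup>2 \<partial>Q) \<le> \<rho> \<longrightarrow> (\<integral>ob. (xd (zo ob) b2)\<^sup>2 \<partial>Q) \<le> \<rho> \<longrightarrow>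
       (\<Sum>i<n. (e (w i) * xd (zo (w i)) b1)\<^sup>2) \<le> \<tau> \<longrightarrow> (\<Sum>i<n. (xd (zo (w i)) b2)\<^sup>2) \<le> \<tau> \<longrightarrow>
       \<bar>\<Sum>i<n. score_err b1 b2 (w i)\<bar> \<le> 4 * t + 2 * L * \<delta> + 8 / c\<^sup>2 * (\<tau> + real n * \<rho> + t * \<delta> / L))"

text \<open>Six exceptional events: uniform deviations of \<open>F1\<close> and \<open>F2\<close>,
  single deviations of \<open>R1\<close> and \<open>R2\<close>, and the empirical squares of the two
  approximation errors. All are brought under one counting factor and one exponential.\<close>

lemma score_deviation:
  assumes n: "n > 0" and k: "k \<le> n" and t: "t \<ge> 0" and \<rho>: "\<rho> \<ge> 0"
    and \<rho>\<gamma>: "(\<integral>ob. (\<gamma> (zo ob) - xd (zo ob) b\<gamma>)\<^sup>2 \<partial>Q) \<le> \<rho>"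
    and \<rho>\<mu>: "(\<integral>ob. (\<mu> (zo ob) - G (xd (zo ob) b\<mu>))\<^sup>2 \<partial>Q) \<le> \<rho>"
  shows "\<exists>B\<in>sets (sampleM n Q). measure (sampleM n Q) B \<le>
       10 * ((real (p + 1) * (2 * (real n)\<^sup>2 + 1)) ^ k * exp (- t / (L * \<delta>) + real n * (2 * \<rho> + 2 * (\<delta> / real n)\<^sup>2) / \<delta>\<^sup>2)) \<and>
     (\<forall>w\<in>space (sampleM n Q) - B. controlled n k \<rho> t w)"
proof -
  let ?S = "sampleM n Q" and ?u = "real n * \<rho> + t * \<delta> / L"
  define N where "N = (real (p + 1) * (2 * (real n)\<^sup>2 + 1)) ^ k"
  define E where "E = exp (- t / (L * \<delta>) + real n * (2 * \<rho> + 2 * (\<delta> / real n)\<^sup>2) / \<delta>\<^sup>2)"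
  interpret S: prob_space ?S by (rule prob_space_sampleM[OF Q])
  \<comment> \<open>Events without a grid have no counting factor; this lets them share the common
    bound.\<close>
  have N1: "N \<ge> 1" unfolding N_def
  proof (rule one_le_power)
    have "1 * 1 \<le> real (p + 1) * (2 * (real n)\<^sup>2 + 1)" by (rule mult_mono) auto
    then show "1 \<le> real (p + 1) * (2 * (real n)\<^sup>2 + 1)" by simp
  qed
  have E0: "E > 0" by (simp add: E_def)
  have NE: "E \<le> N * E" using N1 E0 by simp
  have XQ: "(\<lambda>ob. X (zo ob) j) \<in> borel_measurable Q" for j
    using measurable_compose[OF zo_meas X_meas] .
  have "\<exists>B\<in>sets ?S. measure ?S B \<le> N * (2 * E) \<and> (\<forall>w\<in>space ?S - B. \<forall>b. l0norm p b \<le> k \<longrightarrow> K * l1norm p b \<le> \<delta> \<longrightarrow>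
        (\<integral>x. (xd (zo x) b)\<^sup>2 \<partial>Q) \<le> \<rho> \<longrightarrow> \<bar>\<Sum>i<n. F1 b (w i)\<bar> \<le> t + L * \<delta>)"
    unfolding N_def E_def
  proof (rule sparse_uniform_deviation[OF Q XQ X_bd meas_all(1)])
    show "AE x in Q. \<forall>b b'. K * l1norm p b \<le> \<delta> \<longrightarrow> K * l1norm p b' \<le> \<delta> \<longrightarrow>
        \<bar>F1 b x - F1 b' x\<bar> \<le> L * \<bar>xd (zo x) b - xd (zo x) b'\<bar>"
      using AE_ok by eventually_elim (blast intro: ok_F1_lip)
  qed (use F1_0 mean_F1 \<delta>_pos L_pos n k t in auto)
  then obtain B1 where B1: "B1 \<in> sets ?S" "measure ?S B1 \<le> N * (2 * E)"
    "\<And>w b. w \<in> space ?S - B1 \<Longrightarrow> l0norm p b \<le> k \<Longrightarrow> K * l1norm p b \<le> \<delta> \<Longrightarrow>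
        (\<integral>x. (xd (zo x) b)\<^sup>2 \<partial>Q) \<le> \<rho> \<Longrightarrow> \<bar>\<Sum>i<n. F1 b (w i)\<bar> \<le> t + L * \<delta>"
    by blast
  have "\<exists>B\<in>sets ?S. measure ?S B \<le> N * (2 * E) \<and> (\<forall>w\<in>space ?S - B. \<forall>b. l0norm p b \<le> k \<longrightarrow> K * l1norm p b \<le> \<delta> \<longrightarrow>
        (\<integral>x. (xd (zo x) b)\<^sup>2 \<partial>Q) \<le> \<rho> \<longrightarrow> \<bar>\<Sum>i<n. F2 b (w i)\<bar> \<le> t + L * \<delta>)"
    unfolding N_def E_def
  proof (rule sparse_uniform_deviation[OF Q XQ X_bd meas_all(2)])
    show "AE x in Q. \<forall>b b'. K * l1norm p b \<le> \<delta> \<longrightarrow> K * l1norm p b' \<le> \<delta> \<longrightarrow>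
        \<bar>F2 b x - F2 b' x\<bar> \<le> L * \<bar>xd (zo x) b - xd (zo x) b'\<bar>"
      using AE_ok by eventually_elim (blast intro: ok_F2_lip)
  qed (use F2_0 mean_F2 \<delta>_pos L_pos n k t in auto)
  then obtain B2 where B2: "B2 \<in> sets ?S" "measure ?S B2 \<le> N * (2 * E)"
    "\<And>w b. w \<in> space ?S - B2 \<Longrightarrow> l0norm p b \<le> k \<Longrightarrow> K * l1norm p b \<le> \<delta> \<Longrightarrow>
        (\<integral>x. (xd (zo x) b)\<^sup>2 \<partial>Q) \<le> \<rho> \<Longrightarrow> \<bar>\<Sum>i<n. F2 b (w i)\<bar> \<le> t + L * \<delta>"
    by blast
  have expo: "real n * \<rho> / \<delta>\<^sup>2 \<le> real n * (2 * \<rho> + 2 * (\<delta> / real n)\<^sup>2) / \<delta>\<^sup>2"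
    using \<rho> by (intro divide_right_mono mult_left_mono) auto
  have fixed: "measure ?S {w \<in> space ?S. \<bar>\<Sum>i<n. R (w i)\<bar> \<ge> t} \<le> N * (2 * E)"
    if R: "R \<in> borel_measurable Q" and r: "r \<in> borel_measurable Q" and rb: "AE ob in Q. \<bar>r ob\<bar> \<le> \<delta>"
      and Rr: "AE ob in Q. \<bar>R ob\<bar> \<le> L * \<bar>r ob\<bar>" and mean: "(\<integral>ob. R ob \<partial>Q) = 0"
      and r2: "(\<integral>ob. (r ob)\<^sup>2 \<partial>Q) \<le> \<rho>" for R r
  proof -
    note [measurable] = R r
    have Rb: "AE ob in Q. \<bar>R ob\<bar> \<le> L * \<delta>" using Rr rb
    proof eventually_elim
      case (elim ob)
      then show ?case using mult_left_mono[of "\<bar>r ob\<bar>" \<delta> L] L_pos by linarith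
    qed
    have ir: "integrable Q (\<lambda>ob. (r ob)\<^sup>2)" by (rule AE_bounded_square_integrable[OF Q r rb])
    have iR: "integrable Q (\<lambda>ob. (R ob)\<^sup>2)" by (rule AE_bounded_square_integrable[OF Q R Rb])
    have "(\<integral>ob. (R ob)\<^sup>2 \<partial>Q) \<le> (\<integral>ob. L\<^sup>2 * (r ob)\<^sup>2 \<partial>Q)"
    proof (rule integral_mono_AE)
      show "AE ob in Q. (R ob)\<^sup>2 \<le> L\<^sup>2 * (r ob)\<^sup>2" using Rr
      proof eventually_elim
        case (elim ob)
        then show ?case using power_mono[OF elim, of 2] by (simp add: power_mult_distrib)
      qed
    qed (use iR ir in auto)
    also have "\<dots> \<le> L\<^sup>2 * \<rho>" using r2 by (simp add: mult_left_mono)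
    finally have var: "(\<integral>ob. (R ob)\<^sup>2 \<partial>Q) \<le> L\<^sup>2 * \<rho>" .
    have "measure ?S {w \<in> space ?S. \<bar>\<Sum>i<n. R (w i)\<bar> \<ge> t} \<le> 2 * exp (- t / (L * \<delta>) + real n * (L\<^sup>2 * \<rho>) / (L * \<delta>)\<^sup>2)"
      by (rule sample_sum_tail[OF Q R Rb _ mean var]) (use L_pos \<delta>_pos in simp)
    also have "real n * (L\<^sup>2 * \<rho>) / (L * \<delta>)\<^sup>2 = real n * \<rho> / \<delta>\<^sup>2"
      using L_pos by (simp add: power_mult_distrib)
    also have "2 * exp (- t / (L * \<delta>) + real n * \<rho> / \<delta>\<^sup>2) \<le> 2 * E"
      unfolding E_def using expo by simp
    also have "\<dots> \<le> N * (2 * E)" using NE by simp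
    finally show ?thesis .
  qed
  define B3 where "B3 = {w \<in> space ?S. \<bar>\<Sum>i<n. R1 (w i)\<bar> \<ge> t}"
  have B3: "B3 \<in> sets ?S" "measure ?S B3 \<le> N * (2 * E)"
  proof -
    have [measurable]: "(\<lambda>w. \<Sum>i<n. R1 (w i)) \<in> borel_measurable ?S"
      by (rule measurable_sample_sum) (rule meas_all)
    show "B3 \<in> sets ?S" unfolding B3_def by measurable
    show "measure ?S B3 \<le> N * (2 * E)" unfolding B3_def
      by (rule fixed[OF meas_all(3) meas_all(6) r\<mu>_bd _ mean_R1 \<rho>\<mu>])
         (rule eventually_mono[OF AE_ok], rule ok_R1)
  qed
  define B4 where "B4 = {w \<in> space ?S. \<bar>\<Sum>i<n. R2 (w i)\<bar> \<ge> t}"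
  have B4: "B4 \<in> sets ?S" "measure ?S B4 \<le> N * (2 * E)"
  proof -
    have [measurable]: "(\<lambda>w. \<Sum>i<n. R2 (w i)) \<in> borel_measurable ?S"
      by (rule measurable_sample_sum) (rule meas_all)
    show "B4 \<in> sets ?S" unfolding B4_def by measurable
    show "measure ?S B4 \<le> N * (2 * E)" unfolding B4_def
      by (rule fixed[OF meas_all(4) meas_all(5) r\<gamma>_bd _ mean_R2 \<rho>\<gamma>])
         (rule eventually_mono[OF AE_ok], rule ok_R2)
  qed
  let ?W = "\<lambda>r. {w \<in> space ?S. (\<Sum>i<n. (r (w i))\<^sup>2) \<ge> ?u}"
  have sq: "?W r \<in> sets ?S \<and>
      measure ?S (?W r) \<le> N * E"
    if r: "r \<in> borel_measurable Q" and rb: "AE ob in Q. \<bar>r ob\<bar> \<le> \<delta>" and r2: "(\<integral>ob. (r ob)\<^sup>2 \<partial>Q) \<le> \<rho>" for r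
  proof
    have [measurable]: "(\<lambda>w. \<Sum>i<n. (r (w i))\<^sup>2) \<in> borel_measurable ?S"
      by (rule measurable_sample_sum[of "\<lambda>ob. (r ob)\<^sup>2"]) (use r in simp)
    show "?W r \<in> sets ?S" by measurable
    \<comment> \<open>The excess t \<delta>/L is chosen so that tilt 1/\<delta>^2 yields the same
      exponent t/(L \<delta>) as the other events.\<close>
    have "- (t * \<delta> / L) / \<delta>\<^sup>2 = - t / (L * \<delta>)" using \<delta>_pos by (simp add: power2_eq_square)
    then have "measure ?S (?W r)
       \<le> exp (- t / (L * \<delta>) + real n * \<rho> / \<delta>\<^sup>2)"
      using square_sum_tail[OF r rb r2, of n "t * \<delta> / L"] by simp
    also have "\<dots> \<le> E" unfolding E_def using expo by simp
    finally show "measure ?S (?W r) \<le> N * E"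
      using NE by linarith
  qed
  define B5 where "B5 = {w \<in> space ?S. (\<Sum>i<n. (\<gamma> (zo (w i)) - xd (zo (w i)) b\<gamma>)\<^sup>2) \<ge> ?u}"
  define B6 where "B6 = {w \<in> space ?S. (\<Sum>i<n. (\<mu> (zo (w i)) - G (xd (zo (w i)) b\<mu>))\<^sup>2) \<ge> ?u}"
  have B5: "B5 \<in> sets ?S" "measure ?S B5 \<le> N * E"
    using sq[OF meas_all(5) r\<gamma>_bd \<rho>\<gamma>] by (auto simp: B5_def)
  have B6: "B6 \<in> sets ?S" "measure ?S B6 \<le> N * E"
    using sq[OF meas_all(6) r\<mu>_bd \<rho>\<mu>] by (auto simp: B6_def)
  \<comment> \<open>The constant 10 is 2 + 2 + 2 + 2 for the four two-sided deviations plus 1 + 1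
    for the two one-sided ones.\<close>
  define A where "A = B1 \<union> (B2 \<union> (B3 \<union> (B4 \<union> (B5 \<union> B6))))"
  have A: "A \<in> sets ?S" using B1 B2 B3 B4 B5 B6 by (auto simp: A_def)
  have "measure ?S A \<le> measure ?S B1 + (measure ?S B2 + (measure ?S B3 + (measure ?S B4 + (measure ?S B5 + measure ?S B6))))"
    unfolding A_def using B1 B2 B3 B4 B5 B6
    by (intro order_trans[OF measure_Un_le] add_left_mono sets.Un order_refl) auto
  also have "\<dots> \<le> 10 * (N * E)" using B1(2) B2(2) B3(2) B4(2) B5(2) B6(2) by linarith
  finally have mA: "measure ?S A \<le> 10 * (N * E)" .
  obtain B where B: "B \<in> sets ?S" "measure ?S B \<le> 10 * (N * E)"
      "\<And>w. w \<in> space ?S - B \<Longrightarrow> (\<forall>i<n. ok (w i)) \<and> w \<notin> A"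
    using measure_le_AE_event[OF S.prob_space_axioms A AE_sampleM[OF Q AE_ok] mA] by blast
  have main: "\<bar>\<Sum>i<n. score_err b1 b2 (w i)\<bar> \<le> 4 * t + 2 * L * \<delta> + 8 / c\<^sup>2 * (\<tau> + real n * \<rho> + t * \<delta> / L)"
      (is "\<bar>\<Sum>i<n. ?D i\<bar> \<le> _")
    if w: "w \<in> space ?S - B" and s1: "l0norm p b1 \<le> k" and s2: "l0norm p b2 \<le> k"
      and l1: "K * l1norm p b1 \<le> \<delta>" and l2: "K * l1norm p b2 \<le> \<delta>"
      and v1: "(\<integral>ob. (xd (zo ob) b1)\<^sup>2 \<partial>Q) \<le> \<rho>" and v2: "(\<integral>ob. (xd (zo ob) b2)\<^sup>2 \<partial>Q) \<le> \<rho>"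
      and q1: "(\<Sum>i<n. (e (w i) * xd (zo (w i)) b1)\<^sup>2) \<le> \<tau>"
      and q2: "(\<Sum>i<n. (xd (zo (w i)) b2)\<^sup>2) \<le> \<tau>" for w b1 b2 \<tau>
  proof -
    have okw: "\<And>i. i < n \<Longrightarrow> ok (w i)" and wA: "w \<notin> A" using B(3)[OF w] by auto
    have wS: "w \<in> space ?S" using w by auto
    let ?f = "\<lambda>i. F1 b2 (w i) + R1 (w i) + F2 b1 (w i) - R2 (w i)"
    let ?r = "\<lambda>i. (e (w i) * xd (zo (w i)) b1)\<^sup>2 + (\<gamma> (zo (w i)) - xd (zo (w i)) b\<gamma>)\<^sup>2
        + (xd (zo (w i)) b2)\<^sup>2 + (\<mu> (zo (w i)) - G (xd (zo (w i)) b\<mu>))\<^sup>2"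
    have "\<bar>(\<Sum>i<n. ?D i) - (\<Sum>i<n. ?f i)\<bar> \<le> (\<Sum>i<n. \<bar>?D i - ?f i\<bar>)"
      by (rule order_trans[OF eq_refl[OF arg_cong[where f=abs, OF sum_subtractf[symmetric]]] sum_abs])
    also have "\<dots> \<le> (\<Sum>i<n. 4 / c\<^sup>2 * ?r i)"
      by (rule sum_mono) (use ok_score_diff(1)[OF okw l1 l2] in \<open>auto simp: score_err_def\<close>)
    also have "\<dots> = 4 / c\<^sup>2 * (\<Sum>i<n. ?r i)" by (simp only: sum_distrib_left)
    also have "\<dots> \<le> 4 / c\<^sup>2 * (2 * (\<tau> + real n * \<rho> + t * \<delta> / L))"
    proof (rule mult_left_mono)
      have add4: "a + b + a' + b' \<le> 2 * (u + v + v')"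
        if "b \<le> v + v'" "b' \<le> v + v'" "a \<le> u" "a' \<le> u" for a b a' b' u v v' :: real
        using add_mono[OF add_mono[OF add_mono[OF that(3) that(1)] that(4)] that(2)] by (simp add: algebra_simps)
      have "(\<Sum>i<n. (\<gamma> (zo (w i)) - xd (zo (w i)) b\<gamma>)\<^sup>2) \<le> ?u"
        using wA wS unfolding A_def B5_def by simp
      moreover have "(\<Sum>i<n. (\<mu> (zo (w i)) - G (xd (zo (w i)) b\<mu>))\<^sup>2) \<le> ?u"
        using wA wS unfolding A_def B6_def by simp
      ultimately show "(\<Sum>i<n. ?r i) \<le> 2 * (\<tau> + real n * \<rho> + t * \<delta> / L)"
        unfolding sum.distrib using q1 q2 by (rule add4)
    qed simp
    finally have rem: "\<bar>(\<Sum>i<n. ?D i) - (\<Sum>i<n. ?f i)\<bar> \<le> 8 / c\<^sup>2 * (\<tau> + real n * \<rho> + t * \<delta> / L)"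
      by simp
    have "\<bar>\<Sum>i<n. F1 b2 (w i)\<bar> \<le> t + L * \<delta>" by (rule B1(3)[OF _ s2 l2 v2]) (use wS wA in \<open>auto simp: A_def\<close>)
    moreover have "\<bar>\<Sum>i<n. F2 b1 (w i)\<bar> \<le> t + L * \<delta>" by (rule B2(3)[OF _ s1 l1 v1]) (use wS wA in \<open>auto simp: A_def\<close>)
    moreover have "\<bar>\<Sum>i<n. R1 (w i)\<bar> \<le> t" using wA wS unfolding A_def B3_def by simp
    moreover have "\<bar>\<Sum>i<n. R2 (w i)\<bar> \<le> t" using wA wS unfolding A_def B4_def by simp
    ultimately have "\<bar>\<Sum>i<n. ?f i\<bar> \<le> 4 * t + 2 * L * \<delta>"
      unfolding sum.distrib sum_subtractf by linarith
    then show ?thesis using rem by linarith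
  qed
  show ?thesis
    unfolding N_def[symmetric] E_def[symmetric] controlled_def
  proof (rule bexI[OF _ B(1)], intro conjI ballI allI impI)
    show "measure ?S B \<le> 10 * (N * E)" by (rule B(2))
    show "ok (w i)" if "w \<in> space ?S - B" "i < n" for w i using B(3) that by blast
  qed (rule main)
qed

end

section \<open>From the regression model to the two arms\<close>

text \<open>A function of f is measurable for the sigma-algebra generated by f and can be pulled
  into the conditional expectation, which vanishes.\<close>

lemma orth_from_cond_exp:
  assumes Q: "prob_space Q" and f: "f \<in> measurable Q N" and sp: "space Q = \<Omega>"
    and u: "integrable Q u" and ub: "AE x in Q. \<bar>u x\<bar> \<le> U"
    and ce: "AE x in Q. real_cond_exp Q (vimage_algebra \<Omega> f N) u x = 0"
    and h: "h \<in> borel_measurable N" and hb: "AE x in Q. \<bar>h (f x)\<bar> \<le> B"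
  shows "(\<integral>x. u x * h (f x) \<partial>Q) = 0"
proof -
  let ?F = "vimage_algebra \<Omega> f N"
  interpret prob_space Q by fact
  have fs: "f \<in> \<Omega> \<rightarrow> space N" using f sp by (auto simp: measurable_def)
  have sub: "subalgebra Q ?F"
    unfolding subalgebra_def using sp measurable_sets[OF f] fs
    by (auto simp: sets_vimage_algebra2)
  interpret finite_measure_subalgebra Q ?F by standard (rule sub)
  have hm: "(\<lambda>x. h (f x)) \<in> borel_measurable ?F"
    using measurable_compose[OF measurable_vimage_algebra1[OF fs] h] .
  have hQ: "(\<lambda>x. h (f x)) \<in> borel_measurable Q" using measurable_compose[OF f h] .
  have uQ: "u \<in> borel_measurable Q" using u by simp
  have int: "integrable Q (\<lambda>x. h (f x) * u x)"
  proof (rule AE_bounded_integrable[OF Q])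
    show "AE x in Q. \<bar>h (f x) * u x\<bar> \<le> \<bar>B\<bar> * \<bar>U\<bar>" using ub hb
      by eventually_elim (auto simp: abs_mult intro!: mult_mono)
  qed (use hQ uQ in auto)
  have "(\<integral>x. u x * h (f x) \<partial>Q) = (\<integral>x. h (f x) * real_cond_exp Q ?F u x \<partial>Q)"
    using real_cond_exp_intg(2)[OF int hm uQ] by (simp add: mult.commute)
  also have "\<dots> = (\<integral>x. 0 \<partial>Q)"
  proof (rule integral_cong_AE)
    show "AE x in Q. h (f x) * real_cond_exp Q ?F u x = 0" using ce by eventually_elim simp
    show "(\<lambda>x. h (f x) * real_cond_exp Q ?F u x) \<in> borel_measurable Q" using hQ by measurable
  qed simp
  finally show ?thesis by simp
qed

text \<open>Orthogonality allows the indicator \<open>e\<close> to be replaced by the propensity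
  under the integral, and the propensity is at least \<open>c\<close>. A bound on the observed arm
  thus becomes a bound on the whole population at the price 1/c.\<close>

lemma overlap_integral_le:
  fixes z :: "'a \<Rightarrow> 'b" and h \<mu> :: "'b \<Rightarrow> real"
  assumes Q: "prob_space Q" and z: "z \<in> measurable Q N"
    and e: "e \<in> borel_measurable Q" and \<mu>: "\<mu> \<in> borel_measurable N"
    and eb: "AE x in Q. 0 \<le> e x \<and> e x \<le> 1" and \<mu>b: "AE x in Q. c \<le> \<mu> (z x) \<and> \<mu> (z x) \<le> 1"
    and orth: "\<And>h B. h \<in> borel_measurable N \<Longrightarrow> AE x in Q. \<bar>h (z x)\<bar> \<le> B \<Longrightarrow>
        (\<integral>x. (e x - \<mu> (z x)) * h (z x) \<partial>Q) = 0"
    and h: "h \<in> borel_measurable N" and h0: "AE x in Q. 0 \<le> h (z x)" and hb: "AE x in Q. \<bar>h (z x)\<bar> \<le> B"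
    and c: "c > 0"
  shows "c * (\<integral>x. h (z x) \<partial>Q) \<le> (\<integral>x. e x * h (z x) \<partial>Q)"
proof -
  note [measurable] = z e \<mu> h
  have ih: "integrable Q (\<lambda>x. h (z x))" by (rule AE_bounded_integrable[OF Q _ hb]) measurable
  have ie: "integrable Q (\<lambda>x. e x * h (z x))"
  proof (rule AE_bounded_integrable[OF Q])
    show "AE x in Q. \<bar>e x * h (z x)\<bar> \<le> 1 * \<bar>B\<bar>" using eb hb
      by eventually_elim (unfold abs_mult, intro mult_mono, auto)
  qed measurable
  have im: "integrable Q (\<lambda>x. \<mu> (z x) * h (z x))"
  proof (rule AE_bounded_integrable[OF Q])
    show "AE x in Q. \<bar>\<mu> (z x) * h (z x)\<bar> \<le> 1 * \<bar>B\<bar>" using \<mu>b hb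
      by eventually_elim (unfold abs_mult, intro mult_mono, use c in auto)
  qed measurable
  have "c * (\<integral>x. h (z x) \<partial>Q) = (\<integral>x. c * h (z x) \<partial>Q)" by simp
  also have "\<dots> \<le> (\<integral>x. \<mu> (z x) * h (z x) \<partial>Q)"
  proof (rule integral_mono_AE)
    show "AE x in Q. c * h (z x) \<le> \<mu> (z x) * h (z x)" using \<mu>b h0
      by eventually_elim (auto intro: mult_right_mono)
  qed (use ih im in auto)
  also have "\<dots> = (\<integral>x. e x * h (z x) \<partial>Q)"
    using orth[OF h hb] ie im by (simp add: left_diff_distrib)
  finally show ?thesis .
qed

text \<open>The indicator of the failure set is the test function. This is what bounds the
  regression function and its approximation error at the treatment that was not received.\<close>

lemma overlap_AE:
  fixes z :: "'a \<Rightarrow> 'b" and \<mu> :: "'b \<Rightarrow> real"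
  assumes Q: "prob_space Q" and z: "z \<in> measurable Q N"
    and e: "e \<in> borel_measurable Q" and \<mu>: "\<mu> \<in> borel_measurable N"
    and e01: "AE x in Q. e x = 0 \<or> e x = 1" and \<mu>b: "AE x in Q. c \<le> \<mu> (z x) \<and> \<mu> (z x) \<le> 1"
    and orth: "\<And>h B. h \<in> borel_measurable N \<Longrightarrow> AE x in Q. \<bar>h (z x)\<bar> \<le> B \<Longrightarrow>
        (\<integral>x. (e x - \<mu> (z x)) * h (z x) \<partial>Q) = 0"
    and c: "c > 0" and P: "{y \<in> space N. \<not> P y} \<in> sets N" and eP: "AE x in Q. e x = 1 \<longrightarrow> P (z x)"
  shows "AE x in Q. P (z x)"
proof -
  let ?A = "{y \<in> space N. \<not> P y}"
  have eb: "AE x in Q. 0 \<le> e x \<and> e x \<le> 1" using e01 by eventually_elim auto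
  have ih: "integrable Q (\<lambda>x. indicator ?A (z x) :: real)"
    by (rule AE_bounded_integrable[OF Q, where B=1])
       (use measurable_compose[OF z borel_measurable_indicator[OF P]] in \<open>auto simp: indicator_def\<close>)
  have "c * (\<integral>x. indicator ?A (z x) \<partial>Q) \<le> (\<integral>x. e x * indicator ?A (z x) \<partial>Q)"
    by (rule overlap_integral_le[OF Q z e \<mu> eb \<mu>b orth, where B=1])
       (use P c in \<open>auto simp: indicator_def\<close>)
  also have "\<dots> = (\<integral>x. 0 \<partial>Q)"
  proof (rule integral_cong_AE)
    show "AE x in Q. e x * indicator ?A (z x) = 0" using eP e01
      by eventually_elim (auto simp: indicator_def)
    show "(\<lambda>x. e x * indicator ?A (z x)) \<in> borel_measurable Q"
      using e measurable_compose[OF z borel_measurable_indicator[OF P]] by (rule borel_measurable_times)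
  qed simp
  finally have "(\<integral>x. indicator ?A (z x) \<partial>Q) \<le> (0::real)" using c by (simp add: mult_le_0_iff)
  then have "(\<integral>x. indicator ?A (z x) \<partial>Q) = (0::real)" by (simp add: antisym)
  then have "AE x in Q. (indicator ?A (z x) :: real) = 0"
    using integral_nonneg_eq_0_iff_AE[OF ih] by simp
  then show ?thesis using AE_space
  proof eventually_elim
    case (elim x)
    then show ?case using measurable_space[OF z] by (auto simp: indicator_def split: if_splits)
  qed
qed

lemma integral_square_le_L2norm:
  assumes "L2norm M f \<le> a"
  shows "(\<integral>x. (f x)\<^sup>2 \<partial>M) \<le> a\<^sup>2"
proof -
  have "(L2norm M f)\<^sup>2 \<le> a\<^sup>2" using assms by (intro power_mono) (auto simp: L2norm_def)
  then show ?thesis by (simp add: L2norm_def)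
qed

text \<open>For a <= b, exp b - exp a <= exp b (b - a), and the denominator (1 + exp a)(1 + exp b)
  dominates exp b. The constant 1 is shared with the identity link.\<close>

lemma logistic_lipschitz: "\<bar>logistic u - logistic v\<bar> \<le> \<bar>u - v\<bar>"
proof -
  have mono: "logistic b - logistic a \<le> b - a \<and> logistic a \<le> logistic b" if ab: "a \<le> b" for a b
  proof
    have pos: "1 + exp a > 0" "1 + exp b > 0" by (simp_all add: add_pos_pos)
    have eq: "logistic b - logistic a = (exp b - exp a) / ((1 + exp a) * (1 + exp b))"
      using pos by (simp add: logistic_def field_simps)
    show "logistic a \<le> logistic b"
      using eq ab pos by (smt (verit) divide_nonneg_pos exp_le_cancel_iff mult_pos_pos)
    have "1 + (a - b) \<le> exp (a - b)" by (rule exp_ge_add_one_self)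
    then have "exp b * (1 + (a - b)) \<le> exp b * exp (a - b)" by (intro mult_left_mono) auto
    also have "\<dots> = exp a" by (simp add: exp_add[symmetric])
    finally have "exp b - exp a \<le> exp b * (b - a)" by (simp add: algebra_simps)
    also have "\<dots> \<le> ((1 + exp a) * (1 + exp b)) * (b - a)"
    proof (rule mult_right_mono)
      have "exp b \<le> 1 * (1 + exp b)" by simp
      also have "\<dots> \<le> (1 + exp a) * (1 + exp b)" using pos by (intro mult_right_mono) auto
      finally show "exp b \<le> (1 + exp a) * (1 + exp b)" .
    qed (use ab in simp)
    finally have "exp b - exp a \<le> (b - a) * ((1 + exp a) * (1 + exp b))" by (simp add: mult.commute)
    then show "logistic b - logistic a \<le> b - a"
      unfolding eq using pos by (subst pos_divide_le_eq) auto
  qed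
  show ?thesis using mono[of u v] mono[of v u] by (cases "u \<le> v") auto
qed

lemma l0norm_diff_le: "l0norm q (\<lambda>j. a j - b j) \<le> l0norm q a + l0norm q b"
proof -
  have "{j. j < q \<and> a j - b j \<noteq> 0} \<subseteq> {j. j < q \<and> a j \<noteq> 0} \<union> {j. j < q \<and> b j \<noteq> 0}" by auto
  then have "card {j. j < q \<and> a j - b j \<noteq> 0} \<le> card ({j. j < q \<and> a j \<noteq> 0} \<union> {j. j < q \<and> b j \<noteq> 0})"
    by (intro card_mono) auto
  also have "\<dots> \<le> card {j. j < q \<and> a j \<noteq> 0} + card {j. j < q \<and> b j \<noteq> 0}" by (rule card_Un_le)
  finally show ?thesis by (simp add: l0norm_def)
qed

lemma l0norm_blocks_le:
  "l0norm q b \<le> l0norm (2 * q) b" "l0norm q (\<lambda>j. b (q + j)) \<le> l0norm (2 * q) b"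
proof -
  show "l0norm q b \<le> l0norm (2 * q) b" unfolding l0norm_def by (rule card_mono) auto
  have "card {j. j < q \<and> b (q + j) \<noteq> 0} = card ((+) q ` {j. j < q \<and> b (q + j) \<noteq> 0})"
    by (simp add: card_image)
  also have "\<dots> \<le> card {j. j < 2 * q \<and> b j \<noteq> 0}" by (rule card_mono) auto
  finally show "l0norm q (\<lambda>j. b (q + j)) \<le> l0norm (2 * q) b" unfolding l0norm_def .
qed

lemma l1norm_blocks_le:
  "l1norm q b \<le> l1norm (2 * q) b" "l1norm q (\<lambda>j. b (q + j)) \<le> l1norm (2 * q) b"
proof -
  show "l1norm q b \<le> l1norm (2 * q) b" unfolding l1norm_def by (rule sum_mono2) auto
  have "(\<Sum>j<q. \<bar>b (q + j)\<bar>) = (\<Sum>j\<in>(+) q ` {..<q}. \<bar>b j\<bar>)"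
    by (simp add: sum.reindex)
  also have "\<dots> \<le> (\<Sum>j<2*q. \<bar>b j\<bar>)" by (rule sum_mono2) auto
  finally show "l1norm q (\<lambda>j. b (q + j)) \<le> l1norm (2 * q) b" unfolding l1norm_def .
qed

text \<open>Padding places a propensity coefficient vector in the treated block, where the norm
  comparison for the stacked regressor applies to it with unchanged sparsity.\<close>

lemma l0norm_pad: "l0norm (2 * q) (\<lambda>j. if j < q then b j else 0) = l0norm q b"
  unfolding l0norm_def by (rule arg_cong[where f=card]) auto

lemma xtdot_pad: "xtdot q x d (\<lambda>j. if j < q then b j else 0) = d * dotp q x b"
  by (simp add: xtdot_def dotp_def)

locale hte =
  fixes Mz :: "'z measure" and \<delta> \<Delta> K s :: "nat \<Rightarrow> real" and p :: "nat \<Rightarrow> nat"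
    and C c c' :: real and Pd :: "nat \<Rightarrow> 'z \<Rightarrow> nat \<Rightarrow> real" and Lam :: "real \<Rightarrow> real"
    and bghat bmhat :: "nat \<Rightarrow> (nat \<Rightarrow> 'z obs) \<Rightarrow> nat \<Rightarrow> real"
    and n :: nat and D :: "'z dgp"
  assumes D: "D \<in> HTE_class Mz \<delta> \<Delta> K s p C c c' Pd Lam bghat bmhat n"
    and \<delta>_pos: "\<delta> n > 0" and C_pos: "C > 0" and c_pos: "c > 0" and c'_pos: "0 < c'" and c'_less: "c' < 1/2"
    and link: "Lam = (\<lambda>u. u) \<or> Lam = logistic"
    and Pd_meas: "\<And>n j. (\<lambda>z. Pd n z j) \<in> borel_measurable Mz"
    and bghat_meas: "\<And>n j. (\<lambda>w. bghat n w j) \<in> borel_measurable (PiM {..<n} (\<lambda>_. obsM Mz))"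
    and bmhat_meas: "\<And>n j. (\<lambda>w. bmhat n w j) \<in> borel_measurable (PiM {..<n} (\<lambda>_. obsM Mz))"
begin

abbreviation "Q \<equiv> lawQ D"
abbreviation "g \<equiv> gfun D"
abbreviation "m \<equiv> mfun D"
abbreviation "S \<equiv> sampleM n Q"
abbreviation "x z \<equiv> Pd n z"
abbreviation "xb z \<equiv> dotp (p n) (Pd n z)"

definition \<zeta> :: "'z obs \<Rightarrow> real" where "\<zeta> ob = yo ob - g (dO ob) (zo ob)"
definition rg :: "'z obs \<Rightarrow> real" where
  "rg ob = g (dO ob) (zo ob) - xtdot (p n) (x (zo ob)) (dO ob) (bg0 D)"
definition rm :: "'z obs \<Rightarrow> real" where
  "rm ob = m (zo ob) - Lam (xb (zo ob) (bm0 D))"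

lemmas D_unfolded = D[unfolded HTE_class_def Let_def mem_Collect_eq]

lemma Q: "prob_space Q"
  and sets_Q: "sets Q = sets (obsM Mz)"
  and g_meas: "(\<lambda>(d, z). g d z) \<in> borel_measurable (borel \<Otimes>\<^sub>M Mz)"
  and m_meas: "m \<in> borel_measurable Mz"
  and d01: "AE ob in Q. dO ob = 0 \<or> dO ob = 1"
  using D_unfolded by - (elim conjE, assumption)+

lemma \<zeta>_int: "integrable Q \<zeta>"
  and \<zeta>_ce: "AE ob in Q. real_cond_exp Q (sigma_dz Mz) \<zeta> ob = 0"
  unfolding \<zeta>_def[abs_def] using D_unfolded by - (elim conjE, assumption)+

lemma v_int: "integrable Q (\<lambda>ob. dO ob - m (zo ob))"
  and v_ce: "AE ob in Q. real_cond_exp Q (sigma_z Mz) (\<lambda>ob. dO ob - m (zo ob)) ob = 0"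
  using D_unfolded by - (elim conjE, assumption)+

lemma rg_L2: "L2norm Q rg \<le> \<delta> n * real n powr (-1/4)"
  and rg_bd: "AE ob in Q. \<bar>rg ob\<bar> \<le> \<delta> n"
  unfolding rg_def[abs_def] using D_unfolded by - (elim conjE, assumption)+

lemma rm_L2: "L2norm Q rm \<le> \<delta> n * real n powr (-1/4)"
  and rm_bd: "AE ob in Q. \<bar>rm ob\<bar> \<le> \<delta> n"
  unfolding rm_def[abs_def] using D_unfolded by - (elim conjE, assumption)+

lemma bg0_sparse: "real (l0norm (2 * p n) (bg0 D)) \<le> C * s n"
  and bm0_sparse: "real (l0norm (p n) (bm0 D)) \<le> C * s n"
  using D_unfolded by - (elim conjE, assumption)+

definition good_sample :: "(nat \<Rightarrow> 'z obs) \<Rightarrow> bool" where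
  "good_sample w \<longleftrightarrow>
    Pn2 n (\<lambda>i. xtdot (p n) (x (zo (w i))) (dO (w i)) (\<lambda>j. bghat n w j - bg0 D j)) \<le> \<delta> n * real n powr (-1/4) \<and>
    Pn2 n (\<lambda>i. xb (zo (w i)) (\<lambda>j. bmhat n w j - bm0 D j)) \<le> \<delta> n * real n powr (-1/4) \<and>
    K n * l1norm (2 * p n) (\<lambda>j. bghat n w j - bg0 D j) \<le> \<delta> n \<and>
    K n * l1norm (p n) (\<lambda>j. bmhat n w j - bm0 D j) \<le> \<delta> n \<and>
    real (l0norm (2 * p n) (bghat n w)) \<le> C * s n \<and>
    real (l0norm (p n) (bmhat n w)) \<le> C * s n \<and>
    (\<forall>b. real (l0norm (2 * p n) b) \<le> 2 * C * s n \<and>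
          L2norm Q (\<lambda>ob. xtdot (p n) (x (zo ob)) (dO ob) b) > 0 \<longrightarrow>
       \<bar>Pn2 n (\<lambda>i. xtdot (p n) (x (zo (w i))) (dO (w i)) b)
          / L2norm Q (\<lambda>ob. xtdot (p n) (x (zo ob)) (dO ob) b) - 1\<bar> \<le> \<delta> n)"

lemma estimators: "\<exists>A\<in>sets S. measure S A \<ge> 1 - \<Delta> n \<and> (\<forall>w\<in>A. good_sample w)"
  unfolding good_sample_def using D_unfolded by (elim conjE)

lemma x_bd: "AE ob in Q. \<forall>j<p n. \<bar>x (zo ob) j\<bar> \<le> K n"
proof -
  have *: "\<forall>j<p n. AE ob in Q. \<bar>x (zo ob) j\<bar> \<le> K n" using D_unfolded by (elim conjE)
  have "AE ob in Q. \<forall>j\<in>{..<p n}. \<bar>x (zo ob) j\<bar> \<le> K n"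
    using * by (intro eventually_ball_finite) auto
  then show ?thesis by eventually_elim auto
qed

lemma g_bd: "AE ob in Q. \<bar>g (dO ob) (zo ob)\<bar> \<le> C"
  and y_bd: "AE ob in Q. \<bar>yo ob\<bar> \<le> C"
  and m_bd: "AE ob in Q. c' \<le> m (zo ob) \<and> m (zo ob) \<le> 1 - c'"
  using D_unfolded by - (elim conjE, assumption)+

lemma \<zeta>_lower: "L2norm Q (\<lambda>ob. (\<zeta> ob)\<^sup>2) \<ge> c" unfolding \<zeta>_def using D_unfolded by (elim conjE)

lemma growth: "(s n * ln (real (max (p n) n)))\<^sup>2 / real n \<le> \<delta> n" using D_unfolded by (elim conjE)

lemma space_Q: "space Q = space (obsM Mz)" using sets_Q by (rule sets_eq_imp_space_eq)

lemma obs_meas: "yo \<in> borel_measurable Q" "dO \<in> borel_measurable Q" "zo \<in> measurable Q Mz"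
  unfolding yo_def[abs_def] dO_def[abs_def] zo_def[abs_def] measurable_cong_sets[OF sets_Q refl]
  by (simp_all add: obsM_def)

lemma dz_meas: "(\<lambda>ob. (dO ob, zo ob)) \<in> measurable Q (borel \<Otimes>\<^sub>M Mz)"
  using obs_meas by measurable

lemma garm_meas: "g d \<in> borel_measurable Mz"
  using measurable_compose[OF measurable_Pair1' g_meas, of d] by simp

lemma gobs_meas: "(\<lambda>ob. g (dO ob) (zo ob)) \<in> borel_measurable Q"
  using measurable_compose[OF dz_meas g_meas] by simp

lemma dotp_meas: "(\<lambda>z. xb z b) \<in> borel_measurable Mz"
  by (rule measurable_dotp) (rule Pd_meas)

lemma Lam_meas: "Lam \<in> borel_measurable borel"
  using link unfolding logistic_def[abs_def] by auto

lemma Lam_lip: "\<bar>Lam u - Lam v\<bar> \<le> \<bar>u - v\<bar>"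
  using link logistic_lipschitz by auto

lemma \<zeta>_bd: "AE ob in Q. \<bar>\<zeta> ob\<bar> \<le> 2 * C"
  using y_bd g_bd unfolding \<zeta>_def by eventually_elim linarith

lemma orth_dz:
  assumes "h \<in> borel_measurable (borel \<Otimes>\<^sub>M Mz)" "AE ob in Q. \<bar>h (dO ob, zo ob)\<bar> \<le> B"
  shows "(\<integral>ob. \<zeta> ob * h (dO ob, zo ob) \<partial>Q) = 0"
  by (rule orth_from_cond_exp[OF Q dz_meas space_Q \<zeta>_int \<zeta>_bd \<zeta>_ce[unfolded sigma_dz_def] assms])

lemma v_bd: "AE ob in Q. \<bar>dO ob - m (zo ob)\<bar> \<le> 1"
  using d01 m_bd by eventually_elim (use c'_pos in auto)

lemma orth_z:
  assumes "h \<in> borel_measurable Mz" "AE ob in Q. \<bar>h (zo ob)\<bar> \<le> B"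
  shows "(\<integral>ob. (dO ob - m (zo ob)) * h (zo ob) \<partial>Q) = 0"
  by (rule orth_from_cond_exp[OF Q obs_meas(3) space_Q v_int v_bd v_ce[unfolded sigma_z_def] assms])

text \<open>The flag is true for the treated arm. In the untreated arm propensity and link are both
  reflected, so the propensity error only changes sign and one coefficient vector serves both
  arms.\<close>

definition ind :: "bool \<Rightarrow> 'z obs \<Rightarrow> real" where "ind a = (if a then dO else (\<lambda>ob. 1 - dO ob))"
definition pscore :: "bool \<Rightarrow> 'z \<Rightarrow> real" where "pscore a = (if a then m else (\<lambda>z. 1 - m z))"
definition reg :: "bool \<Rightarrow> 'z \<Rightarrow> real" where "reg a = (if a then g 1 else g 0)"
definition lnk :: "bool \<Rightarrow> real \<Rightarrow> real" where "lnk a = (if a then Lam else (\<lambda>u. 1 - Lam u))"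
definition blk :: "bool \<Rightarrow> (nat \<Rightarrow> real) \<Rightarrow> nat \<Rightarrow> real" where "blk a b = (if a then b else (\<lambda>j. b (p n + j)))"

lemmas arm_defs = ind_def pscore_def reg_def lnk_def blk_def

lemma ind_meas: "ind a \<in> borel_measurable Q" and pscore_meas: "pscore a \<in> borel_measurable Mz"
  and reg_meas: "reg a \<in> borel_measurable Mz" and lnk_meas: "lnk a \<in> borel_measurable borel"
  using obs_meas(2) m_meas garm_meas Lam_meas by (auto simp: arm_defs)

lemma orth_pscore:
  assumes "h \<in> borel_measurable Mz" "AE ob in Q. \<bar>h (zo ob)\<bar> \<le> B"
  shows "(\<integral>ob. (ind a ob - pscore a (zo ob)) * h (zo ob) \<partial>Q) = 0"
proof (cases a)
  case True then show ?thesis using orth_z[OF assms] by (simp add: arm_defs)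
next
  case False
  have "((1 - dO ob) - (1 - m (zo ob))) * h (zo ob) = - ((dO ob - m (zo ob)) * h (zo ob))" for ob
    by (simp add: algebra_simps)
  then show ?thesis using orth_z[OF assms] False by (simp add: arm_defs)
qed

lemma ind01: "AE ob in Q. ind a ob = 0 \<or> ind a ob = 1"
  using d01 by eventually_elim (auto simp: ind_def)

lemma pscore_bd: "AE ob in Q. c' \<le> pscore a (zo ob) \<and> pscore a (zo ob) \<le> 1"
  using m_bd by eventually_elim (use c'_pos in \<open>auto simp: pscore_def\<close>)

lemma orth_reg:
  assumes h: "h \<in> borel_measurable Mz" and hb: "AE ob in Q. \<bar>h (zo ob)\<bar> \<le> B"
  shows "(\<integral>ob. ind a ob * (yo ob - reg a (zo ob)) * h (zo ob) \<partial>Q) = 0"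
proof -
  note [measurable] = obs_meas h ind_meas reg_meas
  have "(\<integral>ob. ind a ob * (yo ob - reg a (zo ob)) * h (zo ob) \<partial>Q) = (\<integral>ob. \<zeta> ob * (ind a ob * h (zo ob)) \<partial>Q)"
  proof (rule integral_cong_AE)
    show "AE ob in Q. ind a ob * (yo ob - reg a (zo ob)) * h (zo ob) = \<zeta> ob * (ind a ob * h (zo ob))"
      using d01 by eventually_elim (auto simp: \<zeta>_def arm_defs)
    show "(\<lambda>ob. \<zeta> ob * (ind a ob * h (zo ob))) \<in> borel_measurable Q"
      using borel_measurable_integrable[OF \<zeta>_int] by measurable
  qed measurable
  also have "\<dots> = 0"
  proof -
    have "AE ob in Q. \<bar>(if a then dO ob else 1 - dO ob) * h (zo ob)\<bar> \<le> \<bar>B\<bar>"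
      using hb d01 by eventually_elim auto
    then show ?thesis using orth_dz[of "\<lambda>(d, z). (if a then d else 1 - d) * h z" "\<bar>B\<bar>"]
      by (cases a) (simp_all add: ind_def)
  qed
  finally show ?thesis .
qed

lemma AE_arm:
  assumes "{z \<in> space Mz. \<not> P z} \<in> sets Mz" "AE ob in Q. ind a ob = 1 \<longrightarrow> P (zo ob)"
  shows "AE ob in Q. P (zo ob)"
  by (rule overlap_AE[OF Q obs_meas(3) ind_meas pscore_meas ind01 pscore_bd orth_pscore c'_pos assms])

lemma integral_le_arm:
  assumes h: "h \<in> borel_measurable Mz" and h0: "\<And>z. 0 \<le> h z" and hb: "AE ob in Q. \<bar>h (zo ob)\<bar> \<le> B"
    and f: "integrable Q f" and hf: "AE ob in Q. ind a ob * h (zo ob) \<le> f ob" and fa: "(\<integral>ob. f ob \<partial>Q) \<le> v"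
  shows "(\<integral>ob. h (zo ob) \<partial>Q) \<le> v / c'"
proof -
  note [measurable] = obs_meas h ind_meas
  have eb: "AE ob in Q. 0 \<le> ind a ob \<and> ind a ob \<le> 1" using ind01[of a] by eventually_elim auto
  have "c' * (\<integral>ob. h (zo ob) \<partial>Q) \<le> (\<integral>ob. ind a ob * h (zo ob) \<partial>Q)"
    by (rule overlap_integral_le[OF Q obs_meas(3) ind_meas pscore_meas eb pscore_bd orth_pscore h _ hb c'_pos])
       (use h0 in auto)
  also have "\<dots> \<le> (\<integral>ob. f ob \<partial>Q)"
  proof (rule integral_mono_AE[OF _ f hf])
    show "integrable Q (\<lambda>ob. ind a ob * h (zo ob))"
    proof (rule AE_bounded_integrable[OF Q])
      show "AE ob in Q. \<bar>ind a ob * h (zo ob)\<bar> \<le> \<bar>B\<bar>" using ind01[of a] hb by eventually_elim auto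
    qed measurable
  qed
  finally show ?thesis using fa c'_pos by (simp add: pos_le_divide_eq mult.commute)
qed

lemma reg_bd: "AE ob in Q. \<bar>reg a (zo ob)\<bar> \<le> C"
proof (rule AE_arm[where a=a])
  show "{z \<in> space Mz. \<not> \<bar>reg a z\<bar> \<le> C} \<in> sets Mz" using reg_meas[of a] by measurable
  show "AE ob in Q. ind a ob = 1 \<longrightarrow> \<bar>reg a (zo ob)\<bar> \<le> C" using g_bd by eventually_elim (auto simp: arm_defs)
qed

lemmas g1_bd = reg_bd[of True, unfolded reg_def if_True]
lemmas g0_bd = reg_bd[of False, unfolded reg_def if_False]

lemma rarm_bd: "AE ob in Q. \<bar>reg a (zo ob) - xb (zo ob) (blk a (bg0 D))\<bar> \<le> \<delta> n"
proof (rule AE_arm[where a=a])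
  show "{z \<in> space Mz. \<not> \<bar>reg a z - xb z (blk a (bg0 D))\<bar> \<le> \<delta> n} \<in> sets Mz"
    using reg_meas[of a] dotp_meas[of "blk a (bg0 D)"] by measurable
  show "AE ob in Q. ind a ob = 1 \<longrightarrow> \<bar>reg a (zo ob) - xb (zo ob) (blk a (bg0 D))\<bar> \<le> \<delta> n"
    using rg_bd by eventually_elim (auto simp: rg_def xtdot_def arm_defs)
qed

definition \<rho>0 :: real where "\<rho>0 = (\<delta> n * real n powr (-1/4))\<^sup>2"
text \<open>The 4 is the square of the factor 2 lost between empirical and population norm, and 1/c'
  is the price of passing from one arm to the population.\<close>

definition \<rho> :: real where "\<rho> = 4 * \<rho>0 / c'"

text \<open>The rate n^(-1/4) is what makes the summed squared errors \<delta>^2 sqrt n, hence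
  negligible on the sqrt n scale.\<close>

lemma \<rho>0_eq: "n > 0 \<Longrightarrow> real n * \<rho>0 = (\<delta> n)\<^sup>2 * sqrt (real n)"
proof -
  assume n: "n > 0"
  have "(real n powr (-1/4))\<^sup>2 = real n powr (-1/2)"
    by (simp add: power2_eq_square powr_add[symmetric])
  also have "\<dots> = inverse (sqrt (real n))" using n by (simp add: powr_minus powr_half_sqrt[symmetric])
  finally have "real n * \<rho>0 = (\<delta> n)\<^sup>2 * (real n * inverse (sqrt (real n)))"
    by (simp add: \<rho>0_def power_mult_distrib)
  also have "real n * inverse (sqrt (real n)) = sqrt (real n)"
    using n by (simp add: field_simps)
  finally show ?thesis .
qed

lemma \<rho>0_nonneg: "\<rho>0 \<ge> 0" by (simp add: \<rho>0_def)

lemma \<rho>0_le: "\<rho>0 / c' \<le> \<rho>" "\<rho>0 \<le> \<rho>"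
proof -
  show 1: "\<rho>0 / c' \<le> \<rho>" unfolding \<rho>_def using \<rho>0_nonneg c'_pos by (intro divide_right_mono) auto
  have "\<rho>0 * c' \<le> \<rho>0 * 1" using \<rho>0_nonneg c'_less by (intro mult_left_mono) auto
  then have "\<rho>0 \<le> \<rho>0 / c'" using c'_pos by (simp add: pos_le_divide_eq)
  then show "\<rho>0 \<le> \<rho>" using 1 by linarith
qed

lemma rg_meas: "rg \<in> borel_measurable Q"
proof -
  note [measurable] = obs_meas gobs_meas dotp_meas
  show ?thesis unfolding rg_def[abs_def] xtdot_def by measurable
qed

lemma rg_int: "integrable Q (\<lambda>ob. (rg ob)\<^sup>2)"
  by (rule AE_bounded_square_integrable[OF Q rg_meas rg_bd])

lemma rarm_int: "(\<integral>ob. (reg a (zo ob) - xb (zo ob) (blk a (bg0 D)))\<^sup>2 \<partial>Q) \<le> \<rho>"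
proof -
  have "(\<integral>ob. (reg a (zo ob) - xb (zo ob) (blk a (bg0 D)))\<^sup>2 \<partial>Q) \<le> \<rho>0 / c'"
  proof (rule integral_le_arm[where h="\<lambda>z. (reg a z - xb z (blk a (bg0 D)))\<^sup>2" and a=a, OF _ _ AE_square_le[OF rarm_bd] rg_int])
    show "AE ob in Q. ind a ob * (reg a (zo ob) - xb (zo ob) (blk a (bg0 D)))\<^sup>2 \<le> (rg ob)\<^sup>2"
      using d01 by eventually_elim (auto simp: rg_def xtdot_def arm_defs)
    show "(\<integral>ob. (rg ob)\<^sup>2 \<partial>Q) \<le> \<rho>0" unfolding \<rho>0_def by (rule integral_square_le_L2norm[OF rg_L2])
  qed (use reg_meas dotp_meas in auto)
  then show ?thesis using \<rho>0_le by linarith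
qed

lemma rm_arm: "\<bar>pscore a (zo ob) - lnk a (xb (zo ob) (bm0 D))\<bar> = \<bar>rm ob\<bar>"
  by (simp add: arm_defs rm_def abs_minus_commute)

lemma rm_int: "(\<integral>ob. (pscore a (zo ob) - lnk a (xb (zo ob) (bm0 D)))\<^sup>2 \<partial>Q) \<le> \<rho>"
proof -
  have "(pscore a (zo ob) - lnk a (xb (zo ob) (bm0 D)))\<^sup>2 = (rm ob)\<^sup>2" for ob
    using rm_arm[of a ob] by (metis power2_abs)
  then show ?thesis using integral_square_le_L2norm[OF rm_L2] \<rho>0_le unfolding \<rho>0_def by simp
qed

lemma arm_locale:
  assumes "4 * \<delta> n \<le> c'"
  shows "arm Q Mz (ind a) (reg a) (pscore a) (lnk a) (Pd n) (p n) (K n) (blk a (bg0 D)) (bm0 D) (\<delta> n) c' C"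
proof (rule arm.intro)
  show "AE ob in Q. \<bar>pscore a (zo ob) - lnk a (xb (zo ob) (bm0 D))\<bar> \<le> \<delta> n"
    using rm_bd unfolding rm_arm .
  show "\<bar>lnk a u - lnk a v\<bar> \<le> \<bar>u - v\<bar>" for u v
    using Lam_lip[of u v] by (simp add: lnk_def abs_minus_commute)
  show "c' \<le> 1" using c'_less by simp
qed (assumption | rule Q obs_meas ind_meas reg_meas pscore_meas lnk_meas Pd_meas ind01 y_bd reg_bd pscore_bd x_bd
    rarm_bd orth_reg orth_pscore \<delta>_pos assms c'_pos C_pos)+

end

section \<open>Approximation of the estimator and of its variance at a fixed sample size\<close>

lemma l1norm_nonneg: "l1norm q b \<ge> 0"
  by (simp add: l1norm_def sum_nonneg)

lemma l1norm_pad: "l1norm (2 * q) (\<lambda>j. if j < q then b j else 0) = l1norm q b"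
  unfolding l1norm_def by (rule sum.mono_neutral_cong_right) auto

lemma dotp_pad: "dotp q x (\<lambda>j. if j < q then b j else 0) = dotp q x b"
  by (simp add: dotp_def)

text \<open>The factor is of either sign since \<open>K n\<close> is an arbitrary real; a negative
  one makes the left side at most 0.\<close>

lemma mult_le_of_le:
  fixes k a b d :: real
  assumes "0 \<le> a" "a \<le> b" "k * b \<le> d" "0 \<le> d"
  shows "k * a \<le> d"
proof (cases "k \<ge> 0")
  case True
  then show ?thesis using assms mult_left_mono[of a b k] by linarith
next
  case False
  then show ?thesis using assms mult_nonpos_nonneg[of k a] by linarith
qed

lemma sum_squares_le_Pn2:
  assumes n: "n > 0" and "Pn2 n f \<le> a"
  shows "(\<Sum>i<n. (f i)\<^sup>2) \<le> real n * a\<^sup>2"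
proof -
  have nn: "En n (\<lambda>i. (f i)\<^sup>2) \<ge> 0" by (simp add: En_def sum_nonneg)
  have "(Pn2 n f)\<^sup>2 \<le> a\<^sup>2" using assms(2) nn by (intro power_mono) (auto simp: Pn2_def)
  then have "(\<Sum>i<n. (f i)\<^sup>2) / real n \<le> a\<^sup>2" using nn by (simp add: Pn2_def En_def)
  then show ?thesis using n by (simp add: pos_divide_le_eq mult.commute)
qed

text \<open>|alpha0| and |g1 - g0| contribute 2C each, and the two weighted residuals 2C/c'
  each.\<close>

definition score_bound :: "real \<Rightarrow> real \<Rightarrow> real" where
  "score_bound C c' = 4 * C + 4 * C / c'"

context hte
begin

definition \<phi>0 :: "'z obs \<Rightarrow> real" where
  "\<phi>0 ob = phi (alpha0 D) (yo ob) (dO ob) (g 0 (zo ob)) (g 1 (zo ob)) (m (zo ob))"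

definition \<phi>h :: "(nat \<Rightarrow> 'z obs) \<Rightarrow> 'z obs \<Rightarrow> real" where
  "\<phi>h w ob = phi (alpha0 D) (yo ob) (dO ob) (ghat p Pd bghat n w 0 (zo ob)) (ghat p Pd bghat n w 1 (zo ob))
     (mhat p Pd Lam bmhat n w (zo ob))"

lemma sigma2_eq: "sigma2 D = (\<integral>ob. (\<phi>0 ob)\<^sup>2 \<partial>Q)"
  by (simp add: sigma2_def \<phi>0_def)

lemma sigmahat2_eq: "sigmahat2 p Pd Lam bghat bmhat D n w = (\<Sum>i<n. (\<phi>h w (w i))\<^sup>2) / real n"
  by (simp add: sigmahat2_def \<phi>h_def En_def)

text \<open>The score is affine in its first argument with slope one, so the root hidden in the
  definite description is explicit and unique.\<close>

lemma alpha_check_eq: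
  assumes n: "n > 0"
  shows "alpha_check p Pd Lam bghat bmhat n w = alpha0 D - (\<Sum>i<n. \<phi>h w (w i)) / real n"
proof -
  have "phi a (yo (w i)) (dO (w i)) (ghat p Pd bghat n w 0 (zo (w i))) (ghat p Pd bghat n w 1 (zo (w i)))
       (mhat p Pd Lam bmhat n w (zo (w i))) = (a - alpha0 D) + \<phi>h w (w i)" for a i
    by (simp add: \<phi>h_def phi_def)
  then have En: "En n (\<lambda>i. phi a (yo (w i)) (dO (w i)) (ghat p Pd bghat n w 0 (zo (w i))) (ghat p Pd bghat n w 1 (zo (w i)))
       (mhat p Pd Lam bmhat n w (zo (w i)))) = (a - alpha0 D) + (\<Sum>i<n. \<phi>h w (w i)) / real n" for a
    using n by (simp add: En_def sum.distrib add_divide_distrib)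
  show ?thesis unfolding alpha_check_def En by (rule the_equality) auto
qed

abbreviation "B\<phi> \<equiv> score_bound C c'"

lemma alpha0_bd: "\<bar>alpha0 D\<bar> \<le> 2 * C"
proof -
  interpret prob_space Q by (rule Q)
  note [measurable] = obs_meas garm_meas
  have b: "AE ob in Q. \<bar>g 1 (zo ob) - g 0 (zo ob)\<bar> \<le> 2 * C" using g1_bd g0_bd by eventually_elim linarith
  have i: "integrable Q (\<lambda>ob. g 1 (zo ob) - g 0 (zo ob))"
    by (rule AE_bounded_integrable[OF Q _ b]) measurable
  have "\<bar>alpha0 D\<bar> \<le> (\<integral>ob. \<bar>g 1 (zo ob) - g 0 (zo ob)\<bar> \<partial>Q)"
    unfolding alpha0_def by (rule integral_abs_bound)
  also have "\<dots> \<le> (\<integral>ob. 2 * C \<partial>Q)"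
    by (rule integral_mono_AE) (use i b in auto)
  finally show ?thesis by (simp add: prob_space)
qed

lemma \<phi>0_meas: "\<phi>0 \<in> borel_measurable Q"
proof -
  note [measurable] = obs_meas garm_meas m_meas
  show ?thesis unfolding \<phi>0_def[abs_def] phi_def by measurable
qed

lemma \<phi>0_bd: "AE ob in Q. \<bar>\<phi>0 ob\<bar> \<le> B\<phi>"
  using d01 y_bd g1_bd g0_bd m_bd
proof eventually_elim
  case (elim ob)
  have q: "\<bar>(yo ob - a) / b\<bar> \<le> 2 * C / c'" if "\<bar>a\<bar> \<le> C" "c' \<le> b" for a b
  proof -
    have "\<bar>(yo ob - a) / b\<bar> = \<bar>yo ob - a\<bar> / b" using that c'_pos by simp
    also have "\<dots> \<le> 2 * C / c'" using that elim c'_pos by (intro frac_le) auto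
    finally show ?thesis .
  qed
  have q1: "\<bar>dO ob * (yo ob - g 1 (zo ob)) / m (zo ob)\<bar> \<le> 2 * C / c'"
    using elim(1) q[of "g 1 (zo ob)" "m (zo ob)"] elim c'_pos C_pos by auto
  have q0: "\<bar>(1 - dO ob) * (yo ob - g 0 (zo ob)) / (1 - m (zo ob))\<bar> \<le> 2 * C / c'"
    using elim(1) q[of "g 0 (zo ob)" "1 - m (zo ob)"] elim c'_pos C_pos by auto
  have "\<bar>a - u + v - (b - b')\<bar> \<le> 4 * C + (r + r)"
    if "\<bar>a\<bar> \<le> 2 * C" "\<bar>b\<bar> \<le> C" "\<bar>b'\<bar> \<le> C" "\<bar>u\<bar> \<le> r" "\<bar>v\<bar> \<le> r" for a b b' u v r :: real
    using that by linarith
  from this[OF alpha0_bd elim(3,4) q1 q0] show ?case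
    unfolding \<phi>0_def phi_def score_bound_def by simp
qed

lemma B\<phi>_pos: "B\<phi> > 0" unfolding score_bound_def using C_pos c'_pos by (simp add: add_pos_pos)

text \<open>The first summand depends on z alone, the second is noise times a function of (d, z).
  Centring of the score and the lower bound on its variance both rest on this split.\<close>

lemma \<phi>0_decomp:
  "AE ob in Q. \<phi>0 ob = (alpha0 D - (g 1 (zo ob) - g 0 (zo ob)))
     + \<zeta> ob * ((1 - dO ob) / (1 - m (zo ob)) - dO ob / m (zo ob))"
  using d01 by eventually_elim (auto simp: \<phi>0_def phi_def \<zeta>_def)

lemma weight_bd: "AE ob in Q. 1 \<le> \<bar>(1 - dO ob) / (1 - m (zo ob)) - dO ob / m (zo ob)\<bar> \<and>
    \<bar>(1 - dO ob) / (1 - m (zo ob)) - dO ob / m (zo ob)\<bar> \<le> 1 / c'"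
  using d01 m_bd
proof eventually_elim
  case (elim ob)
  have "1 \<le> 1 / u \<and> 1 / u \<le> 1 / c'" if "c' \<le> u" "u \<le> 1" for u
    using that c'_pos by (auto intro!: divide_left_mono)
  from this[of "m (zo ob)"] this[of "1 - m (zo ob)"] show ?case using elim c'_pos by auto
qed

lemma weight_meas: "(\<lambda>(d, z). (1 - d) / (1 - m z) - d / m z) \<in> borel_measurable (borel \<Otimes>\<^sub>M Mz)"
  using m_meas by measurable

lemma \<zeta>_meas: "\<zeta> \<in> borel_measurable Q" using \<zeta>_int by simp

lemma \<phi>0_mean: "(\<integral>ob. \<phi>0 ob \<partial>Q) = 0"
proof -
  interpret prob_space Q by (rule Q)
  note [measurable] = obs_meas garm_meas m_meas \<phi>0_meas \<zeta>_meas
  let ?W = "\<lambda>ob. (1 - dO ob) / (1 - m (zo ob)) - dO ob / m (zo ob)"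
  have "AE ob in Q. \<bar>g 1 (zo ob) - g 0 (zo ob)\<bar> \<le> 2 * C" using g1_bd g0_bd by eventually_elim linarith
  then have i1: "integrable Q (\<lambda>ob. g 1 (zo ob) - g 0 (zo ob))"
    by (rule AE_bounded_integrable[OF Q, rotated]) measurable
  have i2: "integrable Q (\<lambda>ob. \<zeta> ob * ?W ob)"
  proof (rule AE_bounded_integrable[OF Q])
    show "AE ob in Q. \<bar>\<zeta> ob * ?W ob\<bar> \<le> (2 * C) * (1 / c')" using \<zeta>_bd weight_bd
      by eventually_elim (unfold abs_mult, intro mult_mono, use C_pos in auto)
  qed measurable
  have "(\<integral>ob. \<phi>0 ob \<partial>Q) = (\<integral>ob. (alpha0 D - (g 1 (zo ob) - g 0 (zo ob))) + \<zeta> ob * ?W ob \<partial>Q)"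
    by (rule integral_cong_AE[OF _ _ \<phi>0_decomp]) measurable
  also have "\<dots> = (\<integral>ob. alpha0 D - (g 1 (zo ob) - g 0 (zo ob)) \<partial>Q) + (\<integral>ob. \<zeta> ob * ?W ob \<partial>Q)"
    by (rule Bochner_Integration.integral_add) (use i1 i2 in auto)
  also have "(\<integral>ob. \<zeta> ob * ?W ob \<partial>Q) = 0"
    using orth_dz[OF weight_meas, of "1 / c'"] weight_bd by simp
  also have "(\<integral>ob. alpha0 D - (g 1 (zo ob) - g 0 (zo ob)) \<partial>Q) = alpha0 D - (\<integral>ob. g 1 (zo ob) - g 0 (zo ob) \<partial>Q)"
    by (subst Bochner_Integration.integral_diff) (use i1 in \<open>auto simp: prob_space\<close>)
  finally show ?thesis by (simp add: alpha0_def)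
qed

lemma \<phi>0_sq_int: "integrable Q (\<lambda>ob. (\<phi>0 ob)\<^sup>2)"
  by (rule AE_bounded_square_integrable[OF Q \<phi>0_meas \<phi>0_bd])

text \<open>The weight on the noise has modulus at least 1 and the cross term has mean zero, so the
  variance is at least E[zeta^2]. The fourth-moment condition and |zeta| <= 2C give c^2 <= E[zeta^4]
  <= 4 C^2 E[zeta^2].\<close>

lemma sigma2_lower: "sigma2 D \<ge> c\<^sup>2 / (4 * C\<^sup>2)"
proof -
  interpret prob_space Q by (rule Q)
  note [measurable] = obs_meas garm_meas m_meas \<phi>0_meas \<zeta>_meas
  let ?W = "\<lambda>ob. (1 - dO ob) / (1 - m (zo ob)) - dO ob / m (zo ob)"
  let ?A = "\<lambda>ob. alpha0 D - (g 1 (zo ob) - g 0 (zo ob))"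
  have z2: "AE ob in Q. (\<zeta> ob)\<^sup>2 \<le> (2 * C)\<^sup>2" using AE_square_le[OF \<zeta>_bd] by simp
  have iz: "integrable Q (\<lambda>ob. (\<zeta> ob)\<^sup>2)" by (rule AE_bounded_square_integrable[OF Q \<zeta>_meas \<zeta>_bd])
  have "c\<^sup>2 \<le> (\<integral>ob. ((\<zeta> ob)\<^sup>2)\<^sup>2 \<partial>Q)"
  proof -
    have "c\<^sup>2 \<le> (L2norm Q (\<lambda>ob. (\<zeta> ob)\<^sup>2))\<^sup>2" using \<zeta>_lower c_pos by (intro power_mono) auto
    then show ?thesis by (simp add: L2norm_def)
  qed
  also have "\<dots> \<le> (\<integral>ob. (2 * C)\<^sup>2 * (\<zeta> ob)\<^sup>2 \<partial>Q)"
  proof (rule integral_mono_AE)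
    show "AE ob in Q. ((\<zeta> ob)\<^sup>2)\<^sup>2 \<le> (2 * C)\<^sup>2 * (\<zeta> ob)\<^sup>2" using z2
    proof eventually_elim
      case (elim ob)
      show ?case unfolding power2_eq_square[of "(\<zeta> ob)\<^sup>2"] by (rule mult_right_mono[OF elim]) simp
    qed
    show "integrable Q (\<lambda>ob. ((\<zeta> ob)\<^sup>2)\<^sup>2)"
      by (rule AE_bounded_square_integrable[OF Q _ AE_square_le[OF \<zeta>_bd]]) measurable
  qed (use iz in auto)
  also have "\<dots> = (4 * C\<^sup>2) * (\<integral>ob. (\<zeta> ob)\<^sup>2 \<partial>Q)" by (simp add: power_mult_distrib)
  finally have 1: "c\<^sup>2 / (4 * C\<^sup>2) \<le> (\<integral>ob. (\<zeta> ob)\<^sup>2 \<partial>Q)"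
    using C_pos by (simp add: pos_divide_le_eq mult.commute)
  have Ab: "AE ob in Q. \<bar>?A ob\<bar> \<le> 4 * C" using g1_bd g0_bd
    by eventually_elim (use alpha0_bd in linarith)
  have AWb: "AE ob in Q. \<bar>?A ob * ?W ob\<bar> \<le> (4 * C) * (1 / c')" using Ab weight_bd
    by eventually_elim (unfold abs_mult, intro mult_mono, use C_pos in auto)
  have cross: "(\<integral>ob. \<zeta> ob * (?A ob * ?W ob) \<partial>Q) = 0"
  proof -
    have "(\<lambda>(d, z). (alpha0 D - (g 1 z - g 0 z)) * ((1 - d) / (1 - m z) - d / m z)) \<in> borel_measurable (borel \<Otimes>\<^sub>M Mz)"
      by measurable
    from orth_dz[OF this, of "(4 * C) * (1 / c')"] AWb show ?thesis by simp
  qed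
  have ic: "integrable Q (\<lambda>ob. \<zeta> ob * (?A ob * ?W ob))"
  proof (rule AE_bounded_integrable[OF Q])
    show "AE ob in Q. \<bar>\<zeta> ob * (?A ob * ?W ob)\<bar> \<le> (2 * C) * ((4 * C) * (1 / c'))" using \<zeta>_bd AWb
      by eventually_elim (unfold abs_mult[of "\<zeta> _"], intro mult_mono, use C_pos in auto)
  qed measurable
  have "(\<integral>ob. (\<zeta> ob)\<^sup>2 \<partial>Q) = (\<integral>ob. (\<zeta> ob)\<^sup>2 + 2 * (\<zeta> ob * (?A ob * ?W ob)) \<partial>Q)"
    using iz ic cross by simp
  also have "\<dots> \<le> (\<integral>ob. (\<phi>0 ob)\<^sup>2 \<partial>Q)"
  proof (rule integral_mono_AE)
    show "AE ob in Q. (\<zeta> ob)\<^sup>2 + 2 * (\<zeta> ob * (?A ob * ?W ob)) \<le> (\<phi>0 ob)\<^sup>2"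
      using \<phi>0_decomp weight_bd
    proof eventually_elim
      case (elim ob)
      have "1 \<le> (?W ob)\<^sup>2" using elim(2) abs_le_square_iff[of 1 "?W ob"] by simp
      then have "(\<zeta> ob)\<^sup>2 * 1 \<le> (\<zeta> ob)\<^sup>2 * (?W ob)\<^sup>2" by (rule mult_left_mono) simp
      moreover have "(\<phi>0 ob)\<^sup>2 = (?A ob)\<^sup>2 + 2 * (\<zeta> ob * (?A ob * ?W ob)) + (\<zeta> ob)\<^sup>2 * (?W ob)\<^sup>2"
        unfolding elim(1) power2_sum power_mult_distrib by (simp only: ac_simps)
      ultimately show ?case using zero_le_power2[of "?A ob"] by linarith
    qed
  qed (use iz ic \<phi>0_sq_int in auto)
  finally show ?thesis using 1 by (simp add: sigma2_eq)
qed

lemma ghat_eq: "ghat p Pd bghat n w (if a then 1 else 0) z =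
    xb z (blk a (bg0 D)) + xb z (blk a (\<lambda>j. bghat n w j - bg0 D j))"
  by (simp add: ghat_def xtdot_def blk_def dotp_diff)

lemma mhat_eq: "mhat p Pd Lam bmhat n w z = Lam (xb z (bm0 D) + xb z (\<lambda>j. bmhat n w j - bm0 D j))"
  by (simp add: mhat_def dotp_diff)

lemma block_l1norm:
  assumes "K n * l1norm (2 * p n) b \<le> \<delta> n"
  shows "K n * l1norm (p n) (blk a b) \<le> \<delta> n"
proof (rule mult_le_of_le[OF l1norm_nonneg _ assms])
  show "l1norm (p n) (blk a b) \<le> l1norm (2 * p n) b" using l1norm_blocks_le[of "p n" b] by (simp add: blk_def)
qed (use \<delta>_pos in simp)

lemma ind_xb_le:
  "d = 0 \<or> d = 1 \<Longrightarrow> ((if a then d else 1 - d) * xb z (blk a b))\<^sup>2 \<le> (xtdot (p n) (x z) d b)\<^sup>2"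
  by (auto simp: xtdot_def blk_def)

text \<open>The stacked regressor dominates either block on its own arm; overlap then removes the
  arm indicator. The l1 constraint supplies the boundedness needed for integrability.\<close>

lemma block_second_moment:
  assumes l1: "K n * l1norm (2 * p n) b \<le> \<delta> n"
    and L2: "L2norm Q (\<lambda>ob. xtdot (p n) (x (zo ob)) (dO ob) b) \<le> 2 * (\<delta> n * real n powr (-1/4))"
  shows "(\<integral>ob. (xb (zo ob) (blk a b))\<^sup>2 \<partial>Q) \<le> \<rho>"
proof -
  note [measurable] = obs_meas dotp_meas
  have d: "AE ob in Q. \<bar>xb (zo ob) (blk a b)\<bar> \<le> \<delta> n" for a using x_bd
  proof eventually_elim
    case (elim ob)
    show ?case using abs_dotp_le_l1norm[OF elim, of "blk a b"] block_l1norm[OF l1, of a] by linarith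
  qed
  have int: "integrable Q (\<lambda>ob. (xtdot (p n) (x (zo ob)) (dO ob) b)\<^sup>2)"
  proof (rule AE_bounded_square_integrable[OF Q])
    show "AE ob in Q. \<bar>xtdot (p n) (x (zo ob)) (dO ob) b\<bar> \<le> \<delta> n" using d[of True] d[of False] d01
      by eventually_elim (auto simp: xtdot_def blk_def)
    show "(\<lambda>ob. xtdot (p n) (x (zo ob)) (dO ob) b) \<in> borel_measurable Q" unfolding xtdot_def by measurable
  qed
  have le: "(\<integral>ob. (xtdot (p n) (x (zo ob)) (dO ob) b)\<^sup>2 \<partial>Q) \<le> 4 * \<rho>0"
    using integral_square_le_L2norm[OF L2] by (simp add: \<rho>0_def power_mult_distrib)
  show ?thesis
    unfolding \<rho>_def
  proof (rule integral_le_arm[where h="\<lambda>z. (xb z (blk a b))\<^sup>2" and a=a, OF _ _ AE_square_le[OF d] int _ le])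
    show "AE ob in Q. ind a ob * (xb (zo ob) (blk a b))\<^sup>2 \<le> (xtdot (p n) (x (zo ob)) (dO ob) b)\<^sup>2"
      using d01 by eventually_elim (auto simp: xtdot_def arm_defs)
  qed auto
qed

lemma sets_S: "sets S = sets (PiM {..<n} (\<lambda>_. obsM Mz))"
  unfolding sampleM_def by (rule sets_PiM_cong) (use sets_Q in auto)

lemma dotp_sample_meas:
  assumes i: "i < n" and b: "\<And>j. (\<lambda>w. b w j) \<in> borel_measurable S"
  shows "(\<lambda>w. xb (zo (w i)) (b w)) \<in> borel_measurable S"
  unfolding dotp_def
  by (intro borel_measurable_sum borel_measurable_times b
      measurable_sampleM_component[OF i, of "\<lambda>ob. x (zo ob) _"] measurable_compose[OF obs_meas(3) Pd_meas])

lemma \<phi>h_meas: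
  assumes i: "i < n"
  shows "(\<lambda>w. \<phi>h w (w i)) \<in> borel_measurable S"
proof -
  have [measurable]: "(\<lambda>w. bghat n w j) \<in> borel_measurable S" "(\<lambda>w. bmhat n w j) \<in> borel_measurable S" for j
    using bghat_meas bmhat_meas by (simp_all add: measurable_cong_sets[OF sets_S refl])
  have [measurable]: "(\<lambda>w. xb (zo (w i)) (bghat n w)) \<in> borel_measurable S"
    "(\<lambda>w. xb (zo (w i)) (\<lambda>j. bghat n w (p n + j))) \<in> borel_measurable S"
    "(\<lambda>w. xb (zo (w i)) (bmhat n w)) \<in> borel_measurable S"
    by (rule dotp_sample_meas[OF i], measurable)+
  have [measurable]: "(\<lambda>w. yo (w i)) \<in> borel_measurable S" "(\<lambda>w. dO (w i)) \<in> borel_measurable S"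
    using obs_meas by (auto intro: measurable_sampleM_component[OF i])
  note [measurable] = Lam_meas
  show ?thesis unfolding \<phi>h_def phi_def ghat_def mhat_def xtdot_def by measurable
qed

lemma alpha_check_meas:
  assumes n: "n > 0"
  shows "alpha_check p Pd Lam bghat bmhat n \<in> borel_measurable S"
proof -
  have "alpha_check p Pd Lam bghat bmhat n = (\<lambda>w. alpha0 D - (\<Sum>i<n. \<phi>h w (w i)) / real n)"
    using alpha_check_eq[OF n] by blast
  then show ?thesis using \<phi>h_meas
    by (auto intro!: borel_measurable_diff borel_measurable_divide borel_measurable_sum)
qed

lemma sigmahat2_meas: "sigmahat2 p Pd Lam bghat bmhat D n \<in> borel_measurable S"
  unfolding sigmahat2_eq[abs_def] using \<phi>h_meas
  by (auto intro!: borel_measurable_divide borel_measurable_sum borel_measurable_power)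

text \<open>The estimate and its target have at most C s nonzero entries each, so their difference
  has at most this many.\<close>

abbreviation "k0 \<equiv> nat \<lfloor>2 * C * s n\<rfloor>"
abbreviation "L0 \<equiv> arm_const c' C"

definition NE :: "real \<Rightarrow> real" where
  "NE t = (real (p n + 1) * (2 * (real n)\<^sup>2 + 1)) ^ k0 *
     exp (- t / (L0 * \<delta> n) + real n * (2 * \<rho> + 2 * (\<delta> n / real n)\<^sup>2) / (\<delta> n)\<^sup>2)"

text \<open>On the intersection of the event where the estimators are good with the controlled
  samples of both arms, the uniform bounds are evaluated at the realised estimation errors. Each arm
  costs 10 \<open>NE t\<close> in probability and one copy of the deviation bound.\<close>

lemma score_approx:
  assumes n: "n > 0" and \<delta>1: "4 * \<delta> n \<le> c'" and \<delta>2: "\<delta> n \<le> 1/2" and k: "k0 \<le> n" and t: "t \<ge> 0"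
  shows "whp S (\<Delta> n + 20 * NE t) (\<lambda>w.
     \<bar>\<Sum>i<n. \<phi>h w (w i) - \<phi>0 (w i)\<bar>
       \<le> 2 * (4 * t + 2 * L0 * \<delta> n + 8 / c'\<^sup>2 * ((\<delta> n)\<^sup>2 * sqrt (real n) + real n * \<rho> + t * \<delta> n / L0)) \<and>
     (\<forall>i<n. \<bar>\<phi>h w (w i) - \<phi>0 (w i)\<bar> \<le> 16 * L0 * \<delta> n \<and> \<bar>\<phi>0 (w i)\<bar> \<le> B\<phi>))" (is "whp S _ ?P")
proof -
  interpret S: prob_space S by (rule prob_space_sampleM[OF Q])
  interpret A: arm Q Mz "ind a" "reg a" "pscore a" "lnk a" "Pd n" "p n" "K n" "blk a (bg0 D)" "bm0 D" "\<delta> n" c' C for a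
    by (rule arm_locale[OF \<delta>1])
  have \<rho>: "\<rho> \<ge> 0" using \<rho>0_nonneg \<rho>0_le by linarith
  define a where "a = \<delta> n * real n powr (-1/4)"
  have a2: "real n * a\<^sup>2 = (\<delta> n)\<^sup>2 * sqrt (real n)" using \<rho>0_eq[OF n] by (simp add: \<rho>0_def a_def)
  obtain A where A: "A \<in> sets S" "measure S A \<ge> 1 - \<Delta> n" and est: "\<And>w. w \<in> A \<Longrightarrow> good_sample w"
    using estimators by blast
  obtain B1 where B1: "B1 \<in> sets S" "measure S B1 \<le> 10 * NE t"
    and B1w: "\<And>w. w \<in> space S - B1 \<Longrightarrow> A.controlled True n k0 \<rho> t w"
    using A.score_deviation[OF n k t \<rho> rarm_int rm_int, of True] unfolding NE_def by blast
  obtain B0 where B0: "B0 \<in> sets S" "measure S B0 \<le> 10 * NE t"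
    and B0w: "\<And>w. w \<in> space S - B0 \<Longrightarrow> A.controlled False n k0 \<rho> t w"
    using A.score_deviation[OF n k t \<rho> rarm_int rm_int, of False] unfolding NE_def by blast
  define U where "U = (space S - A) \<union> (B1 \<union> B0)"
  have U: "U \<in> sets S" using A B1 B0 by (auto simp: U_def)
  have "measure S U \<le> measure S (space S - A) + (measure S B1 + measure S B0)"
    unfolding U_def using A(1) B1(1) B0(1)
    by (intro order_trans[OF measure_Un_le] add_left_mono sets.Un order_refl) auto
  also have "\<dots> \<le> \<Delta> n + 20 * NE t" using S.prob_compl[OF A(1)] A(2) B1(2) B0(2) by simp
  finally have mU: "measure S U \<le> \<Delta> n + 20 * NE t" .
  obtain B where B: "B \<in> sets S" "measure S B \<le> \<Delta> n + 20 * NE t"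
     "\<And>w. w \<in> space S - B \<Longrightarrow> (\<forall>i<n. \<bar>\<phi>0 (w i)\<bar> \<le> B\<phi>) \<and> w \<notin> U"
    using measure_le_AE_event[OF S.prob_space_axioms U AE_sampleM[OF Q \<phi>0_bd] mU] by blast
  have main: "?P w" if w: "w \<in> space S - B" for w
  proof -
    have \<phi>b: "\<And>i. i < n \<Longrightarrow> \<bar>\<phi>0 (w i)\<bar> \<le> B\<phi>" and wU: "w \<notin> U" using B(3)[OF w] by auto
    have wA: "w \<in> A" and w1: "w \<in> space S - B1" and w0: "w \<in> space S - B0" using w wU by (auto simp: U_def)
    have ctl: "A.controlled a n k0 \<rho> t w" for a using B1w[OF w1] B0w[OF w0] by (cases a) auto
    have ok: "A.ok a (w i)" if "i < n" for a i using ctl that by (simp add: A.controlled_def)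
    have dw: "dO (w i) = 0 \<or> dO (w i) = 1" if "i < n" for i using ok[OF that, of True] unfolding A.ok_def by (simp add: ind_def)
    let ?X = "\<lambda>i. xtdot (p n) (x (zo (w i))) (dO (w i))" and ?Xo = "\<lambda>ob. xtdot (p n) (x (zo ob)) (dO ob)"
    let ?b = "\<lambda>j. bghat n w j - bg0 D j"
    let ?bm = "\<lambda>j. bmhat n w j - bm0 D j"
    \<comment> \<open>The propensity error seen as a vector for the stacked regressor, with empty
      untreated block.\<close>
    let ?bp = "\<lambda>j. if j < p n then ?bm j else 0"
    note e = est[OF wA, unfolded good_sample_def, folded a_def]
    have lb: "real (l0norm (2 * p n) ?b) \<le> 2 * C * s n"
      using l0norm_diff_le[of "2 * p n" "bghat n w" "bg0 D"] e bg0_sparse by linarith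
    have lm: "real (l0norm (p n) ?bm) \<le> 2 * C * s n"
      using l0norm_diff_le[of "p n" "bmhat n w" "bm0 D"] e bm0_sparse by linarith
    have kb: "l0norm (2 * p n) ?b \<le> k0" using lb by (rule le_nat_floor)
    have k1: "l0norm (p n) (blk a ?b) \<le> k0" for a
      using l0norm_blocks_le[of "p n" ?b] kb by (simp add: blk_def)
    have km: "l0norm (p n) ?bm \<le> k0" using lm by (rule le_nat_floor)
    have l1b: "K n * l1norm (2 * p n) ?b \<le> \<delta> n" and l1m: "K n * l1norm (p n) ?bm \<le> \<delta> n" using e by auto
    have l11: "K n * l1norm (p n) (blk a ?b) \<le> \<delta> n" for a by (rule block_l1norm[OF l1b])
    have a0: "a \<ge> 0" using \<delta>_pos by (simp add: a_def)
    \<comment> \<open>With \<open>\<delta> n \<le> 1/2\<close> the ratio of empirical to population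
      norm is at least 1/2. The comparison excludes a vanishing population norm, where the claim is
      trivial.\<close>
    have L2le: "L2norm Q (\<lambda>ob. ?Xo ob b) \<le> 2 * a"
      if l0: "real (l0norm (2 * p n) b) \<le> 2 * C * s n"
        and P: "Pn2 n (\<lambda>i. ?X i b) \<le> a" for b
    proof (cases "L2norm Q (\<lambda>ob. ?Xo ob b) > 0")
      case False then show ?thesis using a0 by linarith
    next
      case True
      let ?P = "Pn2 n (\<lambda>i. ?X i b)"
      let ?L = "L2norm Q (\<lambda>ob. ?Xo ob b)"
      have "\<bar>?P / ?L - 1\<bar> \<le> \<delta> n" using e l0 True by blast
      then have "1/2 \<le> ?P / ?L" using \<delta>2 by linarith
      then have "1/2 * ?L \<le> ?P" using True by (simp only: pos_le_divide_eq)
      then show ?thesis using P by linarith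
    qed
    have P1: "Pn2 n (\<lambda>i. ?X i ?b) \<le> a" using e by blast
    have Pm: "Pn2 n (\<lambda>i. xb (zo (w i)) ?bm) \<le> a" using e by blast
    \<comment> \<open>The padded index is d x'b, dominated by x'b at each observation; the part lost
      here is recovered in population by overlap.\<close>
    have Pp: "Pn2 n (\<lambda>i. ?X i ?bp) \<le> a"
    proof -
      have "En n (\<lambda>i. (?X i ?bp)\<^sup>2) \<le> En n (\<lambda>i. (xb (zo (w i)) ?bm)\<^sup>2)"
        unfolding En_def
      proof (intro divide_right_mono sum_mono)
        fix i assume "i \<in> {..<n}"
        then show "(?X i ?bp)\<^sup>2 \<le> (xb (zo (w i)) ?bm)\<^sup>2"
          using dw[of i] unfolding xtdot_pad by auto
      qed simp
      then show ?thesis using Pm unfolding Pn2_def by (smt (verit) real_sqrt_le_mono)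
    qed
    have v1: "(\<integral>ob. (xb (zo ob) (blk a ?b))\<^sup>2 \<partial>Q) \<le> \<rho>" for a
      by (rule block_second_moment[OF l1b L2le[OF lb P1, unfolded a_def]])
    have vm: "(\<integral>ob. (xb (zo ob) ?bm)\<^sup>2 \<partial>Q) \<le> \<rho>"
    proof -
      have "K n * l1norm (2 * p n) ?bp \<le> \<delta> n" unfolding l1norm_pad by (rule l1m)
      moreover have "real (l0norm (2 * p n) ?bp) \<le> 2 * C * s n" unfolding l0norm_pad by (rule lm)
      ultimately show ?thesis
        using block_second_moment[of ?bp True] L2le[OF _ Pp] unfolding a_def blk_def if_True dotp_pad by blast
    qed
    have qx: "(\<Sum>i<n. (?X i ?b)\<^sup>2) \<le> (\<delta> n)\<^sup>2 * sqrt (real n)"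
      using sum_squares_le_Pn2[OF n P1] a2 by simp
    have q1: "(\<Sum>i<n. (ind a (w i) * xb (zo (w i)) (blk a ?b))\<^sup>2) \<le> (\<delta> n)\<^sup>2 * sqrt (real n)" for a
    proof (rule order_trans[OF sum_mono qx])
      fix i assume "i \<in> {..<n}"
      then show "(ind a (w i) * xb (zo (w i)) (blk a ?b))\<^sup>2 \<le> (?X i ?b)\<^sup>2"
        using ind_xb_le[OF dw, of i a "zo (w i)" ?b] by (cases a) (auto simp: ind_def)
    qed
    have qm: "(\<Sum>i<n. (xb (zo (w i)) ?bm)\<^sup>2) \<le> (\<delta> n)\<^sup>2 * sqrt (real n)"
      using sum_squares_le_Pn2[OF n Pm] a2 by simp
    define T where "T a = A.score_err a (blk a ?b) ?bm" for a
    \<comment> \<open>The common \<open>alpha0 D\<close> cancels and the two arms remain with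
      opposite signs.\<close>
    have diff: "\<phi>h w ob - \<phi>0 ob = T False ob - T True ob" for ob
      unfolding \<phi>h_def \<phi>0_def phi_eq_arm_score T_def A.score_err_def mhat_eq
        ghat_eq[of w True, simplified] ghat_eq[of w False, simplified] by (simp add: arm_defs)
    let ?R = "4 * t + 2 * L0 * \<delta> n + 8 / c'\<^sup>2 * ((\<delta> n)\<^sup>2 * sqrt (real n) + real n * \<rho> + t * \<delta> n / L0)"
    have s1: "\<bar>\<Sum>i<n. T a (w i)\<bar> \<le> ?R" for a
      unfolding T_def
      using ctl[unfolded A.controlled_def, THEN conjunct2, rule_format, OF k1 km l11 l1m v1 vm q1 qm] .
    have "\<bar>\<Sum>i<n. \<phi>h w (w i) - \<phi>0 (w i)\<bar> = \<bar>(\<Sum>i<n. T False (w i)) - (\<Sum>i<n. T True (w i))\<bar>"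
      unfolding diff sum_subtractf ..
    also have "\<dots> \<le> ?R + ?R" by (rule order_trans[OF abs_triangle_ineq4 add_mono[OF s1 s1]])
    finally have S: "\<bar>\<Sum>i<n. \<phi>h w (w i) - \<phi>0 (w i)\<bar> \<le> 2 * ?R" by (simp only: mult_2)
    have "\<bar>\<phi>h w (w i) - \<phi>0 (w i)\<bar> \<le> 16 * L0 * \<delta> n" if "i < n" for i
    proof -
      have "\<bar>T a (w i)\<bar> \<le> 8 * L0 * \<delta> n" for a
        unfolding T_def A.score_err_def by (rule A.ok_score_diff(2)[OF ok[OF that] l11 l1m])
      from this[of True] this[of False] show ?thesis unfolding diff by linarith
    qed
    then show ?thesis using S \<phi>b by blast
  qed
  show ?thesis unfolding whp_def using B(1,2) main by blast
qed

text \<open>Consistency of the empirical variance of the true score, with an exponential rate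
  depending only on the bound of the score and on \<epsilon>, hence uniform over the class.\<close>

lemma square_average_tail:
  assumes \<epsilon>: "0 < \<epsilon>" "\<epsilon> \<le> 2 * B\<phi>\<^sup>2"
  shows "measure S {w \<in> space S. \<bar>\<Sum>i<n. (\<phi>0 (w i))\<^sup>2 - sigma2 D\<bar> \<ge> real n * \<epsilon>}
    \<le> 2 * exp (- real n * \<epsilon>\<^sup>2 / (4 * (B\<phi>\<^sup>2)\<^sup>2))"
proof -
  interpret prob_space Q by (rule Q)
  note [measurable] = \<phi>0_meas
  let ?f = "\<lambda>ob. (\<phi>0 ob)\<^sup>2 - sigma2 D"
  define M where "M = B\<phi>\<^sup>2"
  have M: "M > 0" using B\<phi>_pos by (simp add: M_def)
  have pM: "AE ob in Q. 0 \<le> (\<phi>0 ob)\<^sup>2 \<and> (\<phi>0 ob)\<^sup>2 \<le> M" using AE_square_le[OF \<phi>0_bd] by (simp add: M_def)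
  have s0: "0 \<le> sigma2 D" unfolding sigma2_eq by simp
  have s1: "sigma2 D \<le> M"
    unfolding sigma2_eq using integral_mono_AE[OF \<phi>0_sq_int integrable_const, of M] pM
    by (simp add: prob_space)
  have fM: "AE ob in Q. \<bar>?f ob\<bar> \<le> M" using pM by eventually_elim (use s0 s1 in linarith)
  \<comment> \<open>The tail bound is applied with 2 M^2/\<epsilon> in the role of the sup bound:
    its reciprocal minimises -\<epsilon> \<lambda> + M^2 \<lambda>^2 over \<lambda>. The upper limit
    on \<epsilon> makes it large enough to dominate the summand.\<close>
  have le: "M \<le> 2 * M\<^sup>2 / \<epsilon>"
    using \<epsilon>(1) \<epsilon>(2)[folded M_def] M by (simp add: pos_le_divide_eq power2_eq_square)
  have "measure S {w \<in> space S. \<bar>\<Sum>i<n. ?f (w i)\<bar> \<ge> real n * \<epsilon>}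
    \<le> 2 * exp (- (real n * \<epsilon>) / (2 * M\<^sup>2 / \<epsilon>) + real n * M\<^sup>2 / (2 * M\<^sup>2 / \<epsilon>)\<^sup>2)"
  proof (rule sample_sum_tail[OF Q])
    show "AE ob in Q. \<bar>?f ob\<bar> \<le> 2 * M\<^sup>2 / \<epsilon>" using fM by eventually_elim (use le in linarith)
    show "(\<integral>ob. ?f ob \<partial>Q) = 0" using \<phi>0_sq_int by (simp add: prob_space sigma2_eq)
    have f2: "AE ob in Q. (?f ob)\<^sup>2 \<le> M\<^sup>2" using fM
    proof eventually_elim
      case (elim ob)
      show ?case using power_mono[OF elim, of 2] by simp
    qed
    have "integrable Q (\<lambda>ob. (?f ob)\<^sup>2)"
      by (rule AE_bounded_integrable[OF Q, where B="M\<^sup>2"]) (use f2 in auto)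
    then show "(\<integral>ob. (?f ob)\<^sup>2 \<partial>Q) \<le> M\<^sup>2"
      using integral_mono_AE[OF _ integrable_const f2] by (simp add: prob_space)
  qed (use \<epsilon> M in auto)
  also have "- (real n * \<epsilon>) / (2 * M\<^sup>2 / \<epsilon>) + real n * M\<^sup>2 / (2 * M\<^sup>2 / \<epsilon>)\<^sup>2 = - real n * \<epsilon>\<^sup>2 / (4 * M\<^sup>2)"
    using M \<epsilon> by (simp add: field_simps power2_eq_square)
  finally show ?thesis by (simp only: M_def)
qed

lemma L0_pos: "L0 > 0"
  unfolding arm_const_def using C_pos c'_pos by simp

text \<open>In units of sqrt n, the logarithm of the grid size costs 10 C and the variance 8/c' + 2.
  The remaining unit in the hypothesis on \<epsilon> leaves exp(-sqrt n).\<close>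

lemma NE_le:
  assumes n3: "n \<ge> 3" and \<delta>1: "\<delta> n \<le> 1" and s1: "s n \<ge> 1"
    and \<epsilon>: "10 * C + 8 / c' + 3 \<le> \<epsilon> / (L0 * \<delta> n)"
  shows "NE (\<epsilon> * sqrt (real n)) \<le> exp (- sqrt (real n))" and "s n \<le> sqrt (real n)"
proof -
  define P where "P = real (max (p n) n)"
  let ?r = "sqrt (real n)"
  have P3: "P \<ge> 3" using n3 by (simp add: P_def)
  \<comment> \<open>\<open>n \<ge> 3\<close> puts the maximum of p and n above e, so s itself, and
    not only s times the logarithm, is at most sqrt n.\<close>
  have lnP: "ln P \<ge> 1" using exp_le P3 by (simp add: ln_ge_iff)
  have r1: "?r \<ge> 1" using n3 by simp
  have n0: "n > 0" using n3 by simp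
  have "(s n * ln P)\<^sup>2 \<le> \<delta> n * real n"
    using growth n0 by (simp add: P_def pos_divide_le_eq)
  also have "\<dots> \<le> 1 * real n" using \<delta>1 by (intro mult_right_mono) auto
  finally have "(s n * ln P)\<^sup>2 \<le> real n" by simp
  then have slnP: "s n * ln P \<le> ?r" by (rule real_le_rsqrt)
  have "s n * 1 \<le> s n * ln P" using s1 lnP by (intro mult_left_mono) auto
  then show "s n \<le> ?r" using slnP by linarith
  define b where "b = real (p n + 1) * (2 * (real n)\<^sup>2 + 1)"
  have b1: "b \<ge> 1"
  proof -
    have "1 * 1 \<le> b" unfolding b_def by (rule mult_mono) auto
    then show ?thesis by simp
  qed
  \<comment> \<open>The factors are at most 2P and 3P^2, and 6 <= P^2 absorbs the constant; hence
    the factor 5 in front of the logarithm.\<close>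
  have "b \<le> P ^ 5"
  proof -
    have a1: "real (p n + 1) \<le> 2 * P" using P3 by (simp add: P_def)
    have nP: "real n \<le> P" by (simp add: P_def)
    have "(real n)\<^sup>2 \<le> P\<^sup>2" using nP by (intro power_mono) auto
    moreover have "1 \<le> P\<^sup>2" using P3 by (simp add: one_le_power)
    ultimately have a2: "2 * (real n)\<^sup>2 + 1 \<le> 3 * P\<^sup>2" by linarith
    have "b \<le> (2 * P) * (3 * P\<^sup>2)" unfolding b_def using a1 a2 P3 by (intro mult_mono) auto
    also have "\<dots> = 6 * P ^ 3" by (simp add: power2_eq_square power3_eq_cube)
    also have "\<dots> \<le> P\<^sup>2 * P ^ 3"
    proof (rule mult_right_mono)
      have "3\<^sup>2 \<le> P\<^sup>2" using P3 by (intro power_mono) auto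
      then show "6 \<le> P\<^sup>2" by simp
    qed (use P3 in simp)
    finally show ?thesis by (simp add: power_add[symmetric])
  qed
  then have "ln b \<le> ln (P ^ 5)" using b1 P3 by simp
  also have "\<dots> = 5 * ln P" using P3 by (simp add: ln_realpow)
  finally have lnb: "ln b \<le> 5 * ln P" .
  have lnb0: "ln b \<ge> 0" using b1 by simp
  have kk: "real k0 \<le> 2 * C * s n" using C_pos s1 by (intro of_nat_floor) auto
  have "real k0 * ln b \<le> (2 * C * s n) * (5 * ln P)" using kk lnb lnb0 C_pos s1 by (intro mult_mono) auto
  also have "\<dots> = 10 * C * (s n * ln P)" by simp
  also have "\<dots> \<le> 10 * C * ?r" using slnP C_pos by (intro mult_left_mono) auto
  finally have kb: "real k0 * ln b \<le> 10 * C * ?r" .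
  have "b ^ k0 = exp (real k0 * ln b)" using b1 by (simp add: exp_of_nat_mult)
  then have pow: "b ^ k0 \<le> exp (10 * C * ?r)" using kb by simp
  have var: "real n * (2 * \<rho> + 2 * (\<delta> n / real n)\<^sup>2) / (\<delta> n)\<^sup>2 \<le> (8 / c' + 2) * ?r"
  proof -
    have "real n * (2 * \<rho> + 2 * (\<delta> n / real n)\<^sup>2) / (\<delta> n)\<^sup>2
       = 8 / c' * (real n * \<rho>0) / (\<delta> n)\<^sup>2 + 2 / real n"
      using \<delta>_pos n0 c'_pos by (simp add: \<rho>_def field_simps power2_eq_square)
    also have "8 / c' * (real n * \<rho>0) / (\<delta> n)\<^sup>2 = 8 / c' * ?r"
      using \<delta>_pos by (simp add: \<rho>0_eq[OF n0])
    also have "2 / real n \<le> 2 * ?r"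
    proof -
      have "2 / real n \<le> 2" using n0 by (simp add: pos_divide_le_eq)
      then show ?thesis using r1 by linarith
    qed
    finally show ?thesis by (simp add: algebra_simps)
  qed
  have eps: "(10 * C + 8 / c' + 3) * ?r \<le> \<epsilon> * ?r / (L0 * \<delta> n)"
    using mult_right_mono[OF \<epsilon>, of ?r] by simp
  have "NE (\<epsilon> * ?r) \<le> exp (10 * C * ?r) * exp (- (\<epsilon> * ?r) / (L0 * \<delta> n) + (8 / c' + 2) * ?r)"
    unfolding NE_def b_def[symmetric] using pow var by (intro mult_mono) auto
  also have "\<dots> = exp (10 * C * ?r - \<epsilon> * ?r / (L0 * \<delta> n) + (8 / c' + 2) * ?r)"
    by (simp add: exp_add[symmetric])
  also have "\<dots> \<le> exp (- ?r)"
    using eps by (simp add: algebra_simps)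
  finally show "NE (\<epsilon> * ?r) \<le> exp (- ?r)" .
qed

text \<open>The deviation level is \<epsilon>1 sqrt n. After division by sqrt n it contributes 8
  \<epsilon>1, and everything else carries a factor \<delta>. Neither the bound nor the exceptional
  probability depends on the process.\<close>

lemma finite_sample_approx:
  assumes n3: "n \<ge> 3" and \<delta>1: "4 * \<delta> n \<le> c'" and s1: "s n \<ge> 1" and \<epsilon>1: "0 < \<epsilon>1" "\<epsilon>1 \<le> 1"
    and C2: "2 * C \<le> sqrt (real n)"
    and \<epsilon>: "10 * C + 8 / c' + 3 \<le> \<epsilon>1 / (L0 * \<delta> n)" and \<epsilon>2: "0 < \<epsilon>2" "\<epsilon>2 \<le> 2 * B\<phi>\<^sup>2"
  shows "whp S (\<Delta> n + 20 * exp (- sqrt (real n)) + 2 * exp (- real n * \<epsilon>2\<^sup>2 / (4 * (B\<phi>\<^sup>2)\<^sup>2))) (\<lambda>w.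
      \<bar>sqrt (real n) * (alpha_check p Pd Lam bghat bmhat n w - alpha0 D) + (\<Sum>i<n. \<phi>0 (w i)) / sqrt (real n)\<bar>
         \<le> 8 * \<epsilon>1 + (4 * L0 + 16 / c'\<^sup>2 * (1 + 4 / c' + 1 / L0)) * \<delta> n \<and>
      \<bar>sigmahat2 p Pd Lam bghat bmhat D n w - sigma2 D\<bar> \<le> 16 * L0 * (16 * L0 + 2 * B\<phi>) * \<delta> n + \<epsilon>2)"
    (is "whp S ?q (\<lambda>w. ?A w \<and> ?V w)")
proof -
  interpret S: prob_space S by (rule prob_space_sampleM[OF Q])
  let ?r = "sqrt (real n)"
  let ?R = "2 * (4 * (\<epsilon>1 * ?r) + 2 * L0 * \<delta> n + 8 / c'\<^sup>2 * ((\<delta> n)\<^sup>2 * ?r + real n * \<rho> + (\<epsilon>1 * ?r) * \<delta> n / L0))"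
  have n0: "n > 0" using n3 by simp
  have r1: "?r \<ge> 1" using n3 by simp
  have \<delta>h: "\<delta> n \<le> 1/2" "\<delta> n \<le> 1" using \<delta>1 c'_less by auto
  note NE = NE_le[OF n3 \<delta>h(2) s1 \<epsilon>]
  \<comment> \<open>The grid mesh was chosen for at most n nonzero entries: 2 C s is at most sqrt n
    times sqrt n.\<close>
  have k: "k0 \<le> n"
  proof -
    have "real k0 \<le> 2 * C * s n" using C_pos s1 by (intro of_nat_floor) auto
    also have "\<dots> \<le> ?r * ?r" using C2 NE(2) s1 by (intro mult_mono) auto
    finally show ?thesis by simp
  qed
  have t0: "0 \<le> \<epsilon>1 * ?r" using \<epsilon>1 r1 by simp
  obtain B1 where B1: "B1 \<in> sets S" "measure S B1 \<le> \<Delta> n + 20 * NE (\<epsilon>1 * ?r)" and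
    B1w: "\<And>w. w \<in> space S - B1 \<Longrightarrow>
     \<bar>\<Sum>i<n. \<phi>h w (w i) - \<phi>0 (w i)\<bar>
       \<le> ?R \<and>
     (\<forall>i<n. \<bar>\<phi>h w (w i) - \<phi>0 (w i)\<bar> \<le> 16 * L0 * \<delta> n \<and> \<bar>\<phi>0 (w i)\<bar> \<le> B\<phi>)"
    using whpE[OF score_approx[OF n0 \<delta>1 \<delta>h(1) k t0]] by blast
  define B2 where "B2 = {w \<in> space S. \<bar>\<Sum>i<n. (\<phi>0 (w i))\<^sup>2 - sigma2 D\<bar> \<ge> real n * \<epsilon>2}"
  have B2: "B2 \<in> sets S"
  proof -
    have [measurable]: "(\<lambda>w. \<Sum>i<n. (\<phi>0 (w i))\<^sup>2 - sigma2 D) \<in> borel_measurable S"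
      by (rule measurable_sample_sum[of "\<lambda>ob. (\<phi>0 ob)\<^sup>2 - sigma2 D"]) (use \<phi>0_meas in simp)
    show ?thesis unfolding B2_def by measurable
  qed
  have "measure S (B1 \<union> B2) \<le> measure S B1 + measure S B2" by (rule measure_Un_le[OF B1(1) B2])
  also have "\<dots> \<le> ?q"
    using B1(2) NE(1) square_average_tail[OF \<epsilon>2] unfolding B2_def by linarith
  finally have mB: "measure S (B1 \<union> B2) \<le> ?q" .
  have main: "?A w \<and> ?V w" if w: "w \<in> space S - (B1 \<union> B2)" for w
  proof
    let ?h = "\<lambda>i. \<phi>h w (w i)" and ?f = "\<lambda>i. \<phi>0 (w i)"
    let ?e = "?r * (alpha_check p Pd Lam bghat bmhat n w - alpha0 D) + (\<Sum>i<n. ?f i) / ?r"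
    have w1: "w \<in> space S - B1" using w by auto
    have sum: "\<bar>\<Sum>i<n. ?h i - ?f i\<bar>
       \<le> ?R"
      and pw: "\<And>i. i < n \<Longrightarrow> \<bar>?h i - ?f i\<bar> \<le> 16 * L0 * \<delta> n \<and> \<bar>?f i\<bar> \<le> B\<phi>"
      using B1w[OF w1] by auto
    have "?e = - (\<Sum>i<n. ?h i - ?f i) / ?r"
    proof -
      have "?r * (- (\<Sum>i<n. ?h i) / real n) = - (\<Sum>i<n. ?h i) / ?r"
        using n0 real_sqrt_mult_self[of "real n"] by (simp add: field_simps)
      then show ?thesis by (simp add: alpha_check_eq[OF n0] sum_subtractf diff_divide_distrib)
    qed
    then have "\<bar>?e\<bar> = \<bar>\<Sum>i<n. ?h i - ?f i\<bar> / ?r" by simp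
    also have "\<dots> \<le> ?R / ?r"
      by (rule divide_right_mono[OF sum]) simp
    also have "\<dots> = 8 * \<epsilon>1 + 4 * L0 * (\<delta> n / ?r) + 16 / c'\<^sup>2 * ((\<delta> n)\<^sup>2 + 4 / c' * (\<delta> n)\<^sup>2 + \<epsilon>1 * \<delta> n / L0)"
    proof -
      have "real n * \<rho> = 4 / c' * (\<delta> n)\<^sup>2 * ?r" using \<rho>0_eq[OF n0] by (simp add: \<rho>_def)
      moreover have "2 * (4 * (\<epsilon>1 * r) + 2 * L0 * \<delta> n + 8 / c'\<^sup>2 * ((\<delta> n)\<^sup>2 * r + 4 / c' * (\<delta> n)\<^sup>2 * r + (\<epsilon>1 * r) * \<delta> n / L0)) / r
         = 8 * \<epsilon>1 + 4 * L0 * (\<delta> n / r) + 16 / c'\<^sup>2 * ((\<delta> n)\<^sup>2 + 4 / c' * (\<delta> n)\<^sup>2 + \<epsilon>1 * \<delta> n / L0)"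
        if "r > 0" for r using that by (simp add: add_divide_distrib distrib_left distrib_right)
      ultimately show ?thesis using r1 by simp
    qed
    also have "\<dots> \<le> 8 * \<epsilon>1 + 4 * L0 * \<delta> n + 16 / c'\<^sup>2 * (\<delta> n + 4 / c' * \<delta> n + \<delta> n / L0)"
    proof -
      have d2: "(\<delta> n)\<^sup>2 \<le> \<delta> n" using \<delta>h(2) \<delta>_pos by (simp add: power2_eq_square mult_left_le)
      have d1: "\<delta> n / ?r \<le> \<delta> n" using r1 \<delta>_pos by (simp add: pos_divide_le_eq mult_le_cancel_left1)
      have d3: "\<epsilon>1 * \<delta> n / L0 \<le> \<delta> n / L0" using \<epsilon>1 \<delta>_pos L0_pos by (intro divide_right_mono) (auto simp: mult_left_le_one_le)
      show ?thesis
        by (intro add_mono mult_left_mono d1 d2 d3 order_refl) (use L0_pos c'_pos in auto)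
    qed
    also have "\<dots> = 8 * \<epsilon>1 + (4 * L0 + 16 / c'\<^sup>2 * (1 + 4 / c' + 1 / L0)) * \<delta> n"
    proof -
      have "a + l * d + k * (d + u * d + d / v) = a + (l + k * (1 + u + 1 / v)) * d" for a l d k u v :: real
        by (simp add: algebra_simps)
      then show ?thesis .
    qed
    finally show "?A w" .
    let ?c = "16 * L0 * (16 * L0 + 2 * B\<phi>) * \<delta> n"
    have pt: "\<bar>(?h i)\<^sup>2 - (?f i)\<^sup>2\<bar> \<le> ?c" if "i < n" for i
    proof -
      have "(?h i)\<^sup>2 - (?f i)\<^sup>2 = (?h i - ?f i) * ((?h i - ?f i) + 2 * ?f i)"
        by (simp add: power2_eq_square algebra_simps)
      then have "\<bar>(?h i)\<^sup>2 - (?f i)\<^sup>2\<bar> = \<bar>?h i - ?f i\<bar> * \<bar>(?h i - ?f i) + 2 * ?f i\<bar>"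
        by (simp add: abs_mult)
      also have "\<dots> \<le> (16 * L0 * \<delta> n) * (16 * L0 + 2 * B\<phi>)"
      proof (rule mult_mono)
        show "\<bar>?h i - ?f i\<bar> \<le> 16 * L0 * \<delta> n" using pw[OF that] by simp
        have "16 * L0 * \<delta> n \<le> 16 * L0 * 1" using \<delta>h(2) L0_pos by (intro mult_left_mono) auto
        then show "\<bar>(?h i - ?f i) + 2 * ?f i\<bar> \<le> 16 * L0 + 2 * B\<phi>"
          using pw[OF that] by linarith
      qed (use L0_pos \<delta>_pos in auto)
      finally show ?thesis by (simp add: mult.commute mult.left_commute)
    qed
    have "\<bar>\<Sum>i<n. (?h i)\<^sup>2 - (?f i)\<^sup>2\<bar> \<le> (\<Sum>i<n. ?c)"
      by (rule order_trans[OF sum_abs sum_mono]) (use pt in auto)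
    then have e1: "\<bar>\<Sum>i<n. (?h i)\<^sup>2 - (?f i)\<^sup>2\<bar> \<le> real n * ?c" by simp
    have e2: "\<bar>\<Sum>i<n. (?f i)\<^sup>2 - sigma2 D\<bar> \<le> real n * \<epsilon>2"
      using w by (auto simp: B2_def)
    have "sigmahat2 p Pd Lam bghat bmhat D n w - sigma2 D
      = ((\<Sum>i<n. (?h i)\<^sup>2 - (?f i)\<^sup>2) + (\<Sum>i<n. (?f i)\<^sup>2 - sigma2 D)) / real n"
      using n0 by (simp add: sigmahat2_eq sum_subtractf diff_divide_distrib)
    then have "\<bar>sigmahat2 p Pd Lam bghat bmhat D n w - sigma2 D\<bar>
      = \<bar>(\<Sum>i<n. (?h i)\<^sup>2 - (?f i)\<^sup>2) + (\<Sum>i<n. (?f i)\<^sup>2 - sigma2 D)\<bar> / real n" by simp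
    also have "\<dots> \<le> (real n * ?c + real n * \<epsilon>2) / real n"
      by (rule divide_right_mono[OF order_trans[OF abs_triangle_ineq add_mono[OF e1 e2]]]) simp
    also have "\<dots> = ?c + \<epsilon>2" using n0 by (simp add: add_divide_distrib)
    finally show "?V w" .
  qed
  show ?thesis unfolding whp_def using B1(1) B2 mB main by (intro bexI[of _ "B1 \<union> B2"]) auto
qed

end

section \<open>Approximation uniformly over the class\<close>

locale hte_seq =
  fixes Mz :: "'z measure" and \<delta> \<Delta> K s :: "nat \<Rightarrow> real" and p :: "nat \<Rightarrow> nat"
    and C c c' :: real and Pd :: "nat \<Rightarrow> 'z \<Rightarrow> nat \<Rightarrow> real" and Lam :: "real \<Rightarrow> real"
    and bghat bmhat :: "nat \<Rightarrow> (nat \<Rightarrow> 'z obs) \<Rightarrow> nat \<Rightarrow> real"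
  assumes \<delta>_pos: "\<And>n. \<delta> n > 0" and \<delta>_lim: "\<delta> \<longlonglongrightarrow> 0" and \<Delta>_lim: "\<Delta> \<longlonglongrightarrow> 0"
    and s_ge1: "\<And>n. s n \<ge> 1"
    and C_pos: "C > 0" and c_pos: "c > 0" and c'_pos: "0 < c'" and c'_less: "c' < 1/2"
    and link: "Lam = (\<lambda>u. u) \<or> Lam = logistic"
    and Pd_meas: "\<And>n j. (\<lambda>z. Pd n z j) \<in> borel_measurable Mz"
    and bghat_meas: "\<And>n j. (\<lambda>w. bghat n w j) \<in> borel_measurable (PiM {..<n} (\<lambda>_. obsM Mz))"
    and bmhat_meas: "\<And>n j. (\<lambda>w. bmhat n w j) \<in> borel_measurable (PiM {..<n} (\<lambda>_. obsM Mz))"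
begin

abbreviation "Pset \<equiv> HTE_class Mz \<delta> \<Delta> K s p C c c' Pd Lam bghat bmhat"
abbreviation "acheck \<equiv> alpha_check p Pd Lam bghat bmhat"
abbreviation "shat2 \<equiv> sigmahat2 p Pd Lam bghat bmhat"

lemma hteI: "D \<in> Pset n \<Longrightarrow> hte Mz \<delta> \<Delta> K s p C c c' Pd Lam bghat bmhat n D"
  by (rule hte.intro) (assumption | rule \<delta>_pos C_pos c_pos c'_pos c'_less link Pd_meas bghat_meas bmhat_meas)+

text \<open>"Eventually" stands outside the quantifier over processes: the threshold is determined
  by the sequences, the constants and \<epsilon> alone. This order of quantifiers is the source of
  all uniformity.\<close>

lemma uniform_approx:
  assumes \<epsilon>: "\<epsilon> > 0"
  shows "\<forall>\<^sub>F n in sequentially. \<forall>D\<in>Pset n. whp (sampleM n (lawQ D)) \<epsilon> (\<lambda>w.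
      \<bar>sqrt (real n) * (acheck n w - alpha0 D) + (\<Sum>i<n. hte.\<phi>0 D (w i)) / sqrt (real n)\<bar> \<le> \<epsilon> \<and>
      \<bar>shat2 D n w - sigma2 D\<bar> \<le> \<epsilon>)"
proof -
  let ?L = "arm_const c' C" and ?B = "score_bound C c'"
  have L: "?L > 0" unfolding arm_const_def using C_pos c'_pos by simp
  have B: "?B > 0" unfolding score_bound_def using C_pos c'_pos by (simp add: add_pos_pos)
  \<comment> \<open>The bound 8 \<epsilon>1 and the bound \<epsilon>2 each use half of \<epsilon>;
    the caps 1 and 2 B^2 are the ranges in which the finite-sample bounds apply.\<close>
  define \<epsilon>1 where "\<epsilon>1 = min 1 (\<epsilon> / 16)"
  define \<epsilon>2 where "\<epsilon>2 = min (\<epsilon> / 2) (2 * ?B\<^sup>2)"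
  have e1: "0 < \<epsilon>1" "\<epsilon>1 \<le> 1" "\<epsilon>1 \<le> \<epsilon> / 16" using \<epsilon> by (auto simp: \<epsilon>1_def)
  have e2: "0 < \<epsilon>2" "\<epsilon>2 \<le> 2 * ?B\<^sup>2" "\<epsilon>2 \<le> \<epsilon> / 2" using \<epsilon> B by (auto simp: \<epsilon>2_def)
  let ?q = "\<epsilon>2\<^sup>2 / (4 * (?B\<^sup>2)\<^sup>2)"
  define M1 where "M1 = 4 * ?L + 16 / c'\<^sup>2 * (1 + 4 / c' + 1 / ?L)"
  define M2 where "M2 = 16 * ?L * (16 * ?L + 2 * ?B)"
  define M3 where "M3 = 10 * C + 8 / c' + 3"
  have M1: "M1 > 0" unfolding M1_def using L c'_pos by (intro add_pos_pos mult_pos_pos divide_pos_pos) auto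
  have M2: "M2 > 0" unfolding M2_def using L B by simp
  have M3: "M3 > 0" unfolding M3_def using C_pos c'_pos by (intro add_pos_pos) auto
  have small: "\<forall>\<^sub>F n in sequentially. \<delta> n < d" if "d > 0" for d
    using order_tendstoD(2)[OF \<delta>_lim that] .
  have s1: "\<forall>\<^sub>F n in sequentially. \<delta> n < c' / 4" by (rule small) (use c'_pos in simp)
  have s2: "\<forall>\<^sub>F n in sequentially. \<delta> n < \<epsilon> / (2 * M1)" by (rule small) (use \<epsilon> M1 in simp)
  have s3: "\<forall>\<^sub>F n in sequentially. \<delta> n < \<epsilon> / (2 * M2)" by (rule small) (use \<epsilon> M2 in simp)
  have s4: "\<forall>\<^sub>F n in sequentially. \<delta> n < \<epsilon>1 / (?L * M3)" by (rule small) (use e1 L M3 in simp)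
  \<comment> \<open>The failure probability is split into thirds: \<epsilon>/3, 20 * \<epsilon>/60
    and 2 * \<epsilon>/6.\<close>
  have s5: "\<forall>\<^sub>F n in sequentially. \<Delta> n < \<epsilon> / 3" by (rule order_tendstoD(2)[OF \<Delta>_lim]) (use \<epsilon> in simp)
  have sq: "filterlim (\<lambda>n. sqrt (real n)) at_top sequentially"
    by (rule filterlim_compose[OF sqrt_at_top filterlim_real_sequentially])
  have "((\<lambda>n. exp (- sqrt (real n))) \<longlongrightarrow> 0) sequentially"
    by (rule filterlim_compose[OF exp_at_bot]) (use sq in \<open>simp add: filterlim_uminus_at_bot\<close>)
  then have s6: "\<forall>\<^sub>F n in sequentially. exp (- sqrt (real n)) < \<epsilon> / 60"
    by (rule order_tendstoD) (use \<epsilon> in simp)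
  have "((\<lambda>n. exp (- (real n * ?q))) \<longlongrightarrow> 0) sequentially"
  proof (rule filterlim_compose[OF exp_at_bot])
    have "filterlim (\<lambda>n. real n * ?q) at_top sequentially"
      by (rule filterlim_at_top_mult_tendsto_pos[OF tendsto_const _ filterlim_real_sequentially]) (use e2 B in simp)
    then show "filterlim (\<lambda>n. - (real n * ?q)) at_bot sequentially"
      by (simp add: filterlim_uminus_at_bot)
  qed
  then have s7: "\<forall>\<^sub>F n in sequentially. exp (- (real n * ?q)) < \<epsilon> / 6"
    by (rule order_tendstoD) (use \<epsilon> in simp)
  have s8: "\<forall>\<^sub>F n in sequentially. sqrt (real n) \<ge> 2 * C" using sq by (simp add: filterlim_at_top)
  show ?thesis
    using s1 s2 s3 s4 s5 s6 s7 s8 eventually_ge_at_top[of 3]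
  proof eventually_elim
    case (elim n)
    show ?case
    proof
      fix D assume D: "D \<in> Pset n"
      interpret hte Mz \<delta> \<Delta> K s p C c c' Pd Lam bghat bmhat n D by (rule hteI[OF D])
      have "\<delta> n * (?L * M3) \<le> \<epsilon>1" using elim(4) L M3 by (simp add: pos_less_divide_eq)
      then have c3: "M3 \<le> \<epsilon>1 / (?L * \<delta> n)" using L \<delta>_pos
        by (simp add: pos_le_divide_eq mult.commute mult.left_commute)
      have c1: "4 * \<delta> n \<le> c'" using elim(1) by simp
      have "M1 * \<delta> n \<le> \<epsilon> / 2" using elim(2) M1 by (simp add: field_simps)
      then have b1: "8 * \<epsilon>1 + M1 * \<delta> n \<le> \<epsilon>" using e1(3) by linarith
      have "M2 * \<delta> n \<le> \<epsilon> / 2" using elim(3) M2 by (simp add: field_simps)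
      then have b2: "M2 * \<delta> n + \<epsilon>2 \<le> \<epsilon>" using e2(3) by linarith
      show "whp S \<epsilon> (\<lambda>w. \<bar>sqrt (real n) * (acheck n w - alpha0 D) + (\<Sum>i<n. \<phi>0 (w i)) / sqrt (real n)\<bar> \<le> \<epsilon> \<and>
          \<bar>shat2 D n w - sigma2 D\<bar> \<le> \<epsilon>)"
        using finite_sample_approx[OF elim(9) c1 s_ge1 e1(1,2) elim(8) c3[unfolded M3_def] e2(1,2)]
        unfolding M1_def[symmetric] M2_def[symmetric]
        by (rule whp_mono) (use elim(5,6,7) b1 b2 in auto)
    qed
  qed
qed

definition \<sigma>l :: real where "\<sigma>l = c / (2 * C)"

lemma \<sigma>l_pos: "\<sigma>l > 0" using c_pos C_pos by (simp add: \<sigma>l_def)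

lemma sigma_lower: "D \<in> Pset n \<Longrightarrow> \<sigma>l \<le> sqrt (sigma2 D)"
proof -
  assume D: "D \<in> Pset n"
  interpret hte Mz \<delta> \<Delta> K s p C c c' Pd Lam bghat bmhat n D by (rule hteI[OF D])
  have "\<sigma>l\<^sup>2 \<le> sigma2 D" using sigma2_lower by (simp add: \<sigma>l_def power_divide power_mult_distrib)
  then show ?thesis by (rule real_le_rsqrt)
qed

text \<open>The error of the variance estimate is moved from the ratio to the level: only the fixed
  x gets multiplied by sqrt v / sg. No control on the size of \<open>U\<close> is then
  required.\<close>

lemma studentized_le_iff:
  fixes U v sg x \<eta> l :: real
  assumes l: "0 < l" "l \<le> sg" and v: "\<bar>v - sg\<^sup>2\<bar> \<le> \<eta>" and \<eta>: "\<eta> < l\<^sup>2"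
  shows "v > 0" and "U / sqrt v \<le> x \<longleftrightarrow> U / sg \<le> x * (sqrt v / sg)"
    and "\<bar>x * (sqrt v / sg) - x\<bar> \<le> \<bar>x\<bar> * (\<eta> / l\<^sup>2)"
proof -
  have ls: "l\<^sup>2 \<le> sg\<^sup>2" using l by (intro power_mono) auto
  show v0: "v > 0" using v ls \<eta> by linarith
  have sg: "sg > 0" using l by linarith
  show "U / sqrt v \<le> x \<longleftrightarrow> U / sg \<le> x * (sqrt v / sg)"
    using v0 sg by (simp add: pos_divide_le_eq)
  define q where "q = sqrt v / sg"
  have q0: "q > 0" using v0 sg by (simp add: q_def)
  have "q\<^sup>2 = v / sg\<^sup>2" using v0 by (simp add: q_def power_divide)
  then have "q\<^sup>2 - 1 = (v - sg\<^sup>2) / sg\<^sup>2" using sg by (simp add: field_simps)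
  then have "\<bar>q\<^sup>2 - 1\<bar> = \<bar>v - sg\<^sup>2\<bar> / sg\<^sup>2" by simp
  also have "\<dots> \<le> \<eta> / l\<^sup>2" using v ls l by (intro frac_le) auto
  finally have qq: "\<bar>q\<^sup>2 - 1\<bar> \<le> \<eta> / l\<^sup>2" .
  have "q\<^sup>2 - 1 = (q - 1) * (q + 1)" by (simp add: power2_eq_square algebra_simps)
  then have "\<bar>q\<^sup>2 - 1\<bar> = \<bar>q - 1\<bar> * (q + 1)" using q0 by (simp add: abs_mult)
  \<comment> \<open>As q + 1 >= 1, the error of the ratio is at most that of its square.\<close>
  moreover have "\<bar>q - 1\<bar> \<le> \<bar>q - 1\<bar> * (q + 1)" using q0 mult_left_mono[of 1 "q + 1" "\<bar>q - 1\<bar>"] by simp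
  ultimately have "\<bar>q - 1\<bar> \<le> \<eta> / l\<^sup>2" using qq by (metis order_trans)
  then have "\<bar>x\<bar> * \<bar>q - 1\<bar> \<le> \<bar>x\<bar> * (\<eta> / l\<^sup>2)" by (intro mult_left_mono) auto
  moreover have "x * q - x = x * (q - 1)" by (simp add: algebra_simps)
  ultimately show "\<bar>x * (sqrt v / sg) - x\<bar> \<le> \<bar>x\<bar> * (\<eta> / l\<^sup>2)" by (simp add: q_def abs_mult)
qed

section \<open>Limits along an arbitrary index sequence tending to infinity\<close>

context
  fixes r :: "nat \<Rightarrow> nat" and D :: "nat \<Rightarrow> 'z dgp"
  assumes r: "filterlim r at_top sequentially" and Dk: "\<And>k. D k \<in> Pset (r k)"
begin

abbreviation "SM k \<equiv> sampleM (r k) (lawQ (D k))"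
abbreviation "dev k w \<equiv> sqrt (real (r k)) * (acheck (r k) w - alpha0 (D k))"
abbreviation "\<sigma> k \<equiv> sqrt (sigma2 (D k))"
abbreviation "vhat k w \<equiv> shat2 (D k) (r k) w"

lemma hte_k: "hte Mz \<delta> \<Delta> K s p C c c' Pd Lam bghat bmhat (r k) (D k)"
  by (rule hteI[OF Dk])

text \<open>The minus sign comes from solving for the root: the estimator minus its target is minus
  the average estimated score.\<close>

definition lead :: "nat \<Rightarrow> (nat \<Rightarrow> 'z obs) \<Rightarrow> real" where
  "lead k w = (\<Sum>i<r k. - hte.\<phi>0 (D k) (w i) / \<sigma> k) / sqrt (real (r k))"

lemma prob_k: "prob_space (SM k)"
  by (rule prob_space_sampleM[OF hte.Q[OF hte_k]])

lemma lead_meas: "lead k \<in> borel_measurable (SM k)"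
proof -
  interpret hte Mz \<delta> \<Delta> K s p C c c' Pd Lam bghat bmhat "r k" "D k" by (rule hte_k)
  have "(\<lambda>ob. - \<phi>0 ob / \<sigma> k) \<in> borel_measurable Q" using \<phi>0_meas by simp
  from measurable_sample_sum[OF this] show ?thesis
    unfolding lead_def[abs_def] by (rule borel_measurable_divide) simp
qed

text \<open>The uniform lower bound \<open>\<sigma>l\<close> keeps the normalised scores in one
  bounded range for all rows, although the law varies with k.\<close>

lemma lead_clt: "weak_conv_m (\<lambda>k. distr (SM k) borel (lead k)) std_normal_distribution"
  unfolding lead_def[abs_def]
proof (rule triangular_bounded_clt[where B="score_bound C c' / \<sigma>l"])
  fix k
  interpret hte Mz \<delta> \<Delta> K s p C c c' Pd Lam bghat bmhat "r k" "D k" by (rule hte_k)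
  have sl: "\<sigma>l \<le> \<sigma> k" by (rule sigma_lower[OF Dk])
  then have sp: "\<sigma> k > 0" using \<sigma>l_pos by linarith
  show "prob_space (lawQ (D k))" by (rule Q)
  show "(\<lambda>ob. - \<phi>0 ob / \<sigma> k) \<in> borel_measurable (lawQ (D k))" using \<phi>0_meas by simp
  show "AE ob in lawQ (D k). \<bar>- \<phi>0 ob / \<sigma> k\<bar> \<le> score_bound C c' / \<sigma>l"
    using \<phi>0_bd
  proof eventually_elim
    case (elim ob)
    have "\<bar>- \<phi>0 ob / \<sigma> k\<bar> = \<bar>\<phi>0 ob\<bar> / \<sigma> k" using sp by simp
    also have "\<dots> \<le> score_bound C c' / \<sigma>l" using elim sl \<sigma>l_pos by (intro frac_le) auto
    finally show ?case .
  qed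
  show "(\<integral>ob. - \<phi>0 ob / \<sigma> k \<partial>lawQ (D k)) = 0" using \<phi>0_mean by simp
  have "(\<integral>ob. (- \<phi>0 ob / \<sigma> k)\<^sup>2 \<partial>lawQ (D k)) = (\<integral>ob. (\<phi>0 ob)\<^sup>2 / sigma2 (D k) \<partial>lawQ (D k))"
    using sp by (simp add: power_divide)
  also have "\<dots> = 1" using sp by (simp add: sigma2_eq[symmetric])
  finally show "(\<integral>ob. (- \<phi>0 ob / \<sigma> k)\<^sup>2 \<partial>lawQ (D k)) = 1" .
qed (rule r)

lemma lead_approx:
  assumes \<epsilon>: "\<epsilon> > 0"
  shows "\<forall>\<^sub>F k in sequentially. whp (SM k) \<epsilon> (\<lambda>w. \<bar>dev k w / \<sigma> k - lead k w\<bar> \<le> \<epsilon> \<and>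
      \<bar>vhat k w - (\<sigma> k)\<^sup>2\<bar> \<le> \<epsilon>)"
proof -
  \<comment> \<open>Division by the standard deviation inflates the error by at most
    1/\<open>\<sigma>l\<close>.\<close>
  define \<epsilon>' where "\<epsilon>' = min \<epsilon> (\<epsilon> * \<sigma>l)"
  have \<epsilon>': "\<epsilon>' > 0" "\<epsilon>' \<le> \<epsilon>" "\<epsilon>' \<le> \<epsilon> * \<sigma>l" using \<epsilon> \<sigma>l_pos by (auto simp: \<epsilon>'_def)
  from eventually_compose_filterlim[OF uniform_approx[OF \<epsilon>'(1)] r] show ?thesis
  proof eventually_elim
    case (elim k)
    have sl: "\<sigma>l \<le> \<sigma> k" by (rule sigma_lower[OF Dk])
    then have sp: "\<sigma> k > 0" using \<sigma>l_pos by linarith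
    have s2: "(\<sigma> k)\<^sup>2 = sigma2 (D k)" using sp by simp
    show ?case
    proof (rule whp_mono[OF bspec[OF elim Dk] \<epsilon>'(2)])
      fix w
      let ?e = "dev k w + (\<Sum>i<r k. hte.\<phi>0 (D k) (w i)) / sqrt (real (r k))"
      assume e: "\<bar>?e\<bar> \<le> \<epsilon>' \<and> \<bar>vhat k w - sigma2 (D k)\<bar> \<le> \<epsilon>'"
      have "lead k w = - ((\<Sum>i<r k. hte.\<phi>0 (D k) (w i)) / sqrt (real (r k))) / \<sigma> k"
        unfolding lead_def by (simp add: sum_negf sum_divide_distrib[symmetric])
      then have "dev k w / \<sigma> k - lead k w = ?e / \<sigma> k"
        by (simp add: add_divide_distrib)
      then have "\<bar>dev k w / \<sigma> k - lead k w\<bar> = \<bar>?e\<bar> / \<sigma> k"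
        using sp by simp
      also have "\<dots> \<le> \<epsilon>' / \<sigma>l" using e sl \<sigma>l_pos \<epsilon>'(1) by (intro frac_le) auto
      also have "\<dots> \<le> \<epsilon>" using \<epsilon>'(3) \<sigma>l_pos by (simp add: pos_divide_le_eq)
      finally show "\<bar>dev k w / \<sigma> k - lead k w\<bar> \<le> \<epsilon> \<and> \<bar>vhat k w - (\<sigma> k)\<^sup>2\<bar> \<le> \<epsilon>"
        using e \<epsilon>'(2) unfolding s2 by linarith
    qed
  qed
qed

lemma r_pos: "\<forall>\<^sub>F k in sequentially. r k > 0"
  using r eventually_gt_at_top[of 0] by (auto simp: filterlim_iff)

lemma weak_conv_known_variance:
  "weak_conv_m (\<lambda>k. distr (SM k) borel (\<lambda>w. dev k w / \<sigma> k)) std_normal_distribution"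
proof (rule weak_conv_std_normal_perturb[OF prob_k lead_meas _ lead_clt])
  show "\<forall>\<^sub>F k in sequentially. (\<lambda>w. dev k w / \<sigma> k) \<in> borel_measurable (SM k)"
    using r_pos by eventually_elim (use hte.alpha_check_meas[OF hte_k] in simp)
  fix x \<epsilon> :: real assume "\<epsilon> > 0"
  from lead_approx[OF this] show "\<forall>\<^sub>F k in sequentially. whp (SM k) \<epsilon> (\<lambda>w.
       (lead k w \<le> x - \<epsilon> \<longrightarrow> dev k w / \<sigma> k \<le> x) \<and>
       (dev k w / \<sigma> k \<le> x \<longrightarrow> lead k w \<le> x + \<epsilon>))"
    by eventually_elim (erule whp_mono, simp, linarith)
qed

lemma studentized_meas:
  "r k > 0 \<Longrightarrow> (\<lambda>w. dev k w / sqrt (vhat k w)) \<in> borel_measurable (SM k)"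
  using hte.alpha_check_meas[OF hte_k] hte.sigmahat2_meas[OF hte_k] by simp

lemma weak_conv_estimated_variance:
  "weak_conv_m (\<lambda>k. distr (SM k) borel (\<lambda>w. dev k w / sqrt (vhat k w))) std_normal_distribution"
proof (rule weak_conv_std_normal_perturb[OF prob_k lead_meas _ lead_clt])
  show "\<forall>\<^sub>F k in sequentially. (\<lambda>w. dev k w / sqrt (vhat k w)) \<in> borel_measurable (SM k)"
    using r_pos by eventually_elim (rule studentized_meas)
  fix x \<epsilon> :: real assume \<epsilon>: "\<epsilon> > 0"
  \<comment> \<open>Three demands: half of \<epsilon> for the numerator, positivity of the estimated
    variance, and a shift of the level x of at most \<epsilon>/2. The choice may depend on x, since
    closeness is required level by level; |x| + 1 avoids a zero denominator.\<close>
  define \<eta> where "\<eta> = min (\<epsilon> / 2) (min (\<sigma>l\<^sup>2 / 2) (\<epsilon> * \<sigma>l\<^sup>2 / (2 * (\<bar>x\<bar> + 1))))"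
  have "\<epsilon> * \<sigma>l\<^sup>2 / (2 * (\<bar>x\<bar> + 1)) > 0" using \<epsilon> \<sigma>l_pos by (intro divide_pos_pos mult_pos_pos) auto
  then have \<eta>: "\<eta> > 0" "\<eta> \<le> \<epsilon> / 2" "\<eta> < \<sigma>l\<^sup>2" "\<eta> \<le> \<epsilon> * \<sigma>l\<^sup>2 / (2 * (\<bar>x\<bar> + 1))"
    unfolding \<eta>_def using \<epsilon> \<sigma>l_pos
    by (simp, simp only: min.cobounded1, simp add: min_less_iff_disj, simp only: min.coboundedI2 min.cobounded2)
  have x\<eta>: "\<bar>x\<bar> * (\<eta> / \<sigma>l\<^sup>2) \<le> \<epsilon> / 2"
  proof -
    have "\<eta> / \<sigma>l\<^sup>2 \<le> \<epsilon> / (2 * (\<bar>x\<bar> + 1))"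
      using \<eta>(4) \<sigma>l_pos by (simp add: pos_divide_le_eq)
    then have "\<bar>x\<bar> * (\<eta> / \<sigma>l\<^sup>2) \<le> \<bar>x\<bar> * (\<epsilon> / (2 * (\<bar>x\<bar> + 1)))" by (intro mult_left_mono) auto
    also have "\<dots> \<le> (\<bar>x\<bar> + 1) * (\<epsilon> / (2 * (\<bar>x\<bar> + 1)))" using \<epsilon> by (intro mult_right_mono) auto
    also have "\<dots> = \<epsilon> / 2"
    proof -
      have "\<bar>x\<bar> + 1 \<noteq> 0" by linarith
      then show ?thesis by (simp add: divide_simps)
    qed
    finally show ?thesis .
  qed
  show "\<forall>\<^sub>F k in sequentially. whp (SM k) \<epsilon> (\<lambda>w.
       (lead k w \<le> x - \<epsilon> \<longrightarrow> dev k w / sqrt (vhat k w) \<le> x) \<and>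
       (dev k w / sqrt (vhat k w) \<le> x \<longrightarrow> lead k w \<le> x + \<epsilon>))"
    using lead_approx[OF \<eta>(1)]
  proof eventually_elim
    case (elim k)
    show ?case
    proof (rule whp_mono[OF elim])
      show "\<eta> \<le> \<epsilon>" using \<eta>(2) \<epsilon> by linarith
      fix w assume e: "\<bar>dev k w / \<sigma> k - lead k w\<bar> \<le> \<eta> \<and> \<bar>vhat k w - (\<sigma> k)\<^sup>2\<bar> \<le> \<eta>"
      note st = studentized_le_iff[OF \<sigma>l_pos sigma_lower[OF Dk] conjunct2[OF e] \<eta>(3)]
      show "(lead k w \<le> x - \<epsilon> \<longrightarrow> dev k w / sqrt (vhat k w) \<le> x) \<and> (dev k w / sqrt (vhat k w) \<le> x \<longrightarrow> lead k w \<le> x + \<epsilon>)"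
        unfolding st(2) using conjunct1[OF e] st(3)[of x] x\<eta> \<eta>(2) by linarith
    qed
  qed
qed

text \<open>The endpoints are null for the normal law, so weak convergence gives the probability
  that the studentized deviation lies in [-q, q]. Rearranging this into coverage requires a positive
  variance estimate, so the two events may differ only on the exceptional one.\<close>

lemma coverage_limit:
  assumes rk: "\<And>k. r k > 0" and q: "q > 0"
  shows "(\<lambda>k. measure (SM k)
      {w \<in> space (SM k).
         alpha0 (D k) \<in> {acheck (r k) w - q * sqrt (vhat k w) / sqrt (real (r k))
                       .. acheck (r k) w + q * sqrt (vhat k w) / sqrt (real (r k))}})
    \<longlonglongrightarrow> measure std_normal_distribution {-q..q}"
proof -
  let ?T = "\<lambda>k w. dev k w / sqrt (vhat k w)"
  define cov where "cov k = {w \<in> space (SM k).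
         alpha0 (D k) \<in> {acheck (r k) w - q * sqrt (vhat k w) / sqrt (real (r k))
                       .. acheck (r k) w + q * sqrt (vhat k w) / sqrt (real (r k))}}" for k
  define inT where "inT k = {w \<in> space (SM k). ?T k w \<in> {-q..q}}" for k
  have "(\<lambda>k. measure (distr (SM k) borel (?T k)) {-q..q}) \<longlonglongrightarrow> measure std_normal_distribution {-q..q}"
  proof (rule weak_conv_imp_continuity_set_conv[OF _ real_dist_normal_dist weak_conv_estimated_variance])
    show "real_distribution (distr (SM k) borel (?T k))" for k
      by (rule prob_space.real_distribution_distr[OF prob_k studentized_meas[OF rk]])
    have "frontier {-q..q} = {-q, q}" using q by (simp add: frontier_def interior_atLeastAtMost_real insert_commute)
    then show "emeasure std_normal_distribution (frontier {-q..q}) = 0"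
      using std_normal_null_sets_iff[of "{-q, q}"] finite_imp_null_set_lborel[of "{-q, q}"]
      by (simp add: null_sets_def)
  qed simp
  moreover have "measure (distr (SM k) borel (?T k)) {-q..q} = measure (SM k) (inT k)" for k
  proof -
    have "?T k -` {-q..q} \<inter> space (SM k) = inT k" by (auto simp: inT_def)
    then show ?thesis using studentized_meas[OF rk, of k] by (simp add: measure_distr)
  qed
  ultimately have lim: "(\<lambda>k. measure (SM k) (inT k)) \<longlonglongrightarrow> measure std_normal_distribution {-q..q}" by simp
  have "(\<lambda>k. measure (SM k) (cov k) - measure (SM k) (inT k)) \<longlonglongrightarrow> 0"
  proof (rule LIMSEQ_I)
    fix e :: real assume e: "e > 0"
    define \<eta> where "\<eta> = min (e / 2) (\<sigma>l\<^sup>2 / 2)"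
    have \<eta>: "\<eta> > 0" "\<eta> < e" "\<eta> < \<sigma>l\<^sup>2" using e \<sigma>l_pos by (auto simp: \<eta>_def min_less_iff_disj)
    have "\<forall>\<^sub>F k in sequentially. norm (measure (SM k) (cov k) - measure (SM k) (inT k) - 0) < e"
      using lead_approx[OF \<eta>(1)]
    proof eventually_elim
      case (elim k)
      interpret S: prob_space "SM k" by (rule prob_k)
      obtain B where B: "B \<in> sets (SM k)" "measure (SM k) B \<le> \<eta>"
        and Bw: "\<And>w. w \<in> space (SM k) - B \<Longrightarrow> \<bar>vhat k w - (\<sigma> k)\<^sup>2\<bar> \<le> \<eta>"
        by (rule whpE[OF elim]) (rule that, auto)
      have [measurable]: "acheck (r k) \<in> borel_measurable (SM k)" "shat2 (D k) (r k) \<in> borel_measurable (SM k)"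
        using hte.alpha_check_meas[OF hte_k rk] hte.sigmahat2_meas[OF hte_k] by auto
      have cm: "cov k \<in> sets (SM k)" unfolding cov_def atLeastAtMost_iff by measurable
      have im: "inT k \<in> sets (SM k)" unfolding inT_def atLeastAtMost_iff by measurable
      have same: "w \<in> cov k \<longleftrightarrow> w \<in> inT k" if w: "w \<in> space (SM k) - B" for w
      proof -
        \<comment> \<open>If the estimate were 0, the quotient would be 0 by the division convention
          and would lie in the interval whether or not the target is covered.\<close>
        have v: "vhat k w > 0"
          by (rule studentized_le_iff(1)[OF \<sigma>l_pos sigma_lower[OF Dk] Bw[OF w] \<eta>(3)])
        define h where "h = sqrt (vhat k w)"
        define n where "n = sqrt (real (r k))"
        have h: "h > 0" and n: "n > 0" using v rk[of k] by (auto simp: h_def n_def)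
        have "alpha0 (D k) \<in> {a - q * h / n .. a + q * h / n} \<longleftrightarrow> n * (a - alpha0 (D k)) / h \<in> {-q..q}" for a
          using h n by (auto simp: field_simps)
        then show ?thesis using w by (simp add: cov_def inT_def h_def n_def)
      qed
      have "measure (SM k) (cov k) \<le> measure (SM k) (inT k \<union> B)"
        by (rule S.finite_measure_mono) (use same im B cm sets.sets_into_space in \<open>blast+\<close>)
      also have "\<dots> \<le> measure (SM k) (inT k) + measure (SM k) B" by (rule measure_Un_le[OF im B(1)])
      finally have 1: "measure (SM k) (cov k) \<le> measure (SM k) (inT k) + \<eta>" using B(2) by linarith
      have "measure (SM k) (inT k) \<le> measure (SM k) (cov k \<union> B)"
        by (rule S.finite_measure_mono) (use same im B cm sets.sets_into_space in \<open>blast+\<close>)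
      also have "\<dots> \<le> measure (SM k) (cov k) + measure (SM k) B" by (rule measure_Un_le[OF cm B(1)])
      finally have 2: "measure (SM k) (inT k) \<le> measure (SM k) (cov k) + \<eta>" using B(2) by linarith
      show ?case using 1 2 \<eta>(2) by (simp add: abs_less_iff)
    qed
    then show "\<exists>no. \<forall>k\<ge>no. norm (measure (SM k) (cov k) - measure (SM k) (inT k) - 0) < e"
      by (simp add: eventually_sequentially)
  qed
  from tendsto_add[OF this lim] show ?thesis unfolding cov_def by simp
qed

end

section \<open>Uniform coverage and conclusion\<close>

text \<open>If the supremum stayed above some e > 0 infinitely often, nearly extremal processes
  could be picked at arbitrarily large sample sizes, and their coverage would contradict
  \<open>coverage_limit\<close>. In \<open>ennreal\<close> every supremum exists and that over an
  empty class is 0.\<close>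

lemma uniform_coverage:
  assumes q: "q > 0" and t: "measure std_normal_distribution {-q..q} = t"
  shows "(\<lambda>n. SUP D\<in>Pset n. ennreal \<bar>measure (sampleM n (lawQ D))
      {w \<in> space (sampleM n (lawQ D)).
         alpha0 D \<in> {acheck n w - q * sqrt (shat2 D n w) / sqrt (real n)
                   .. acheck n w + q * sqrt (shat2 D n w) / sqrt (real n)}} - t\<bar>) \<longlonglongrightarrow> 0"
proof -
  define cov where "cov n D = measure (sampleM n (lawQ D)) {w \<in> space (sampleM n (lawQ D)).
         alpha0 D \<in> {acheck n w - q * sqrt (shat2 D n w) / sqrt (real n)
                   .. acheck n w + q * sqrt (shat2 D n w) / sqrt (real n)}}" for n and D :: "'z dgp"
  have "(\<lambda>n. SUP D\<in>Pset n. ennreal \<bar>cov n D - t\<bar>) \<longlonglongrightarrow> 0"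
  proof (rule order_tendstoI)
    fix a :: ennreal assume a: "0 < a"
    then obtain b where b: "0 < b" "b < a" using dense by blast
    have "\<exists>e>0. ennreal e = b" using b by (cases b) (auto simp: top_unique)
    then obtain e where e: "e > 0" "ennreal e < a" using b by auto
    show "\<forall>\<^sub>F n in sequentially. (SUP D\<in>Pset n. ennreal \<bar>cov n D - t\<bar>) < a"
    proof (rule ccontr)
      assume "\<not> ?thesis"
      then have "\<forall>N. \<exists>n\<ge>N. \<not> (SUP D\<in>Pset n. ennreal \<bar>cov n D - t\<bar>) < a"
        by (simp add: eventually_sequentially)
      \<comment> \<open>\<open>Suc k\<close> rather than \<open>k\<close> makes every selected
        sample size positive, besides forcing the sequence to infinity.\<close>
      have "\<exists>n D. Suc k \<le> n \<and> D \<in> Pset n \<and> e < \<bar>cov n D - t\<bar>" for k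
      proof -
        obtain n where n: "n \<ge> Suc k" "\<not> (SUP D\<in>Pset n. ennreal \<bar>cov n D - t\<bar>) < a"
          using \<open>\<forall>N. \<exists>n\<ge>N. _ n\<close> by blast
        then have "ennreal e < (SUP D\<in>Pset n. ennreal \<bar>cov n D - t\<bar>)" using e(2) by auto
        then obtain D where "D \<in> Pset n" "ennreal e < ennreal \<bar>cov n D - t\<bar>"
          unfolding less_SUP_iff by blast
        then show ?thesis using n(1) e(1) by (auto simp: ennreal_less_iff)
      qed
      then obtain r D where rD: "\<And>k. Suc k \<le> r k" "\<And>k. D k \<in> Pset (r k)" "\<And>k. e < \<bar>cov (r k) (D k) - t\<bar>"
        by metis
      have "filterlim r at_top sequentially"
        by (rule filterlim_at_top_mono[OF filterlim_ident always_eventually]) (use rD(1) Suc_leD in blast)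
      moreover have "r k > 0" for k using rD(1)[of k] by simp
      ultimately have "(\<lambda>k. cov (r k) (D k)) \<longlonglongrightarrow> t"
        unfolding cov_def t[symmetric] using rD(2) q by (intro coverage_limit)
      then have "\<forall>\<^sub>F k in sequentially. \<bar>cov (r k) (D k) - t\<bar> < e"
        using tendstoD e(1) by (fastforce simp: dist_real_def)
      then show False using rD(3) by (auto simp: eventually_sequentially) (meson less_asym order_refl)
    qed
  qed simp
  then show ?thesis unfolding cov_def .
qed

end

theorem theorem1:
  fixes Mz :: "'z measure"
    and \<delta> \<Delta> K s :: "nat \<Rightarrow> real" and p :: "nat \<Rightarrow> nat"
    and C c c' :: real
    and Pd :: "nat \<Rightarrow> 'z \<Rightarrow> nat \<Rightarrow> real"
    and Lam :: "real \<Rightarrow> real"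
    and bghat bmhat :: "nat \<Rightarrow> (nat \<Rightarrow> 'z obs) \<Rightarrow> nat \<Rightarrow> real"
  defines "Pset \<equiv> HTE_class Mz \<delta> \<Delta> K s p C c c' Pd Lam bghat bmhat"
  assumes \<delta>_pos: "\<forall>n. \<delta> n > 0" and \<delta>_dec: "decseq \<delta>" and \<delta>_lim: "\<delta> \<longlonglongrightarrow> 0"
    and \<Delta>_pos: "\<forall>n. \<Delta> n > 0" and \<Delta>_dec: "decseq \<Delta>" and \<Delta>_lim: "\<Delta> \<longlonglongrightarrow> 0"
    and s_ge1: "\<forall>n. s n \<ge> 1"
    and C_pos: "C > 0" and c_pos: "c > 0" and c'_bounds: "0 < c'" "c' < 1/2"
    and link: "Lam = (\<lambda>u. u) \<or> Lam = logistic"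
    and Pd_meas: "\<forall>n j. (\<lambda>z. Pd n z j) \<in> borel_measurable Mz"
    and bghat_meas: "\<forall>n j. (\<lambda>w. bghat n w j) \<in> borel_measurable (PiM {..<n} (\<lambda>_. obsM Mz))"
    and bmhat_meas: "\<forall>n j. (\<lambda>w. bmhat n w j) \<in> borel_measurable (PiM {..<n} (\<lambda>_. obsM Mz))"
  shows
    "(\<forall>D :: nat \<Rightarrow> 'z dgp. (\<forall>n. D n \<in> Pset n) \<longrightarrow>
        weak_conv_m
          (\<lambda>n. distr (sampleM n (lawQ (D n))) borel
                 (\<lambda>w. sqrt (real n) * (alpha_check p Pd Lam bghat bmhat n w - alpha0 (D n))
                       / sqrt (sigma2 (D n))))
          std_normal_distribution)
   \<and> (\<forall>D :: nat \<Rightarrow> 'z dgp. (\<forall>n. D n \<in> Pset n) \<longrightarrow>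
        weak_conv_m
          (\<lambda>n. distr (sampleM n (lawQ (D n))) borel
                 (\<lambda>w. sqrt (real n) * (alpha_check p Pd Lam bghat bmhat n w - alpha0 (D n))
                       / sqrt (sigmahat2 p Pd Lam bghat bmhat (D n) n w)))
          std_normal_distribution)
   \<and> (\<forall>\<xi>. 0 < \<xi> \<and> \<xi> < 1 \<longrightarrow>
        (\<lambda>n. SUP D\<in>Pset n.
            ennreal \<bar>measure (sampleM n (lawQ D))
                {w \<in> space (sampleM n (lawQ D)).
                   alpha0 D \<in> {alpha_check p Pd Lam bghat bmhat n w
                                 - Phi_inv (1 - \<xi>/2) * sqrt (sigmahat2 p Pd Lam bghat bmhat D n w) / sqrt (real n)
                              .. alpha_check p Pd Lam bghat bmhat n w
                                 + Phi_inv (1 - \<xi>/2) * sqrt (sigmahat2 p Pd Lam bghat bmhat D n w) / sqrt (real n)}}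
              - (1 - \<xi>)\<bar>)
        \<longlonglongrightarrow> 0)"
  proof -
  interpret hte_seq Mz \<delta> \<Delta> K s p C c c' Pd Lam bghat bmhat
    using assms by unfold_locales auto
  show ?thesis
    unfolding Pset_def
  proof (intro conjI allI impI)
    fix D :: "nat \<Rightarrow> 'z dgp"
    assume D: "\<forall>n. D n \<in> HTE_class Mz \<delta> \<Delta> K s p C c c' Pd Lam bghat bmhat n"
    show "weak_conv_m (\<lambda>n. distr (sampleM n (lawQ (D n))) borel
        (\<lambda>w. sqrt (real n) * (acheck n w - alpha0 (D n)) / sqrt (sigma2 (D n)))) std_normal_distribution"
      \<comment> \<open>A sequence with one process per n is the case where the index sequence is
        the identity.\<close>
      by (rule weak_conv_known_variance[OF filterlim_ident]) (use D in blast)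
    show "weak_conv_m (\<lambda>n. distr (sampleM n (lawQ (D n))) borel
        (\<lambda>w. sqrt (real n) * (acheck n w - alpha0 (D n)) / sqrt (shat2 (D n) n w))) std_normal_distribution"
      by (rule weak_conv_estimated_variance[OF filterlim_ident]) (use D in blast)
  next
    fix \<xi> :: real assume "0 < \<xi> \<and> \<xi> < 1"
    then show "(\<lambda>n. SUP D\<in>HTE_class Mz \<delta> \<Delta> K s p C c c' Pd Lam bghat bmhat n.
        ennreal \<bar>measure (sampleM n (lawQ D))
        {w \<in> space (sampleM n (lawQ D)). alpha0 D \<in>
            {acheck n w - Phi_inv (1 - \<xi>/2) * sqrt (shat2 D n w) / sqrt (real n)
             .. acheck n w + Phi_inv (1 - \<xi>/2) * sqrt (shat2 D n w) / sqrt (real n)}} - (1 - \<xi>)\<bar>) \<longlonglongrightarrow> 0"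
      by (intro uniform_coverage std_normal_symmetric_interval) auto
  qed
qed

end
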